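(* Let $X$ be a Banach space and let $L$ be the infinitesimal generator of a uniformly bounded $C_0$-semigroup $\{e^{tL}\}_{t\ge0}$ on $X$. Assume that $0\in\rho(L)$. For $0<s<1$ and $u\in X$, let $$U(y)=U[u](y)=\frac{y^{2s}}{4^s\Gamma(s)}\int_0^\infty e^{-y^2/(4t)}e^{tL}u\,\frac{dt}{t^{1+s}},\qquad y>0.$$ The following statements hold. (a) If $u\in D((-L)^s)$ and $f=(-L)^su$ then $$\begin{aligned}U(y)&=u+\frac{1}{\Gamma(s)}\int_0^\infty\big(e^{-y^2/(4t)}-1\big)e^{tL}f\,\frac{dt}{t^{1-s}}\\&=u+\frac{y^{2s}}{4^s\Gamma(s)}\int_0^\infty\big(e^{-r}-1\big)e^{\frac{y^2}{4r}L}f\,\frac{dr}{r^{1+s}}.\end{aligned}$$ (b) $u\in D((-L)^s)$ if and only if the limit $\lim_{y\to0}y^{1-2s}\partial_yU(y)$ exists in $X$, and also if and only if the limit $\lim_{y\to0}\frac{U(y)-u}{y^{2s}}$ exists in $X$; and, in this case, $$\lim_{y\to0}y^{1-2s}\partial_yU(y)=c_s(-L)^su=2s\lim_{y\to0}\frac{U(y)-u}{y^{2s}}\quad\text{in } X,$$ where $c_s=\frac{-\Gamma(1-s)}{4^{s-1/2}\Gamma(s)}$. (c) If $u\in D((-L)^s)$ then $U$ is the unique classical solution to the second order initial value problem $$\begin{cases}LU+\frac{1-2s}{y}\partial_yU+\partial_{yy}U=0 & \text{for } y>0\\ \lim_{y\to0}U(y)=u & \text{in } X\\ \lim_{y\to0}y^{1-2s}\partial_yU(y)=c_s(-L)^su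 & \text{in } X.\end{cases}$$
   Context: A $C_0$-semigroup $\{e^{tL}\}_{t\ge0}$ is uniformly bounded if there is $M\ge1$ with $\|e^{tL}\|\le M$ for all $t\ge0$. $\rho(L)$ is the resolvent set of $L$ and $D(\cdot)$ denotes the domain of an operator ($D(L)$ carries the graph norm). Integrals of $X$-valued functions are Bochner integrals. Fractional powers. If $L$ generates a uniformly bounded $C_0$-semigroup, $A=-L$ is a nonnegative operator, i.e. $(-\infty,0)\subset\rho(A)$ and $\sup_{\mu>0}\|\mu(\mu I+A)^{-1}\|<\infty$. For a bounded nonnegative operator $B$ on $X$ and $0<s<1$ put $B^su=\frac{\sin(s\pi)}{\pi}\int_0^\infty\mu^{s-1}(\mu I+B)^{-1}Bu\,d\mu$. When $0\in\rho(A)$, $B=A^{-1}$ is bounded and nonnegative, $(A^{-1})^s$ is injective, and one defines $A^s=[(A^{-1})^s]^{-1}$ with domain $D(A^s)=R((A^{-1})^s)$ (the range). Thus $(-L)^s=A^s$ with $A=-L$. A classical solution is a function $U\in C^2((0,\infty);X)\cap C((0,\infty);D(L))$ satisfying the equation for $y>0$ and whose initial conditions are satisfied with continuity up to $y=0$, i.e. the limits as $y\to0$ exist in $X$ and have the prescribed values. *)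

theory Defs
  imports "HOL-Analysis.Analysis"
begin

text \<open>
  The library's \<^const>\<open>has_bochner_integral\<close> requires a second countable (i.e. separable) target
  space.  The following is the same definition without that restriction.  It does not force
  separability: the \<open>L\<^sup>1\<close> approximation by simple functions already makes the integrand
  almost everywhere separably valued.
\<close>

definition has_Bochner_int :: "'b measure \<Rightarrow> ('b \<Rightarrow> 'a::real_normed_vector) \<Rightarrow> 'a \<Rightarrow> bool" where
  "has_Bochner_int M f x \<longleftrightarrow>
     f \<in> borel_measurable M \<and>
     (\<exists>S. (\<forall>i. Bochner_Integration.simple_bochner_integrable M (S i)) \<and>
          (\<lambda>i. \<integral>\<^sup>+t. ennreal (norm (f t - S i t)) \<partial>M) \<longlonglongrightarrow> 0 \<and>
          (\<lambda>i. Bochner_Integration.simple_bochner_integral M (S i)) \<longlonglongrightarrow> x)"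

lemma has_Bochner_int_iff_has_bochner_integral:
  fixes f :: "'b \<Rightarrow> 'a::{real_normed_vector, second_countable_topology}"
  shows "has_Bochner_int M f x \<longleftrightarrow> has_bochner_integral M f x"
  unfolding has_Bochner_int_def has_bochner_integral.simps by blast

definition Bochner_integrable :: "'b measure \<Rightarrow> ('b \<Rightarrow> 'a::real_normed_vector) \<Rightarrow> bool" where
  "Bochner_integrable M f \<longleftrightarrow> (\<exists>x. has_Bochner_int M f x)"

definition Bochner_int :: "'b measure \<Rightarrow> ('b \<Rightarrow> 'a::real_normed_vector) \<Rightarrow> 'a" where
  "Bochner_int M f = (if Bochner_integrable M f then THE x. has_Bochner_int M f x else 0)"

abbreviation integrable_pos :: "(real \<Rightarrow> 'a::real_normed_vector) \<Rightarrow> bool" where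
  "integrable_pos f \<equiv> Bochner_integrable (lebesgue_on {0<..}) f"

abbreviation int_pos :: "(real \<Rightarrow> 'a::real_normed_vector) \<Rightarrow> 'a" where
  "int_pos f \<equiv> Bochner_int (lebesgue_on {0<..}) f"

text \<open>A semigroup is a function on all reals of which only the values at \<open>t \<ge> 0\<close> matter.\<close>

definition C0_semigroup :: "(real \<Rightarrow> ('a::real_normed_vector \<Rightarrow>\<^sub>L 'a)) \<Rightarrow> bool" where
  "C0_semigroup T \<longleftrightarrow>
     T 0 = id_blinfun \<and>
     (\<forall>t\<ge>0. \<forall>r\<ge>0. T (t + r) = T t o\<^sub>L T r) \<and>
     (\<forall>x. ((\<lambda>t. T t x) \<longlongrightarrow> x) (at_right 0))"

definition uniformly_bounded :: "(real \<Rightarrow> ('a::real_normed_vector \<Rightarrow>\<^sub>L 'a)) \<Rightarrow> bool" where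
  "uniformly_bounded T \<longleftrightarrow> (\<exists>M\<ge>1. \<forall>t\<ge>0. norm (T t) \<le> M)"

text \<open>
  An unbounded operator is given by its domain \<open>D\<close> and a total function \<open>L\<close> whose values outside
  \<open>D\<close> are irrelevant.
\<close>

definition is_generator ::
  "'a::real_normed_vector set \<Rightarrow> ('a \<Rightarrow> 'a) \<Rightarrow> (real \<Rightarrow> ('a \<Rightarrow>\<^sub>L 'a)) \<Rightarrow> bool" where
  "is_generator D L T \<longleftrightarrow>
     D = {x. \<exists>l. ((\<lambda>h. (T h x - x) /\<^sub>R h) \<longlongrightarrow> l) (at_right 0)} \<and>
     (\<forall>x\<in>D. ((\<lambda>h. (T h x - x) /\<^sub>R h) \<longlongrightarrow> L x) (at_right 0))"

definition is_bounded_inverse ::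
  "'a::real_normed_vector set \<Rightarrow> ('a \<Rightarrow> 'a) \<Rightarrow> ('a \<Rightarrow>\<^sub>L 'a) \<Rightarrow> bool" where
  "is_bounded_inverse D A R \<longleftrightarrow> (\<forall>x. R x \<in> D \<and> A (R x) = x) \<and> (\<forall>x\<in>D. R (A x) = x)"

definition bounded_inverse ::
  "'a::real_normed_vector set \<Rightarrow> ('a \<Rightarrow> 'a) \<Rightarrow> ('a \<Rightarrow>\<^sub>L 'a)" where
  "bounded_inverse D A = (THE R. is_bounded_inverse D A R)"

text \<open>Only the real points of the resolvent set are needed.\<close>

definition resolvent_set :: "'a::real_normed_vector set \<Rightarrow> ('a \<Rightarrow> 'a) \<Rightarrow> real set" where
  "resolvent_set D A = {\<mu>. \<exists>R. is_bounded_inverse D (\<lambda>x. \<mu> *\<^sub>R x - A x) R}"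

definition bounded_frac_power ::
  "('a::real_normed_vector \<Rightarrow>\<^sub>L 'a) \<Rightarrow> real \<Rightarrow> 'a \<Rightarrow> 'a" where
  "bounded_frac_power B s u =
     (sin (s * pi) / pi) *\<^sub>R
       int_pos (\<lambda>\<mu>. \<mu> powr (s - 1) *\<^sub>R bounded_inverse UNIV (\<lambda>x. \<mu> *\<^sub>R x + B x) (B u))"

text \<open>
  The power \<open>A\<^sup>s\<close> of an operator \<open>A\<close> with domain \<open>D\<close> and \<open>0\<close> in its resolvent set, as the inverse of
  \<open>(A\<^sup>-\<^sup>1)\<^sup>s\<close>.
\<close>

definition frac_power_domain ::
  "'a::real_normed_vector set \<Rightarrow> ('a \<Rightarrow> 'a) \<Rightarrow> real \<Rightarrow> 'a set" where
  "frac_power_domain D A s = range (bounded_frac_power (bounded_inverse D A) s)"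

definition frac_power ::
  "'a::real_normed_vector set \<Rightarrow> ('a \<Rightarrow> 'a) \<Rightarrow> real \<Rightarrow> 'a \<Rightarrow> 'a" where
  "frac_power D A s = inv (bounded_frac_power (bounded_inverse D A) s)"

definition ext_integrand ::
  "(real \<Rightarrow> ('a::real_normed_vector \<Rightarrow>\<^sub>L 'a)) \<Rightarrow> real \<Rightarrow> 'a \<Rightarrow> real \<Rightarrow> real \<Rightarrow> 'a" where
  "ext_integrand T s u y t = (exp (- (y\<^sup>2 / (4 * t))) / t powr (1 + s)) *\<^sub>R T t u"

definition ext ::
  "(real \<Rightarrow> ('a::real_normed_vector \<Rightarrow>\<^sub>L 'a)) \<Rightarrow> real \<Rightarrow> 'a \<Rightarrow> real \<Rightarrow> 'a" where
  "ext T s u y =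
     (y powr (2 * s) / (4 powr s * Gamma s)) *\<^sub>R int_pos (ext_integrand T s u y)"

definition c_const :: "real \<Rightarrow> real" where
  "c_const s = - Gamma (1 - s) / (4 powr (s - 1 / 2) * Gamma s)"

definition graph_norm :: "('a::real_normed_vector \<Rightarrow> 'a) \<Rightarrow> 'a \<Rightarrow> real" where
  "graph_norm L x = norm x + norm (L x)"

definition continuous_into_domain ::
  "'a::real_normed_vector set \<Rightarrow> ('a \<Rightarrow> 'a) \<Rightarrow> (real \<Rightarrow> 'a) \<Rightarrow> bool" where
  "continuous_into_domain D L V \<longleftrightarrow>
     (\<forall>y>0. V y \<in> D) \<and> (\<forall>y>0. ((\<lambda>z. graph_norm L (V z - V y)) \<longlongrightarrow> 0) (at y))"

text \<open>\<open>V1\<close> and \<open>V2\<close> are the first and second derivatives; continuity of \<open>V2\<close> is the \<open>C\<^sup>2\<close> condition.\<close>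

definition classical_solution ::
  "'a::real_normed_vector set \<Rightarrow> ('a \<Rightarrow> 'a) \<Rightarrow> real \<Rightarrow> 'a \<Rightarrow> 'a \<Rightarrow> (real \<Rightarrow> 'a) \<Rightarrow> bool" where
  "classical_solution D L s u g V \<longleftrightarrow>
     continuous_into_domain D L V \<and>
     (\<exists>V1 V2.
        (\<forall>y>0. (V has_vector_derivative V1 y) (at y)) \<and>
        (\<forall>y>0. (V1 has_vector_derivative V2 y) (at y)) \<and>
        continuous_on {0<..} V2 \<and>
        (\<forall>y>0. L (V y) + ((1 - 2 * s) / y) *\<^sub>R V1 y + V2 y = 0) \<and>
        (V \<longlongrightarrow> u) (at_right 0) \<and>
        ((\<lambda>y. y powr (1 - 2 * s) *\<^sub>R V1 y) \<longlongrightarrow> g) (at_right 0))"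

end

theory Submission
  imports Defs "HOL-Real_Asymp.Real_Asymp"
begin

text \<open>
  Let \<open>B = (-L)\<^sup>-\<^sup>1\<close>.  All integrands are continuous on \<open>(0, \<infinity>)\<close> with integrable norm, so a Bochner
  integral is a limit of integrals over \<open>[1/n, n]\<close>.  Writing \<open>R(\<lambda>) = (\<lambda> - L)\<^sup>-\<^sup>1\<close>, the substitution
  \<open>\<mu> = 1/\<lambda>\<close> turns the definition of \<open>u = B\<^sup>s f\<close> into \<open>sin(\<pi> s)/\<pi> \<integral> \<lambda>\<^sup>-\<^sup>s R(\<lambda>) f d\<lambda>\<close>.  Replacing \<open>L\<close> by
  \<open>L - \<epsilon>\<close> makes all double integrals absolutely convergent; by Fubini \<open>u\<^sub>\<epsilon>\<close> is then
  \<open>1/\<Gamma>(s) \<integral> t\<^sup>s\<^sup>-\<^sup>1 e\<^sup>-\<^sup>\<epsilon>\<^sup>t T(t) f dt\<close> and its extension is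
  \<open>1/\<Gamma>(s) \<integral> e\<^bsup>-y\<^sup>2/4t\<^esup> t\<^sup>s\<^sup>-\<^sup>1 e\<^sup>-\<^sup>\<epsilon>\<^sup>t T(t) f dt\<close>.  The difference of the two converges as \<open>\<epsilon> \<rightarrow> 0\<close>, which is
  (a), and the substitution \<open>t = y\<^sup>2/4r\<close> followed by dominated convergence gives the limits in (b).
  Conversely \<open>B\<^sup>s\<close> commutes with the extension, so if \<open>l\<close> is one of the limits in (b) for an arbitrary
  \<open>u\<close>, applying (b) to \<open>B\<^sup>s u\<close> shows that \<open>B\<^sup>s l\<close> is a nonzero multiple of \<open>u\<close>.

  For uniqueness, let \<open>Z\<close> be the difference of two solutions.  Since \<open>Z = B(Z'' + (1 - 2s)/y Z')\<close>,
  integrating twice for every factor \<open>B\<close> yields \<open>\<parallel>B\<^sup>n Z(y)\<parallel> \<le> N q\<^sup>n / (n!)\<^sup>2\<close>.  This forces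
  \<open>(\<lambda> R(\<lambda>))\<^sup>n Z(y) \<rightarrow> 0\<close> for \<open>\<lambda> = n/t\<close>, whereas \<open>(\<lambda> R(\<lambda>))\<^sup>n B x\<close> stays within \<open>M\<^sup>2 t \<parallel>x\<parallel>\<close> of \<open>B x\<close>;
  hence \<open>B Z(y) = 0\<close>.
\<close>

section \<open>Bochner integrals of continuous functions on the half-line\<close>

text \<open>Boundedness of \<open>T\<close> gives no decay, so
  \<open>t powr (s - 1) *\<^sub>R T t f\<close> need not be absolutely integrable at infinity, and
  Fubini cannot be applied to it directly. The formula with the resolvent R(z) does converge,
  because 0 in the resolvent set bounds R(z) by a multiple of 1/(1 + z)
  (\<open>norm_R_le_div\<close>). There the factor exp(-e t) becomes a shift z + e, and the majorant
  is uniform in e. Subtracting 1 from exp(-y^2/(4t)) gains a factor 1/t at infinity, which is why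
  the weights in (a) are integrable without regularisation. For uniqueness, both data are prescribed
  at y = 0 and nothing at infinity, so no decay argument is at hand; powers of B trade the unbounded
  L for bounded operators. The square of n! is essential: with z = n/t the factor z^n costs n^n <=
  exp(n) n!, and the second n! still sends the bound to 0.\<close>

abbreviation "simple_bochner \<equiv> Bochner_Integration.simple_bochner_integrable"
abbreviation "simple_bochner_int \<equiv> Bochner_Integration.simple_bochner_integral"

text \<open>When \<open>'a\<close> is not separable, a difference of two Borel measurable functions
  may fail to be measurable. Here \<open>S\<close> has finitely many values, so the norm is glued
  from the measurable functions \<open>norm (f x - c)\<close>, one for each value
  \<open>c\<close>.\<close>

lemma borel_measurable_norm_diff_simple:
  fixes f :: "'b \<Rightarrow> 'a::real_normed_vector"
  assumes f: "f \<in> borel_measurable M" and S: "simple_function M S"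
  shows "(\<lambda>x. norm (f x - S x)) \<in> borel_measurable M"
proof -
  have "(\<lambda>x. norm (f x - c)) \<in> borel_measurable M" for c
  proof -
    have "(\<lambda>z. norm (z - c)) \<in> borel_measurable borel"
      by (intro borel_measurable_continuous_onI continuous_intros)
    from measurable_compose[OF f this] show ?thesis by simp
  qed
  moreover have "S \<in> measurable M (count_space (S ` space M))"
    using simple_functionD[OF S] measurable_simple_function[OF S]
    by (intro measurable_count_space_eq2[THEN iffD2]) (auto intro: simple_functionD(2)[OF S])
  ultimately show ?thesis
    using simple_functionD(1)[OF S]
    by (intro measurable_compose_countable'[where f="\<lambda>c x. norm (f x - c)" and g=S and I="S ` space M"])
       (auto intro: countable_finite)
qed

text \<open>The triangle inequality through the common \<open>f\<close>. It yields both the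
  uniqueness of the integral and the Cauchy property of the integrals of approximating step
  functions.\<close>

lemma norm_simple_bochner_integral_diff_le:
  fixes f :: "'b \<Rightarrow> 'a::real_normed_vector"
  assumes f: "f \<in> borel_measurable M"
    and S: "simple_bochner M S" "simple_bochner M S'"
  shows "ennreal (norm (simple_bochner_int M S - simple_bochner_int M S'))
    \<le> (\<integral>\<^sup>+x. ennreal (norm (f x - S x)) \<partial>M) + (\<integral>\<^sup>+x. ennreal (norm (f x - S' x)) \<partial>M)"
proof -
  have sf: "simple_function M S" "simple_function M S'"
    using S by (auto elim: simple_bochner_integrable.cases)
  note [measurable] = borel_measurable_norm_diff_simple[OF f sf(1)] borel_measurable_norm_diff_simple[OF f sf(2)]
  have d: "simple_bochner M (\<lambda>x. S x - S' x)"
    by (intro simple_bochner_integrable_compose2[where p="(-)"] S) simp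
  have "ennreal (norm (simple_bochner_int M S - simple_bochner_int M S'))
     \<le> ennreal (simple_bochner_int M (\<lambda>x. norm (S x - S' x)))"
    using simple_bochner_integral_norm_bound[OF d]
    by (simp add: simple_bochner_integral_diff[OF S])
  also have "\<dots> = (\<integral>\<^sup>+x. ennreal (norm (S x - S' x)) \<partial>M)"
    by (intro simple_bochner_integral_eq_nn_integral
        simple_bochner_integrable_compose2[where p="\<lambda>x y. norm (x - y)"] S) auto
  also have "\<dots> \<le> (\<integral>\<^sup>+x. ennreal (norm (f x - S x)) + ennreal (norm (f x - S' x)) \<partial>M)"
  proof (rule nn_integral_mono)
    fix x
    have "norm (S x - S' x) \<le> norm (f x - S x) + norm (f x - S' x)"
      by (metis norm_minus_commute norm_diff_triangle_le order_refl)
    then show "ennreal (norm (S x - S' x)) \<le> ennreal (norm (f x - S x)) + ennreal (norm (f x - S' x))"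
      by (simp flip: ennreal_plus)
  qed
  also have "\<dots> = (\<integral>\<^sup>+x. ennreal (norm (f x - S x)) \<partial>M) + (\<integral>\<^sup>+x. ennreal (norm (f x - S' x)) \<partial>M)"
    by (rule nn_integral_add) auto
  finally show ?thesis .
qed

lemma has_Bochner_int_unique:
  assumes "has_Bochner_int M f x" "has_Bochner_int M f y"
  shows "x = y"
proof -
  from assms(1) obtain S where f: "f \<in> borel_measurable M"
    and S: "\<And>i. simple_bochner M (S i)"
    "(\<lambda>i. \<integral>\<^sup>+t. ennreal (norm (f t - S i t)) \<partial>M) \<longlonglongrightarrow> 0"
    "(\<lambda>i. simple_bochner_int M (S i)) \<longlonglongrightarrow> x"
    unfolding has_Bochner_int_def by blast
  from assms(2) obtain S' where S': "\<And>i. simple_bochner M (S' i)"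
    "(\<lambda>i. \<integral>\<^sup>+t. ennreal (norm (f t - S' i t)) \<partial>M) \<longlonglongrightarrow> 0"
    "(\<lambda>i. simple_bochner_int M (S' i)) \<longlonglongrightarrow> y"
    unfolding has_Bochner_int_def by blast
  let ?d = "\<lambda>i. norm (simple_bochner_int M (S i) - simple_bochner_int M (S' i))"
  have "(\<lambda>i. ennreal (?d i)) \<longlonglongrightarrow> 0"
  proof (rule tendsto_sandwich[OF _ _ tendsto_const])
    show "(\<lambda>i. (\<integral>\<^sup>+t. ennreal (norm (f t - S i t)) \<partial>M) + (\<integral>\<^sup>+t. ennreal (norm (f t - S' i t)) \<partial>M)) \<longlonglongrightarrow> 0"
      using tendsto_add[OF S(2) S'(2)] by simp
  qed (auto intro!: always_eventually norm_simple_bochner_integral_diff_le[OF f S(1) S'(1)])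
  then have "?d \<longlonglongrightarrow> 0"
    by (simp add: tendsto_ennreal_iff[where x=0, simplified] flip: ennreal_0)
  moreover have "?d \<longlonglongrightarrow> norm (x - y)"
    by (intro tendsto_intros S(3) S'(3))
  ultimately have "norm (x - y) = 0"
    using LIMSEQ_unique by blast
  then show ?thesis by simp
qed

lemma Bochner_int_eq: "has_Bochner_int M f x \<Longrightarrow> Bochner_int M f = x"
  unfolding Bochner_int_def Bochner_integrable_def
  by (auto intro: has_Bochner_int_unique)

lemma simple_bochner_integral_indicator:
  fixes c :: "'a::real_normed_vector"
  assumes A: "A \<in> sets M" "emeasure M A < \<infinity>"
  shows "simple_bochner M (\<lambda>t. indicator A t *\<^sub>R c)"
    and "simple_bochner_int M (\<lambda>t. indicator A t *\<^sub>R c) = measure M A *\<^sub>R c"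
proof -
  have i: "simple_bochner M (indicat_real A)"
  proof
    have "{y \<in> space M. indicat_real A y \<noteq> 0} = A"
      using sets.sets_into_space[OF A(1)] by (auto simp: indicator_def)
    then show "emeasure M {y \<in> space M. indicat_real A y \<noteq> 0} \<noteq> \<infinity>"
      using A by simp
  qed (use A in auto)
  have "ennreal (simple_bochner_int M (indicat_real A)) = emeasure M A"
    using simple_bochner_integral_eq_nn_integral[OF i] A
    by (simp add: ennreal_indicator)
  then have e: "simple_bochner_int M (indicat_real A) = measure M A"
    by (metis simple_bochner_integral_nonneg indicator_pos_le measure_eq_emeasure_eq_ennreal)
  show "simple_bochner M (\<lambda>t. indicator A t *\<^sub>R c)"
    by (rule simple_bochner_integrable_compose2[where p="\<lambda>x y. x *\<^sub>R c", OF _ i i]) simp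
  show "simple_bochner_int M (\<lambda>t. indicator A t *\<^sub>R c) = measure M A *\<^sub>R c"
    using simple_bochner_integral_linear[OF _ i, of "\<lambda>r. r *\<^sub>R c"] e
    by (simp add: linear_iff scaleR_add_left)
qed

section \<open>Step-function approximation on compact intervals\<close>

abbreviation pos_measure :: "real measure" where
  "pos_measure \<equiv> lebesgue_on {0<..}"

text \<open>Interval induction (\<open>Bolzano\<close>): the property passes to unions of adjacent
  intervals and holds on short ones by continuity at a point. Half-open pieces keep adjacent
  supports disjoint. The last conclusion ties the simple integral to the gauge integral, so that it
  can be compared with \<open>integral {a..b} f\<close>.\<close>

lemma simple_approx_continuous:
  fixes f :: "real \<Rightarrow> 'a::banach"
  assumes f: "continuous_on {a..b} f" and ab: "0 < a" "a \<le> b" and e: "0 < e"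
  obtains S where "simple_bochner pos_measure S"
    "\<And>t. t \<notin> {a<..b} \<Longrightarrow> S t = 0" "\<And>t. t \<in> {a<..b} \<Longrightarrow> norm (f t - S t) \<le> e"
    "(S has_integral simple_bochner_int pos_measure S) {a..b}"
proof -
  \<comment> \<open>Integrating over \<open>UNIV\<close> in \<open>Q\<close> lets step functions on
    adjacent intervals be added directly. The guard in \<open>P\<close> keeps every interval inside
    \<open>{a..b}\<close>, where \<open>f\<close> is continuous.\<close>
  define Q where "Q c d S \<longleftrightarrow> simple_bochner pos_measure S \<and>
    (\<forall>t. t \<notin> {c<..d} \<longrightarrow> S t = 0) \<and> (\<forall>t\<in>{c<..d}. norm (f t - S t) \<le> e) \<and>
    (S has_integral simple_bochner_int pos_measure S) UNIV" for c d S
  define P where "P c d \<longleftrightarrow> (a \<le> c \<and> d \<le> b \<longrightarrow> (\<exists>S. Q c d S))" for c d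
  have "P a b"
  proof (rule Bolzano[OF ab(2)])
    fix x y z assume P: "P x y" "P y z" and xyz: "x \<le> y" "y \<le> z"
    show "P x z"
      unfolding P_def
    proof
      assume "a \<le> x \<and> z \<le> b"
      with P xyz obtain S S' where "Q x y S" "Q y z S'"
        unfolding P_def by (metis order_trans)
      then have S: "simple_bochner pos_measure S"
        "\<And>t. t \<notin> {x<..y} \<Longrightarrow> S t = 0" "\<And>t. t \<in> {x<..y} \<Longrightarrow> norm (f t - S t) \<le> e"
        "(S has_integral simple_bochner_int pos_measure S) UNIV" and
        S': "simple_bochner pos_measure S'"
        "\<And>t. t \<notin> {y<..z} \<Longrightarrow> S' t = 0" "\<And>t. t \<in> {y<..z} \<Longrightarrow> norm (f t - S' t) \<le> e"
        "(S' has_integral simple_bochner_int pos_measure S') UNIV"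
        unfolding Q_def by blast+
      have n: "norm (f t - (S t + S' t)) \<le> e" if "t \<in> {x<..z}" for t
        using that S(2,3)[of t] S'(2,3)[of t] by (cases "t \<le> y") auto
      show "\<exists>S. Q x z S"
        unfolding Q_def
      proof (intro exI[of _ "\<lambda>t. S t + S' t"] conjI allI impI ballI)
        show "simple_bochner pos_measure (\<lambda>t. S t + S' t)"
          by (rule simple_bochner_integrable_compose2[where p="(+)", OF _ S(1) S'(1)]) simp
        show "((\<lambda>t. S t + S' t) has_integral
            simple_bochner_int pos_measure (\<lambda>t. S t + S' t)) UNIV"
          using has_integral_add[OF S(4) S'(4)]
          by (simp add: simple_bochner_integral_add[OF S(1) S'(1)])
        show "S t + S' t = 0" if "t \<notin> {x<..z}" for t
          using that S(2)[of t] S'(2)[of t] xyz by (cases "t \<le> y") auto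
      qed (rule n)
    qed
  next
    fix x assume x: "a \<le> x" "x \<le> b"
    obtain d where d: "d > 0" "\<And>t. t \<in> {a..b} \<Longrightarrow> dist t x < d \<Longrightarrow> dist (f t) (f x) < e"
      using f[unfolded continuous_on_iff, rule_format, of x e] x e by auto
    have "P p q" if pq: "p \<le> x \<and> x \<le> q \<and> q - p < d" for p q
      unfolding P_def
    proof
      assume *: "a \<le> p \<and> q \<le> b"
      have m: "{p<..q} \<in> sets pos_measure" "emeasure pos_measure {p<..q} < \<infinity>" "measure pos_measure {p<..q} = q - p"
      proof -
        have i: "{0::real<..} \<inter> space lebesgue \<in> sets lebesgue" "{p<..q} \<subseteq> {0::real<..}"
          using * ab by auto
        show "{p<..q} \<in> sets pos_measure"
          using i by (subst sets_restrict_space_iff) auto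
        show "emeasure pos_measure {p<..q} < \<infinity>" "measure pos_measure {p<..q} = q - p"
          using pq by (auto simp: emeasure_restrict_space[OF i] measure_restrict_space[OF i])
      qed
      have "((\<lambda>t. indicator {p..q} t *\<^sub>R f x) has_integral (q - p) *\<^sub>R f x) UNIV"
      proof -
        have "(\<lambda>t. indicator {p..q} t *\<^sub>R f x) = (\<lambda>t. if t \<in> {p..q} then f x else 0)"
          by (auto simp: indicator_def)
        then show ?thesis
          using pq has_integral_const_real[of "f x" p q] by (simp only: has_integral_restrict_UNIV) simp
      qed
      then have "((\<lambda>t. indicator {p<..q} t *\<^sub>R f x) has_integral (q - p) *\<^sub>R f x) UNIV"
        by (rule has_integral_spike_finite[of "{p}", rotated 2]) (auto simp: indicator_def)
      moreover have "norm (f t - f x) \<le> e" if "t \<in> {p<..q}" for t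
        using d(2)[of t] that pq * by (auto simp: dist_norm intro: less_imp_le)
      ultimately show "\<exists>S. Q p q S"
        unfolding Q_def using simple_bochner_integral_indicator[OF m(1,2), of "f x"] m(3)
        by (intro exI[of _ "\<lambda>t. indicator {p<..q} t *\<^sub>R f x"]) auto
    qed
    with d(1) show "\<exists>d>0. \<forall>p q. p \<le> x \<and> x \<le> q \<and> q - p < d \<longrightarrow> P p q" by blast
  qed
  then obtain S where S: "simple_bochner pos_measure S"
    "\<And>t. t \<notin> {a<..b} \<Longrightarrow> S t = 0" "\<And>t. t \<in> {a<..b} \<Longrightarrow> norm (f t - S t) \<le> e"
    "(S has_integral simple_bochner_int pos_measure S) UNIV"
    unfolding P_def Q_def by blast
  have "(S has_integral simple_bochner_int pos_measure S) {a..b}"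
  proof (subst has_integral_restrict_UNIV[symmetric], rule has_integral_eq[OF _ S(4)])
    show "S t = (if t \<in> {a..b} then S t else 0)" for t
      using S(2)[of t] by auto
  qed
  from that[OF S(1-3) this] show ?thesis .
qed

text \<open>Integrability is asked only of the real function \<open>norm (f t)\<close>, and
  measurability of \<open>f\<close> comes from continuity. Membership is thus a scalar domination
  estimate.\<close>

definition cont_integrable :: "(real \<Rightarrow> 'a::real_normed_vector) \<Rightarrow> bool" where
  "cont_integrable f \<longleftrightarrow> continuous_on {0<..} f \<and> integrable pos_measure (\<lambda>t. norm (f t))"

text \<open>With \<open>Suc n\<close> the endpoints are positive and ordered from n = 0 on, where
  the interval is the single point 1.\<close>

abbreviation inv_interval :: "nat \<Rightarrow> real set" where
  "inv_interval n \<equiv> {1 / real (Suc n)..real (Suc n)}"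

lemma inv_interval_subset: "inv_interval n \<subseteq> {0<..}"
proof
  fix x assume "x \<in> inv_interval n"
  then have "0 < 1 / real (Suc n)" "1 / real (Suc n) \<le> x" by auto
  then show "x \<in> {0<..}" by (simp only: greaterThan_iff)
qed

lemma inv_interval_nonempty: "1 / real (Suc n) \<le> real (Suc n)"
  by (simp add: field_simps)

lemma inv_interval_mono: "m \<le> n \<Longrightarrow> inv_interval m \<subseteq> inv_interval n"
  by (auto simp: frac_le order_trans)

lemma eventually_in_inv_interval:
  assumes "0 < t" shows "\<forall>\<^sub>F n in sequentially. t \<in> {1 / real (Suc n)<..real (Suc n)}"
proof -
  have "(\<lambda>n. inverse (real (Suc n))) \<longlonglongrightarrow> 0" by (rule LIMSEQ_inverse_real_of_nat)
  then have "\<forall>\<^sub>F n in sequentially. inverse (real (Suc n)) < t"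
    using assms by (rule order_tendstoD)
  moreover have "\<forall>\<^sub>F n in sequentially. t \<le> real n"
    using filterlim_real_sequentially unfolding filterlim_at_top by blast
  ultimately show ?thesis
    by eventually_elim (auto simp: inverse_eq_divide)
qed

lemma cont_integrable_measurable:
  "cont_integrable f \<Longrightarrow> f \<in> borel_measurable pos_measure"
  unfolding cont_integrable_def by (intro continuous_imp_measurable_on_sets_lebesgue) auto

lemma cont_integrable_integrable_on:
  fixes f :: "real \<Rightarrow> 'a::banach"
  assumes "cont_integrable f" "0 < a"
  shows "f integrable_on {a..b}" "(\<lambda>t. norm (f t)) integrable_on {a..b}"
  using assms unfolding cont_integrable_def
  by (auto intro!: integrable_continuous_interval continuous_intros elim!: continuous_on_subset)

lemma integrable_pos_integrable_on:
  fixes g :: "real \<Rightarrow> real"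
  assumes "integrable pos_measure g"
  shows "g integrable_on {0<..}" "integral\<^sup>L pos_measure g = integral {0<..} g"
  using assms by (auto intro!: integrable_on_lebesgue_on lebesgue_integral_eq_integral)

lemma integral_Icc_le_pos:
  fixes f :: "real \<Rightarrow> 'a::banach"
  assumes f: "cont_integrable f" and g: "integrable pos_measure g" and a: "0 < a"
    and le: "\<And>t. 0 < t \<Longrightarrow> norm (f t) \<le> g t"
  shows "norm (integral {a..b} f) \<le> integral\<^sup>L pos_measure g"
proof -
  have "norm (integral {a..b} f) \<le> integral {a..b} (\<lambda>t. norm (f t))"
    using cont_integrable_integrable_on[OF f a] by (intro integral_norm_bound_integral) auto
  also have "\<dots> \<le> integral {0<..} (\<lambda>t. norm (f t))"
    using f a cont_integrable_integrable_on[OF f a]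
    by (intro integral_subset_le integrable_pos_integrable_on) (auto simp: cont_integrable_def)
  also have "\<dots> \<le> integral {0<..} g"
    using f g le by (intro integral_le integrable_pos_integrable_on) (auto simp: cont_integrable_def)
  finally show ?thesis
    using integrable_pos_integrable_on(2)[OF g] by simp
qed

lemma tail_integral_tendsto_0:
  fixes g :: "real \<Rightarrow> real"
  assumes g: "integrable pos_measure g"
  shows "(\<lambda>n. \<integral>t. indicator (- {1 / real (Suc n)<..real (Suc n)}) t *\<^sub>R g t \<partial>pos_measure) \<longlonglongrightarrow> 0"
proof -
  have "(\<lambda>n. \<integral>t. indicator (- {1 / real (Suc n)<..real (Suc n)}) t *\<^sub>R g t \<partial>pos_measure) \<longlonglongrightarrow> (\<integral>t. 0 \<partial>pos_measure)"
  proof (rule integral_dominated_convergence[where w="\<lambda>t. norm (g t)"])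
    show "AE x in pos_measure. (\<lambda>n. indicator (- {1 / real (Suc n)<..real (Suc n)}) x *\<^sub>R g x) \<longlonglongrightarrow> 0"
    proof (rule AE_I2)
      fix x :: real assume "x \<in> space pos_measure"
      then have "0 < x" by simp
      from eventually_in_inv_interval[OF this]
      show "(\<lambda>n. indicator (- {1 / real (Suc n)<..real (Suc n)}) x *\<^sub>R g x) \<longlonglongrightarrow> 0"
        by (rule tendsto_eventually[OF eventually_mono]) simp
    qed
    show "(\<lambda>t. indicator (- {1 / real (Suc n)<..real (Suc n)}) t *\<^sub>R g t) \<in> borel_measurable pos_measure" for n
      using g by (intro borel_measurable_scaleR measurable_restrict_space1[OF borel_measurable_indicator]) (auto simp del: of_nat_Suc)
  qed (use g in \<open>auto simp: indicator_def\<close>)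
  then show ?thesis by simp
qed

lemma ex_Bochner_int_inv_intervals:
  fixes f :: "real \<Rightarrow> 'a::banach"
  assumes f: "cont_integrable f"
  obtains x where "has_Bochner_int pos_measure f x" "(\<lambda>n. integral (inv_interval n) f) \<longlonglongrightarrow> x"
proof -
  let ?sbi = "simple_bochner_int pos_measure"
  \<comment> \<open>The square makes \<open>e n\<close> times the length of
    \<open>inv_interval n\<close> at most \<open>1 / real (Suc n)\<close>, so it tends to 0 although
    the intervals grow.\<close>
  define e where "e n = 1 / (real (Suc n))\<^sup>2" for n
  have e: "e n > 0" for n by (simp add: e_def)
  have "\<exists>S. simple_bochner pos_measure S \<and>
    (\<forall>t. t \<notin> {1 / real (Suc n)<..real (Suc n)} \<longrightarrow> S t = 0) \<and>
    (\<forall>t\<in>{1 / real (Suc n)<..real (Suc n)}. norm (f t - S t) \<le> e n) \<and>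
    (S has_integral ?sbi S) (inv_interval n)" for n
  proof -
    have "continuous_on (inv_interval n) f"
      using f inv_interval_subset by (auto simp: cont_integrable_def intro: continuous_on_subset)
    from simple_approx_continuous[OF this _ inv_interval_nonempty e[of n]] show ?thesis
      by (metis of_nat_0_less_iff zero_less_Suc zero_less_divide_1_iff)
  qed
  then obtain S where S: "\<And>n. simple_bochner pos_measure (S n)"
    "\<And>n t. t \<notin> {1 / real (Suc n)<..real (Suc n)} \<Longrightarrow> S n t = 0"
    "\<And>n t. t \<in> {1 / real (Suc n)<..real (Suc n)} \<Longrightarrow> norm (f t - S n t) \<le> e n"
    "\<And>n. (S n has_integral ?sbi (S n)) (inv_interval n)"
    by metis
  define tail where "tail n t = indicator (- {1 / real (Suc n)<..real (Suc n)}) t *\<^sub>R norm (f t)" for n t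
  have fi: "integrable pos_measure (\<lambda>t. norm (f t))" using f by (simp add: cont_integrable_def)
  have m: "inv_interval n \<in> sets pos_measure" "emeasure pos_measure (inv_interval n) < \<infinity>"
    "measure pos_measure (inv_interval n) = real (Suc n) - 1 / real (Suc n)" for n
  proof -
    have i: "{0::real<..} \<inter> space lebesgue \<in> sets lebesgue" by simp
    show "inv_interval n \<in> sets pos_measure"
      using inv_interval_subset by (subst sets_restrict_space_iff[OF i]) auto
    show "emeasure pos_measure (inv_interval n) < \<infinity>"
      "measure pos_measure (inv_interval n) = real (Suc n) - 1 / real (Suc n)"
      using inv_interval_nonempty[of n]
      by (simp_all add: emeasure_restrict_space[OF i inv_interval_subset] measure_restrict_space[OF i inv_interval_subset]
          del: of_nat_Suc)
  qed
  have ti: "integrable pos_measure (tail n)" for n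
    unfolding tail_def
  proof (rule Bochner_Integration.integrable_bound[OF fi])
    show "(\<lambda>t. indicator (- {1 / real (Suc n)<..real (Suc n)}) t *\<^sub>R norm (f t)) \<in> borel_measurable pos_measure"
      using fi by (intro borel_measurable_scaleR measurable_restrict_space1[OF borel_measurable_indicator])
        (auto simp del: of_nat_Suc)
  qed (auto simp: indicator_def)
  have tail_nonneg: "0 \<le> tail n t" for n t
    by (simp add: tail_def)
  \<comment> \<open>A real majorant of the L1 error: the mass of \<open>f\<close> outside the
    interval plus the uniform error times the length. It drives both the L1 convergence and the
    Cauchy property.\<close>
  define b where "b n = integral\<^sup>L pos_measure (tail n) + e n * (real (Suc n) - 1 / real (Suc n))" for n
  have b_nonneg: "0 \<le> b n" for n
    unfolding b_def using inv_interval_nonempty[of n] e[of n] tail_nonneg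
    by (intro add_nonneg_nonneg integral_nonneg_AE mult_nonneg_nonneg) (auto simp del: of_nat_Suc)
  define a where "a n = (\<integral>\<^sup>+t. ennreal (norm (f t - S n t)) \<partial>pos_measure)" for n
  have ab: "a n \<le> ennreal (b n)" for n
  proof -
    have ki: "integrable pos_measure (\<lambda>t. e n * indicator (inv_interval n) t)"
      using m[of n] by (intro integrable_mult_right integrable_real_indicator) auto
    have "a n \<le> (\<integral>\<^sup>+t. ennreal (tail n t + e n * indicator (inv_interval n) t) \<partial>pos_measure)"
      unfolding a_def
    proof (intro nn_integral_mono ennreal_leI)
      fix t :: real assume "t \<in> space pos_measure"
      show "norm (f t - S n t) \<le> tail n t + e n * indicator (inv_interval n) t"
        using S(2)[of t n] S(3)[of t n] e[of n]
        by (cases "t \<in> {1 / real (Suc n)<..real (Suc n)}") (auto simp: tail_def less_imp_le simp del: of_nat_Suc)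
    qed
    also have "\<dots> = ennreal (\<integral>t. tail n t + e n * indicator (inv_interval n) t \<partial>pos_measure)"
      using ti[of n] ki e[of n] tail_nonneg[of n]
      by (intro nn_integral_eq_integral Bochner_Integration.integrable_add AE_I2 add_nonneg_nonneg) auto
    also have "(\<integral>t. tail n t + e n * indicator (inv_interval n) t \<partial>pos_measure) = b n"
      using ti[of n] ki m[of n] by (simp add: b_def Int_absorb2[OF inv_interval_subset] del: of_nat_Suc)
    finally show ?thesis .
  qed
  have e0: "(\<lambda>n. e n * (real (Suc n) - 1 / real (Suc n))) \<longlonglongrightarrow> 0"
  proof (rule Lim_null_comparison[OF always_eventually LIMSEQ_inverse_real_of_nat], rule allI)
    fix n
    have "norm (e n * (real (Suc n) - 1 / real (Suc n))) = e n * (real (Suc n) - 1 / real (Suc n))"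
      using e[of n] inv_interval_nonempty[of n] by (simp add: less_imp_le del: of_nat_Suc)
    also have "\<dots> \<le> e n * real (Suc n)"
      using e[of n] by (intro mult_left_mono) auto
    finally show "norm (e n * (real (Suc n) - 1 / real (Suc n))) \<le> inverse (real (Suc n))"
      by (simp add: e_def power2_eq_square inverse_eq_divide)
  qed
  have b0: "b \<longlonglongrightarrow> 0"
    using tendsto_add[OF tail_integral_tendsto_0[OF fi] e0] unfolding b_def[abs_def] tail_def by simp
  have a0: "a \<longlonglongrightarrow> 0"
  proof (rule tendsto_sandwich[OF _ _ tendsto_const])
    show "(\<lambda>n. ennreal (b n)) \<longlonglongrightarrow> 0"
      using tendsto_ennrealI[OF b0] by simp
  qed (auto simp: ab)
  have "Cauchy (\<lambda>n. ?sbi (S n))"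
  proof (rule metric_CauchyI)
    fix d :: real assume "d > 0"
    then have "\<forall>\<^sub>F n in sequentially. b n < d / 2"
      using order_tendstoD(2)[OF b0, of "d/2"] by simp
    then obtain N where N: "\<And>n. n \<ge> N \<Longrightarrow> b n < d / 2"
      by (auto simp: eventually_sequentially)
    have "dist (?sbi (S m)) (?sbi (S n)) < d" if "m \<ge> N" "n \<ge> N" for m n
    proof -
      have "ennreal (norm (?sbi (S m) - ?sbi (S n))) \<le> a m + a n"
        unfolding a_def
        by (rule norm_simple_bochner_integral_diff_le[OF cont_integrable_measurable[OF f] S(1) S(1)])
      also have "\<dots> \<le> ennreal (b m) + ennreal (b n)"
        by (intro add_mono ab)
      also have "\<dots> < ennreal d"
        using N[OF that(1)] N[OF that(2)] b_nonneg \<open>d > 0\<close>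
        by (simp add: ennreal_less_iff flip: ennreal_plus)
      finally show ?thesis
        by (simp add: dist_norm ennreal_less_iff)
    qed
    then show "\<exists>M. \<forall>m\<ge>M. \<forall>n\<ge>M. dist (?sbi (S m)) (?sbi (S n)) < d" by blast
  qed
  then obtain x where x: "(\<lambda>n. ?sbi (S n)) \<longlonglongrightarrow> x"
    using Cauchy_convergent convergent_def by blast
  \<comment> \<open>On \<open>inv_interval n\<close> the step function and \<open>f\<close> differ
    by at most \<open>e n\<close>, so the simple integrals and the integrals of \<open>f\<close>
    share their limit.\<close>
  have "(\<lambda>n. ?sbi (S n) - integral (inv_interval n) f) \<longlonglongrightarrow> 0"
  proof (rule Lim_null_comparison[OF always_eventually e0], rule allI)
    fix n
    have "(f has_integral integral (inv_interval n) f) (inv_interval n)"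
      by (intro integrable_integral cont_integrable_integrable_on[OF f]) simp
    from has_integral_bound_real[OF _ _ has_integral_diff[OF S(4) this], of "e n" "{1 / real (Suc n)}"]
    have "norm (?sbi (S n) - integral (inv_interval n) f) \<le> e n * Henstock_Kurzweil_Integration.content (inv_interval n)"
      using e[of n] S(3)[of _ n] by (auto simp: norm_minus_commute)
    then show "norm (?sbi (S n) - integral (inv_interval n) f) \<le> e n * (real (Suc n) - 1 / real (Suc n))"
      using inv_interval_nonempty[of n] by simp
  qed
  then have "(\<lambda>n. integral (inv_interval n) f) \<longlonglongrightarrow> x"
    using tendsto_diff[OF x] by fastforce
  moreover have "has_Bochner_int pos_measure f x"
    unfolding has_Bochner_int_def
    using cont_integrable_measurable[OF f] S(1) a0 x unfolding a_def[abs_def]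
    by (intro conjI exI[of _ S] allI)
  ultimately show ?thesis by (intro that)
qed

lemma cont_integrable_integrable_pos:
  fixes f :: "real \<Rightarrow> 'a::banach"
  shows "cont_integrable f \<Longrightarrow> integrable_pos f"
  by (metis Bochner_integrable_def ex_Bochner_int_inv_intervals)

lemma int_pos_LIMSEQ:
  fixes f :: "real \<Rightarrow> 'a::banach"
  shows "cont_integrable f \<Longrightarrow> (\<lambda>n. integral (inv_interval n) f) \<longlonglongrightarrow> int_pos f"
  by (metis Bochner_int_eq ex_Bochner_int_inv_intervals)

lemma int_pos_eqI:
  fixes f :: "real \<Rightarrow> 'a::banach"
  assumes "cont_integrable f" "(\<lambda>n. integral (inv_interval n) f) \<longlonglongrightarrow> x"
  shows "int_pos f = x"
  using LIMSEQ_unique int_pos_LIMSEQ[OF assms(1)] assms(2) by blast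

lemma cont_integrable_dominated:
  fixes f :: "real \<Rightarrow> 'a::banach"
  assumes f: "continuous_on {0<..} f" and g: "integrable pos_measure g"
    and le: "\<And>t. 0 < t \<Longrightarrow> norm (f t) \<le> g t"
  shows "cont_integrable f"
  unfolding cont_integrable_def
proof
  have "(\<lambda>t. norm (f t)) \<in> borel_measurable pos_measure"
    by (intro continuous_imp_measurable_on_sets_lebesgue continuous_intros f) auto
  then show "integrable pos_measure (\<lambda>t. norm (f t))"
    by (rule Bochner_Integration.integrable_bound[OF g]) (use le in \<open>auto intro!: AE_I2 order_trans[OF le]\<close>)
qed fact

lemma norm_int_pos_le:
  fixes f :: "real \<Rightarrow> 'a::banach"
  assumes f: "cont_integrable f" and g: "integrable pos_measure g"
    and le: "\<And>t. 0 < t \<Longrightarrow> norm (f t) \<le> g t"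
  shows "norm (int_pos f) \<le> integral\<^sup>L pos_measure g"
  by (rule LIMSEQ_le_const2[OF tendsto_norm[OF int_pos_LIMSEQ[OF f]]])
     (use integral_Icc_le_pos[OF f g _ le] in auto)

section \<open>Linearity and transfer rules for the half-line integral\<close>

lemma cont_integrable_add:
  fixes f g :: "real \<Rightarrow> 'a::banach"
  assumes "cont_integrable f" "cont_integrable g"
  shows "cont_integrable (\<lambda>t. f t + g t)" and int_pos_add: "int_pos (\<lambda>t. f t + g t) = int_pos f + int_pos g"
proof -
  show *: "cont_integrable (\<lambda>t. f t + g t)"
    using assms unfolding cont_integrable_def
    by (intro cont_integrable_dominated[where g="\<lambda>t. norm (f t) + norm (g t)", unfolded cont_integrable_def])
       (auto intro!: continuous_intros norm_triangle_ineq)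
  show "int_pos (\<lambda>t. f t + g t) = int_pos f + int_pos g"
    using tendsto_add[OF int_pos_LIMSEQ int_pos_LIMSEQ, OF assms]
    by (intro int_pos_eqI[OF *]) (simp add: integral_add cont_integrable_integrable_on assms)
qed

lemma cont_integrable_bounded_linear:
  fixes f :: "real \<Rightarrow> 'a::banach" and h :: "'a \<Rightarrow> 'b::banach"
  assumes f: "cont_integrable f" and h: "bounded_linear h"
  shows "cont_integrable (\<lambda>t. h (f t))" and int_pos_bounded_linear: "int_pos (\<lambda>t. h (f t)) = h (int_pos f)"
proof -
  obtain K where K: "\<And>x. norm (h x) \<le> norm x * K"
    using bounded_linear.bounded[OF h] by blast
  show *: "cont_integrable (\<lambda>t. h (f t))"
    using f unfolding cont_integrable_def
    by (intro cont_integrable_dominated[where g="\<lambda>t. norm (f t) * K", unfolded cont_integrable_def])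
       (auto intro!: bounded_linear.continuous_on[OF h] K)
  have "integral (inv_interval n) (\<lambda>t. h (f t)) = h (integral (inv_interval n) f)" for n
    using integral_linear[OF cont_integrable_integrable_on(1)[OF f] h] by (simp add: o_def)
  then show "int_pos (\<lambda>t. h (f t)) = h (int_pos f)"
    using bounded_linear.tendsto[OF h int_pos_LIMSEQ[OF f]]
    by (intro int_pos_eqI[OF *]) simp
qed

lemmas cont_integrable_scaleR = cont_integrable_bounded_linear(1)[OF _ bounded_linear_scaleR_right]
lemmas int_pos_scaleR = int_pos_bounded_linear[OF _ bounded_linear_scaleR_right]

lemma cont_integrable_diff:
  fixes f g :: "real \<Rightarrow> 'a::banach"
  assumes "cont_integrable f" "cont_integrable g"
  shows "cont_integrable (\<lambda>t. f t - g t)" and int_pos_diff: "int_pos (\<lambda>t. f t - g t) = int_pos f - int_pos g"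
  using cont_integrable_add[OF assms(1) cont_integrable_scaleR(1)[OF assms(2), of "-1"]]
    int_pos_scaleR[OF assms(2), of "-1"]
  by simp_all

lemma has_Bochner_int_cong:
  assumes "\<And>t. t \<in> space M \<Longrightarrow> f t = g t"
  shows "has_Bochner_int M f x \<longleftrightarrow> has_Bochner_int M g x"
  unfolding has_Bochner_int_def
  by (simp add: assms cong: measurable_cong nn_integral_cong)

lemma int_pos_cong:
  assumes "\<And>t. 0 < t \<Longrightarrow> f t = g t"
  shows "int_pos f = int_pos g" "integrable_pos f \<longleftrightarrow> integrable_pos g"
proof -
  have "has_Bochner_int pos_measure f x \<longleftrightarrow> has_Bochner_int pos_measure g x" for x
    by (rule has_Bochner_int_cong) (simp add: assms)
  then have "has_Bochner_int pos_measure f = has_Bochner_int pos_measure g"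
    by blast
  then show "int_pos f = int_pos g" "integrable_pos f \<longleftrightarrow> integrable_pos g"
    by (simp_all add: Bochner_int_def Bochner_integrable_def)
qed

lemma cont_integrable_cong:
  assumes "\<And>t. 0 < t \<Longrightarrow> f t = g t"
  shows "cont_integrable f \<longleftrightarrow> cont_integrable g"
  unfolding cont_integrable_def using assms
  by (intro conj_cong continuous_on_cong Bochner_Integration.integrable_cong) auto

lemma filterlim_real_Suc: "filterlim (\<lambda>n. real (Suc n)) at_top sequentially"
  using filterlim_real_sequentially by (subst filterlim_sequentially_Suc)

lemma filterlim_inverse_Suc: "filterlim (\<lambda>n. 1 / real (Suc n)) (at_right 0) sequentially"
  unfolding filterlim_at using LIMSEQ_inverse_real_of_nat
  by (simp add: inverse_eq_divide del: of_nat_Suc)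

lemma int_pos_FTC:
  fixes F :: "real \<Rightarrow> 'a::banach"
  assumes f: "cont_integrable f"
    and F: "\<And>t. 0 < t \<Longrightarrow> (F has_vector_derivative f t) (at t)"
    and a: "(F \<longlongrightarrow> a) (at_right 0)" and b: "(F \<longlongrightarrow> b) at_top"
  shows "int_pos f = b - a"
proof (rule int_pos_eqI[OF f])
  have "integral (inv_interval n) f = F (real (Suc n)) - F (1 / real (Suc n))" for n
  proof (rule integral_unique, rule fundamental_theorem_of_calculus[OF inv_interval_nonempty])
    fix x assume "x \<in> inv_interval n"
    from subsetD[OF inv_interval_subset this] have "0 < x"
      by (rule greaterThan_iff[THEN iffD1])
    then show "(F has_vector_derivative f x) (at x within inv_interval n)"
      by (rule has_vector_derivative_at_within[OF F])
  qed
  moreover have "(\<lambda>n. F (real (Suc n))) \<longlonglongrightarrow> b"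
    by (rule filterlim_compose[OF b filterlim_real_Suc])
  moreover have "(\<lambda>n. F (1 / real (Suc n))) \<longlonglongrightarrow> a"
    by (rule filterlim_compose[OF a filterlim_inverse_Suc])
  ultimately show "(\<lambda>n. integral (inv_interval n) f) \<longlonglongrightarrow> b - a"
    by (simp add: tendsto_diff del: of_nat_Suc)
qed

section \<open>Substitution, dominated convergence and Fubini\<close>

lemma int_pos_real:
  fixes g :: "real \<Rightarrow> real"
  assumes "cont_integrable g"
  shows "int_pos g = integral\<^sup>L pos_measure g"
  using cont_integrable_integrable_pos[OF assms] Bochner_int_eq[of pos_measure g]
    has_bochner_integral_integral_eq[of pos_measure g]
  by (auto simp: Bochner_integrable_def has_Bochner_int_iff_has_bochner_integral)

lemma cont_integrable_norm: "cont_integrable f \<Longrightarrow> cont_integrable (\<lambda>t. norm (f t))"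
  by (auto simp: cont_integrable_def intro: continuous_intros)

lemma integral_norm_Icc_le:
  fixes f :: "real \<Rightarrow> 'a::banach"
  assumes "cont_integrable f" "0 < a"
  shows "integral {a..b} (\<lambda>t. norm (f t)) \<le> integral\<^sup>L pos_measure (\<lambda>t. norm (f t))"
  using integral_Icc_le_pos[OF cont_integrable_norm[OF assms(1)] _ assms(2), of "\<lambda>t. norm (f t)" b] assms(1)
  by (simp add: cont_integrable_def)

text \<open>A substitution maps the intervals \<open>inv_interval n\<close> to other exhausting
  intervals, so the limit is needed for arbitrary endpoints. One fixed interval [p, q] carries all
  but e/2 of the integral of the norm, and whatever a larger interval adds is smaller than
  that.\<close>

lemma int_pos_tendsto:
  fixes f :: "real \<Rightarrow> 'a::banach"
  assumes f: "cont_integrable f" and a: "filterlim a (at_right 0) G" and b: "filterlim b at_top G"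
  shows "((\<lambda>x. integral {a x..b x} f) \<longlongrightarrow> int_pos f) G"
proof (rule tendstoI)
  fix e :: real assume e: "e > 0"
  let ?h = "\<lambda>t. norm (f t)" and ?I = "integral\<^sup>L pos_measure (\<lambda>t. norm (f t))"
  have "(\<lambda>n. integral (inv_interval n) ?h) \<longlonglongrightarrow> ?I"
    using int_pos_LIMSEQ[OF cont_integrable_norm[OF f]] int_pos_real[OF cont_integrable_norm[OF f]] by simp
  then have "\<forall>\<^sub>F n in sequentially. dist (integral (inv_interval n) ?h) ?I < e / 2"
    by (rule tendstoD) (use e in simp)
  moreover have "\<forall>\<^sub>F n in sequentially. dist (integral (inv_interval n) f) (int_pos f) < e / 2"
    using int_pos_LIMSEQ[OF f] by (rule tendstoD) (use e in simp)
  ultimately have "\<forall>\<^sub>F n in sequentially. dist (integral (inv_interval n) ?h) ?I < e / 2 \<and>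
      dist (integral (inv_interval n) f) (int_pos f) < e / 2"
    by (rule eventually_conj)
  then obtain n where n: "dist (integral (inv_interval n) ?h) ?I < e / 2"
    "dist (integral (inv_interval n) f) (int_pos f) < e / 2"
    by (auto simp: eventually_sequentially simp del: of_nat_Suc)
  define p q where "p = 1 / real (Suc n)" and "q = real (Suc n)"
  have pq: "0 < p" "p \<le> q" using inv_interval_nonempty[of n] by (auto simp: p_def q_def)
  have "\<forall>\<^sub>F x in G. a x \<in> {0<..<p}"
    using a eventually_at_right_real[OF pq(1)] unfolding filterlim_iff by blast
  moreover have "\<forall>\<^sub>F x in G. q \<le> b x"
    using b unfolding filterlim_at_top by blast
  ultimately show "\<forall>\<^sub>F x in G. dist (integral {a x..b x} f) (int_pos f) < e"
  proof eventually_elim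
    case (elim x)
    then have ax: "0 < a x" "a x \<le> p" by auto
    note i = cont_integrable_integrable_on[OF f ax(1)] cont_integrable_integrable_on[OF f pq(1)]
    have sf: "integral {a x..b x} f = integral {a x..p} f + integral {p..q} f + integral {q..b x} f"
      using ax pq elim i Henstock_Kurzweil_Integration.integral_combine[where a="a x" and c=p and b="b x" and f="f"]
        Henstock_Kurzweil_Integration.integral_combine[where a=p and c=q and b="b x" and f="f"]
      by (simp add: add.assoc)
    have sh: "integral {a x..b x} ?h = integral {a x..p} ?h + integral {p..q} ?h + integral {q..b x} ?h"
      using ax pq elim i Henstock_Kurzweil_Integration.integral_combine[where a="a x" and c=p and b="b x" and f="?h"]
        Henstock_Kurzweil_Integration.integral_combine[where a=p and c=q and b="b x" and f="?h"]
      by (simp add: add.assoc)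
    have "norm (integral {a x..b x} f - integral {p..q} f) = norm (integral {a x..p} f + integral {q..b x} f)"
      using sf by simp
    also have "\<dots> \<le> integral {a x..p} ?h + integral {q..b x} ?h"
      using cont_integrable_integrable_on[OF f] ax pq
      by (intro norm_triangle_mono integral_norm_bound_integral) auto
    also have "\<dots> = integral {a x..b x} ?h - integral {p..q} ?h"
      using sh by simp
    also have "\<dots> \<le> ?I - integral {p..q} ?h"
      using integral_norm_Icc_le[OF f ax(1)] by simp
    also have "\<dots> < e / 2"
      using n(1) unfolding p_def q_def dist_real_def by linarith
    finally have "dist (integral {a x..b x} f) (integral {p..q} f) < e / 2"
      by (simp add: dist_norm)
    with n(2) show ?case
      using dist_triangle_half_l[of "integral {a x..b x} f" "integral {p..q} f" e "int_pos f"]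
      by (simp add: dist_commute p_def q_def del: of_nat_Suc)
  qed
qed

text \<open>Membership without a majorant, by monotone convergence of the truncated norms. After a
  substitution, the integrals over compact intervals are bounded by the integral of the original
  norm, which then serves as \<open>C\<close>.\<close>

lemma cont_integrableI_bounded:
  fixes f :: "real \<Rightarrow> 'a::banach"
  assumes f: "continuous_on {0<..} f" and C: "\<And>n. integral (inv_interval n) (\<lambda>t. norm (f t)) \<le> C"
  shows "cont_integrable f"
  unfolding cont_integrable_def
proof
  define g where "g n t = indicator (inv_interval n) t * norm (f t)" for n t
  have fi: "(\<lambda>t. norm (f t)) integrable_on inv_interval n" for n
    using inv_interval_subset by (intro integrable_continuous_interval continuous_intros continuous_on_subset[OF f])
  have gi: "(g n has_integral integral (inv_interval n) (\<lambda>t. norm (f t))) {0<..}" for n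
  proof -
    have "((\<lambda>t. if t \<in> inv_interval n then norm (f t) else 0) has_integral integral (inv_interval n) (\<lambda>t. norm (f t))) {0<..}"
      using inv_interval_subset fi[of n] by (subst has_integral_restrict) (auto simp del: of_nat_Suc)
    then show ?thesis
      by (rule has_integral_eq[rotated]) (simp add: g_def indicator_def)
  qed
  have "(\<lambda>t. norm (f t)) integrable_on {0<..} \<and> (\<lambda>k. integral {0<..} (g k)) \<longlonglongrightarrow> integral {0<..} (\<lambda>t. norm (f t))"
  proof (rule monotone_convergence_increasing)
    show "g k integrable_on {0<..}" for k using gi by blast
    show "g k x \<le> g (Suc k) x" for k x
      using inv_interval_mono[of k "Suc k"] unfolding g_def
      by (intro mult_right_mono) (auto simp: indicator_def simp del: of_nat_Suc)
    show "(\<lambda>k. g k x) \<longlonglongrightarrow> norm (f x)" if "x \<in> {0<..}" for x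
    proof (rule tendsto_eventually)
      have "\<forall>\<^sub>F n in sequentially. x \<in> {1 / real (Suc n)<..real (Suc n)}"
        using that by (intro eventually_in_inv_interval) simp
      then show "\<forall>\<^sub>F n in sequentially. g n x = norm (f x)"
        by eventually_elim (auto simp: g_def indicator_def)
    qed
    show "bounded (range (\<lambda>k. integral {0<..} (g k)))"
    proof (rule boundedI)
      fix x assume "x \<in> range (\<lambda>k. integral {0<..} (g k))"
      then obtain n where "x = integral (inv_interval n) (\<lambda>t. norm (f t))"
        using gi by (auto simp: integral_unique[OF gi])
      moreover have "0 \<le> integral (inv_interval n) (\<lambda>t. norm (f t))"
        using fi by (rule integral_nonneg) simp
      ultimately show "norm x \<le> C" using C[of n] by simp
    qed
  qed
  then have "(\<lambda>t. norm (f t)) absolutely_integrable_on {0<..}"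
    by (intro nonnegative_absolutely_integrable_1) auto
  then show "integrable pos_measure (\<lambda>t. norm (f t))"
    by (simp add: set_integrable_def integrable_restrict_space)
qed fact

text \<open>With an antiderivative \<open>F\<close> of \<open>f\<close>, both sides are differences
  of values of \<open>F\<close> by the chain rule. The first conclusion serves t \<mapsto> c t, the
  second the orientation-reversing t \<mapsto> c / t.\<close>

lemma integral_subst:
  fixes f :: "real \<Rightarrow> 'a::banach"
  assumes f: "continuous_on {0<..} f" and a: "0 < a" "a \<le> b"
    and \<phi>: "\<And>t. 0 < t \<Longrightarrow> (\<phi> has_real_derivative \<phi>' t) (at t)" "\<And>t. 0 < t \<Longrightarrow> 0 < \<phi> t"
  shows "\<phi> a \<le> \<phi> b \<Longrightarrow> ((\<lambda>t. \<phi>' t *\<^sub>R f (\<phi> t)) has_integral integral {\<phi> a..\<phi> b} f) {a..b}"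
    and "\<phi> b \<le> \<phi> a \<Longrightarrow> ((\<lambda>t. \<phi>' t *\<^sub>R f (\<phi> t)) has_integral - integral {\<phi> b..\<phi> a} f) {a..b}"
proof -
  have "continuous_on {a..b} \<phi>"
    using a by (intro continuous_at_imp_continuous_on ballI DERIV_isCont[OF \<phi>(1)]) auto
  then have "compact (\<phi> ` {a..b})" by (intro compact_continuous_image) auto
  then obtain p q where pq: "\<phi> ` {a..b} \<subseteq> {p..q}" "p \<in> \<phi> ` {a..b}"
    using compact_attains_inf[of "\<phi> ` {a..b}"] compact_attains_sup[of "\<phi> ` {a..b}"] a
    by (metis atLeastAtMost_iff atLeastatMost_empty_iff2 image_is_empty not_le subsetI)
  then have "0 < p" using \<phi>(2) a by auto
  \<comment> \<open>Enlarging [p, q] puts its points into the interior, so that the derivative of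
    \<open>F\<close> within the interval becomes two-sided; p / 2 is still positive.\<close>
  then have fc: "continuous_on {p / 2..q + 1} f"
    by (intro continuous_on_subset[OF f]) auto
  obtain F where F: "\<And>x. x \<in> {p / 2..q + 1} \<Longrightarrow> (F has_vector_derivative f x) (at x within {p / 2..q + 1})"
    using antiderivative_continuous[OF fc] by metis
  have F': "(F has_vector_derivative f x) (at x)" if "x \<in> {p..q}" for x
    using F[of x] that \<open>0 < p\<close> by (simp add: at_within_Icc_at)
  have 1: "((\<lambda>t. \<phi>' t *\<^sub>R f (\<phi> t)) has_integral F (\<phi> b) - F (\<phi> a)) {a..b}"
  proof (rule fundamental_theorem_of_calculus[OF a(2)])
    fix t assume t: "t \<in> {a..b}"
    then have "\<phi> t \<in> {p..q}" "0 < t" using pq(1) a by (auto simp: image_subset_iff)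
    from vector_diff_chain_at[OF \<phi>(1)[OF this(2), unfolded has_real_derivative_iff_has_vector_derivative] F'[OF this(1)]]
    have "((\<lambda>t. F (\<phi> t)) has_vector_derivative \<phi>' t *\<^sub>R f (\<phi> t)) (at t)" by (simp add: o_def)
    then show "((\<lambda>t. F (\<phi> t)) has_vector_derivative \<phi>' t *\<^sub>R f (\<phi> t)) (at t within {a..b})"
      by (rule has_vector_derivative_at_within)
  qed
  have in_pq: "\<phi> a \<in> {p..q}" "\<phi> b \<in> {p..q}" using pq(1) a by (auto simp: image_subset_iff)
  have 2: "integral {c..d} f = F d - F c" if "c \<le> d" "c \<in> {p..q}" "d \<in> {p..q}" for c d
    using that by (intro integral_unique fundamental_theorem_of_calculus has_vector_derivative_at_within[OF F']) auto
  show "\<phi> a \<le> \<phi> b \<Longrightarrow> ((\<lambda>t. \<phi>' t *\<^sub>R f (\<phi> t)) has_integral integral {\<phi> a..\<phi> b} f) {a..b}"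
    using 1 2 in_pq by simp
  show "\<phi> b \<le> \<phi> a \<Longrightarrow> ((\<lambda>t. \<phi>' t *\<^sub>R f (\<phi> t)) has_integral - integral {\<phi> b..\<phi> a} f) {a..b}"
    using 1 2 in_pq by simp
qed

lemma cont_integrable_scale:
  fixes f :: "real \<Rightarrow> 'a::banach"
  assumes f: "cont_integrable f" and c: "0 < c"
  shows "cont_integrable (\<lambda>t. c *\<^sub>R f (c * t))" and int_pos_scale: "int_pos (\<lambda>t. c *\<^sub>R f (c * t)) = int_pos f"
proof -
  have fc: "continuous_on {0<..} f" using f by (simp add: cont_integrable_def)
  have ic: "integral (inv_interval n) (\<lambda>t. c *\<^sub>R h (c * t)) = integral {c * (1 / real (Suc n))..c * real (Suc n)} h"
    if "continuous_on {0<..} h" for n and h :: "real \<Rightarrow> 'b::banach"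
  proof (rule integral_unique)
    show "((\<lambda>t. c *\<^sub>R h (c * t)) has_integral integral {c * (1 / real (Suc n))..c * real (Suc n)} h) (inv_interval n)"
      using mult_left_mono[OF inv_interval_nonempty[of n], of c] c
      by (intro integral_subst[OF that] inv_interval_nonempty) (auto intro!: derivative_eq_intros simp del: of_nat_Suc)
  qed
  show *: "cont_integrable (\<lambda>t. c *\<^sub>R f (c * t))"
  proof (rule cont_integrableI_bounded)
    show "continuous_on {0<..} (\<lambda>t. c *\<^sub>R f (c * t))"
      using c by (intro continuous_intros continuous_on_compose2[OF fc]) auto
    fix n
    have "integral (inv_interval n) (\<lambda>t. norm (c *\<^sub>R f (c * t))) = integral (inv_interval n) (\<lambda>t. c *\<^sub>R norm (f (c * t)))"
      using c by simp
    also have "\<dots> = integral {c * (1 / real (Suc n))..c * real (Suc n)} (\<lambda>t. norm (f t))"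
      by (rule ic) (intro continuous_intros fc)
    also have "\<dots> \<le> integral\<^sup>L pos_measure (\<lambda>t. norm (f t))"
      using c by (intro integral_norm_Icc_le[OF f]) simp
    finally show "integral (inv_interval n) (\<lambda>t. norm (c *\<^sub>R f (c * t))) \<le> integral\<^sup>L pos_measure (\<lambda>t. norm (f t))" .
  qed
  show "int_pos (\<lambda>t. c *\<^sub>R f (c * t)) = int_pos f"
  proof (rule int_pos_eqI[OF *])
    have "filterlim (\<lambda>n. c * (1 / real (Suc n))) (at_right 0) sequentially"
      using c tendsto_mult_right_zero[OF LIMSEQ_inverse_real_of_nat, of c] unfolding filterlim_at
      by (simp add: inverse_eq_divide del: of_nat_Suc)
    moreover have "filterlim (\<lambda>n. c * real (Suc n)) at_top sequentially"
      using c filterlim_real_Suc by (intro filterlim_tendsto_pos_mult_at_top[OF tendsto_const])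
    ultimately show "(\<lambda>n. integral (inv_interval n) (\<lambda>t. c *\<^sub>R f (c * t))) \<longlonglongrightarrow> int_pos f"
      using int_pos_tendsto[OF f] by (simp only: ic[OF fc])
  qed
qed

lemma cont_integrable_inverse:
  fixes f :: "real \<Rightarrow> 'a::banach"
  assumes f: "cont_integrable f" and c: "0 < c"
  shows "cont_integrable (\<lambda>t. (c / t\<^sup>2) *\<^sub>R f (c / t))" and int_pos_inverse: "int_pos (\<lambda>t. (c / t\<^sup>2) *\<^sub>R f (c / t)) = int_pos f"
proof -
  have fc: "continuous_on {0<..} f" using f by (simp add: cont_integrable_def)
  have ic: "integral (inv_interval n) (\<lambda>t. (c / t\<^sup>2) *\<^sub>R h (c / t)) = integral {c / real (Suc n)..c / (1 / real (Suc n))} h"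
    if h: "continuous_on {0<..} h" for n and h :: "real \<Rightarrow> 'b::banach"
  proof -
    \<comment> \<open>The negative derivative of c / t and the reversed endpoints contribute two
      signs, which cancel.\<close>
    have "((\<lambda>t. (- (c / t\<^sup>2)) *\<^sub>R h (c / t)) has_integral - integral {c / real (Suc n)..c / (1 / real (Suc n))} h) (inv_interval n)"
      using inv_interval_nonempty[of n] c
      by (intro integral_subst(2)[OF h])
         (auto intro!: derivative_eq_intros divide_left_mono simp: power2_eq_square divide_simps simp del: of_nat_Suc)
    from has_integral_neg[OF this] show ?thesis
      by (intro integral_unique) simp
  qed
  show *: "cont_integrable (\<lambda>t. (c / t\<^sup>2) *\<^sub>R f (c / t))"
  proof (rule cont_integrableI_bounded)
    show "continuous_on {0<..} (\<lambda>t. (c / t\<^sup>2) *\<^sub>R f (c / t))"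
      using c by (intro continuous_intros continuous_on_compose2[OF fc]) auto
    fix n
    have "integral (inv_interval n) (\<lambda>t. norm ((c / t\<^sup>2) *\<^sub>R f (c / t))) = integral (inv_interval n) (\<lambda>t. (c / t\<^sup>2) *\<^sub>R norm (f (c / t)))"
      using c by simp
    also have "\<dots> = integral {c / real (Suc n)..c / (1 / real (Suc n))} (\<lambda>t. norm (f t))"
      by (rule ic) (intro continuous_intros fc)
    also have "\<dots> \<le> integral\<^sup>L pos_measure (\<lambda>t. norm (f t))"
      using c by (intro integral_norm_Icc_le[OF f]) simp
    finally show "integral (inv_interval n) (\<lambda>t. norm ((c / t\<^sup>2) *\<^sub>R f (c / t))) \<le> integral\<^sup>L pos_measure (\<lambda>t. norm (f t))" .
  qed
  show "int_pos (\<lambda>t. (c / t\<^sup>2) *\<^sub>R f (c / t)) = int_pos f"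
  proof (rule int_pos_eqI[OF *])
    have "filterlim (\<lambda>n. c / real (Suc n)) (at_right 0) sequentially"
      using c tendsto_mult_right_zero[OF LIMSEQ_inverse_real_of_nat, of c] unfolding filterlim_at
      by (simp add: inverse_eq_divide del: of_nat_Suc)
    moreover have "filterlim (\<lambda>n. c / (1 / real (Suc n))) at_top sequentially"
      using c filterlim_tendsto_pos_mult_at_top[OF tendsto_const c filterlim_real_Suc] by (simp del: of_nat_Suc)
    ultimately show "(\<lambda>n. integral (inv_interval n) (\<lambda>t. (c / t\<^sup>2) *\<^sub>R f (c / t))) \<longlonglongrightarrow> int_pos f"
      using int_pos_tendsto[OF f] by (simp only: ic[OF fc])
  qed
qed

section \<open>Limits and derivatives under the integral sign\<close>

lemma has_vector_derivative_iff_quotient: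
  "(f has_vector_derivative d) (at y within S) \<longleftrightarrow> ((\<lambda>z. (f z - f y) /\<^sub>R (z - y)) \<longlongrightarrow> d) (at y within S)"
proof -
  have "(f has_vector_derivative d) (at y within S) \<longleftrightarrow>
      ((\<lambda>z. norm (f z - f y - (z - y) *\<^sub>R d) / norm (z - y)) \<longlongrightarrow> 0) (at y within S)"
    unfolding has_vector_derivative_def has_derivative_iff_norm
    by (simp add: bounded_linear_scaleR_left)
  also have "\<dots> \<longleftrightarrow> ((\<lambda>z. norm ((f z - f y) /\<^sub>R (z - y) - d)) \<longlongrightarrow> 0) (at y within S)"
  proof (rule filterlim_cong[OF refl refl])
    show "\<forall>\<^sub>F z in at y within S. norm (f z - f y - (z - y) *\<^sub>R d) / norm (z - y) = norm ((f z - f y) /\<^sub>R (z - y) - d)"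
      unfolding eventually_at_filter
    proof (intro always_eventually allI impI)
      fix z assume "z \<noteq> y"
      then have "(f z - f y) /\<^sub>R (z - y) - d = (f z - f y - (z - y) *\<^sub>R d) /\<^sub>R (z - y)"
        by (simp add: scaleR_diff_right)
      then show "norm (f z - f y - (z - y) *\<^sub>R d) / norm (z - y) = norm ((f z - f y) /\<^sub>R (z - y) - d)"
        by (simp add: divide_inverse mult.commute)
    qed
  qed
  also have "\<dots> \<longleftrightarrow> ((\<lambda>z. (f z - f y) /\<^sub>R (z - y)) \<longlongrightarrow> d) (at y within S)"
    by (simp add: tendsto_norm_zero_iff LIM_zero_iff)
  finally show ?thesis .
qed

text \<open>Reduction to the scalar theorem: the norms of \<open>f i t - l t\<close> have the
  majorant \<open>2 * g t\<close>, and their integrals bound the distance between the vector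
  integrals.\<close>

lemma int_pos_LIMSEQ_dominated:
  fixes f :: "nat \<Rightarrow> real \<Rightarrow> 'a::banach"
  assumes f: "\<And>i. cont_integrable (f i)" and l: "cont_integrable l"
    and g: "integrable pos_measure g"
    and le: "\<And>i t. 0 < t \<Longrightarrow> norm (f i t) \<le> g t"
    and lim: "\<And>t. 0 < t \<Longrightarrow> (\<lambda>i. f i t) \<longlonglongrightarrow> l t"
  shows "(\<lambda>i. int_pos (f i)) \<longlonglongrightarrow> int_pos l"
proof -
  have lg: "norm (l t) \<le> g t" if "0 < t" for t
    by (rule LIMSEQ_le_const2[OF tendsto_norm[OF lim[OF that]]]) (use le that in auto)
  have ci: "cont_integrable (\<lambda>t. f i t - l t)" for i
    by (rule cont_integrable_diff(1)[OF f l])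
  have "(\<lambda>i. integral\<^sup>L pos_measure (\<lambda>t. norm (f i t - l t))) \<longlonglongrightarrow> integral\<^sup>L pos_measure (\<lambda>t. 0)"
  proof (rule integral_dominated_convergence[where w="\<lambda>t. 2 * g t"])
    show "(\<lambda>t. norm (f i t - l t)) \<in> borel_measurable pos_measure" for i
      using ci by (auto simp: cont_integrable_def)
    show "AE t in pos_measure. norm (norm (f i t - l t)) \<le> 2 * g t" for i
    proof (rule AE_I2)
      fix t :: real assume "t \<in> space pos_measure"
      then have "0 < t" by simp
      from le[OF this, of i] lg[OF this] norm_triangle_ineq4[of "f i t" "l t"]
      show "norm (norm (f i t - l t)) \<le> 2 * g t" by simp
    qed
    show "AE t in pos_measure. (\<lambda>i. norm (f i t - l t)) \<longlonglongrightarrow> 0"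
      using lim by (intro AE_I2 tendsto_norm_zero LIM_zero) auto
  qed (use g in auto)
  then have "(\<lambda>i. integral\<^sup>L pos_measure (\<lambda>t. norm (f i t - l t))) \<longlonglongrightarrow> 0" by simp
  moreover have "\<forall>i. norm (int_pos (f i) - int_pos l) \<le> integral\<^sup>L pos_measure (\<lambda>t. norm (f i t - l t))"
  proof
    show "norm (int_pos (f i) - int_pos l) \<le> integral\<^sup>L pos_measure (\<lambda>t. norm (f i t - l t))" for i
      using norm_int_pos_le[OF ci, of "\<lambda>t. norm (f i t - l t)" i] ci[of i]
      by (simp add: int_pos_diff[OF f l] cont_integrable_def)
  qed
  ultimately have "(\<lambda>i. int_pos (f i) - int_pos l) \<longlonglongrightarrow> 0"
    by (rule Lim_null_comparison[OF always_eventually, rotated])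
  then show ?thesis
    by (simp add: LIM_zero_iff)
qed

lemma int_pos_tendsto_dominated:
  fixes f :: "real \<Rightarrow> real \<Rightarrow> 'a::banach"
  assumes f: "\<forall>\<^sub>F y in at x within S. cont_integrable (f y)" and l: "cont_integrable l"
    and g: "integrable pos_measure g"
    and le: "\<forall>\<^sub>F y in at x within S. \<forall>t>0. norm (f y t) \<le> g t"
    and lim: "\<And>t. 0 < t \<Longrightarrow> ((\<lambda>y. f y t) \<longlongrightarrow> l t) (at x within S)"
  shows "((\<lambda>y. int_pos (f y)) \<longlongrightarrow> int_pos l) (at x within S)"
  unfolding tendsto_at_iff_sequentially comp_def
proof (intro allI impI)
  fix X :: "nat \<Rightarrow> real" assume "\<forall>i. X i \<in> S - {x}" "X \<longlonglongrightarrow> x"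
  then have X: "filterlim X (at x within S) sequentially"
    by (auto simp: filterlim_at)
  have "\<forall>\<^sub>F i in sequentially. cont_integrable (f (X i)) \<and> (\<forall>t>0. norm (f (X i) t) \<le> g t)"
    using X eventually_conj[OF f le] unfolding filterlim_iff by blast
  then obtain N where N: "\<And>i. i \<ge> N \<Longrightarrow> cont_integrable (f (X i))"
    "\<And>i t. i \<ge> N \<Longrightarrow> 0 < t \<Longrightarrow> norm (f (X i) t) \<le> g t"
    by (auto simp: eventually_sequentially)
  have "(\<lambda>i. int_pos (f (X (i + N)))) \<longlonglongrightarrow> int_pos l"
    using N by (intro int_pos_LIMSEQ_dominated[OF _ l g] LIMSEQ_ignore_initial_segment[OF filterlim_compose[OF lim X]]) auto
  then show "(\<lambda>i. int_pos (f (X i))) \<longlonglongrightarrow> int_pos l"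
    by (rule LIMSEQ_offset)
qed

lemma integrable_pos_powr:
  fixes C p q :: real
  assumes "- 1 < p" "q < - 1"
  shows "integrable pos_measure (\<lambda>t. if t \<le> 1 then t powr p else t powr q)"
proof -
  have "(\<lambda>t. t powr p) integrable_on {0<..1}"
    using assms by (intro integrable_on_powr_from_0') auto
  then have 1: "(\<lambda>t. if t \<le> 1 then t powr p else t powr q) integrable_on {0<..1}"
    by (rule integrable_eq) auto
  have "(\<lambda>t. t powr q) integrable_on {1..}"
    using has_integral_powr_to_inf[of q 1] assms by (auto simp: integrable_on_def)
  then have 2: "(\<lambda>t. if t \<le> 1 then t powr p else t powr q) integrable_on {1..}"
    by (rule integrable_spike_finite[of "{1}", rotated 2]) auto
  have "{0<..} = {0<..1} \<union> {1::real..}" "{0<..1} \<inter> {1..} = {1::real}" by auto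
  with integrable_Un'[OF 1 2, of "{0<..}"] have "(\<lambda>t. if t \<le> 1 then t powr p else t powr q) integrable_on {0<..}"
    by simp
  then have "(\<lambda>t. if t \<le> 1 then t powr p else t powr q) absolutely_integrable_on {0<..}"
    by (intro nonnegative_absolutely_integrable_1) auto
  then show ?thesis
    by (simp add: set_integrable_def integrable_restrict_space)
qed

lemma cont_integrable_powr_bound:
  fixes f :: "real \<Rightarrow> 'a::banach"
  assumes f: "continuous_on {0<..} f" and "- 1 < p" "q < - 1"
    and 1: "\<And>t. 0 < t \<Longrightarrow> t \<le> 1 \<Longrightarrow> norm (f t) \<le> C * t powr p"
    and 2: "\<And>t. 1 \<le> t \<Longrightarrow> norm (f t) \<le> C' * t powr q"
  shows "cont_integrable f"
proof (rule cont_integrable_dominated[OF f])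
  show "integrable pos_measure (\<lambda>t. max C C' * (if t \<le> 1 then t powr p else t powr q))"
    using integrable_pos_powr[OF assms(2,3)] by (rule integrable_mult_right)
  show "norm (f t) \<le> max C C' * (if t \<le> 1 then t powr p else t powr q)" if "0 < t" for t
  proof -
    have "C * t powr p \<le> max C C' * t powr p" "C' * t powr q \<le> max C C' * t powr q"
      by (intro mult_right_mono; simp)+
    then have "t \<le> 1 \<Longrightarrow> norm (f t) \<le> max C C' * t powr p" "1 \<le> t \<Longrightarrow> norm (f t) \<le> max C C' * t powr q"
      using 1[OF that] 2[of t] by linarith+
    then show ?thesis by simp
  qed
qed

text \<open>The mean value inequality transfers the bound \<open>g\<close> from the derivatives to
  the difference quotients, after which dominated convergence applies.\<close>

lemma int_pos_has_vector_derivative: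
  fixes f :: "real \<Rightarrow> real \<Rightarrow> 'a::banach"
  assumes y: "y \<in> {p<..<q}"
    and f: "\<And>z. z \<in> {p<..<q} \<Longrightarrow> cont_integrable (f z)" and f': "cont_integrable (f' y)"
    and d: "\<And>z t. z \<in> {p<..<q} \<Longrightarrow> 0 < t \<Longrightarrow> ((\<lambda>z. f z t) has_vector_derivative f' z t) (at z)"
    and g: "integrable pos_measure g"
    and le: "\<And>z t. z \<in> {p<..<q} \<Longrightarrow> 0 < t \<Longrightarrow> norm (f' z t) \<le> g t"
  shows "((\<lambda>z. int_pos (f z)) has_vector_derivative int_pos (f' y)) (at y)"
proof -
  let ?q = "\<lambda>z t. (f z t - f y t) /\<^sub>R (z - y)"
  have ev: "\<forall>\<^sub>F z in at y. z \<in> {p<..<q}"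
    using y by (intro eventually_at_topological[THEN iffD2] exI[of _ "{p<..<q}"]) auto
  have ci: "cont_integrable (?q z)" "int_pos (?q z) = (int_pos (f z) - int_pos (f y)) /\<^sub>R (z - y)"
    if "z \<in> {p<..<q}" for z
    using cont_integrable_scaleR[OF cont_integrable_diff(1)[OF f f, OF that y], of "inverse (z - y)"]
      int_pos_scaleR[OF cont_integrable_diff(1)[OF f f, OF that y], of "inverse (z - y)"]
      int_pos_diff[OF f f, OF that y] by auto
  have "((\<lambda>z. int_pos (?q z)) \<longlongrightarrow> int_pos (f' y)) (at y)"
  proof (rule int_pos_tendsto_dominated[OF _ f' g])
    show "\<forall>\<^sub>F z in at y. cont_integrable (?q z)"
      using ev by eventually_elim (rule ci(1))
    show "((\<lambda>z. ?q z t) \<longlongrightarrow> f' y t) (at y)" if "0 < t" for t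
      using d[OF y that] by (simp add: has_vector_derivative_iff_quotient)
    show "\<forall>\<^sub>F z in at y. \<forall>t>0. norm (?q z t) \<le> g t"
      using ev
    proof eventually_elim
      case (elim z)
      show ?case
      proof (intro allI impI)
        fix t :: real assume t: "0 < t"
        have b: "norm (f z t - f y t) \<le> g t * norm (z - y)"
        proof (rule differentiable_bound[of "{p<..<q}"])
          show "((\<lambda>z. f z t) has_derivative (\<lambda>h. h *\<^sub>R f' w t)) (at w within {p<..<q})" if "w \<in> {p<..<q}" for w
            using d[OF that t] by (auto simp: has_vector_derivative_def intro: has_derivative_at_withinI)
          show "onorm (\<lambda>h. h *\<^sub>R f' w t) \<le> g t" if "w \<in> {p<..<q}" for w
            using le[OF that t] by (intro onorm_le) (simp add: mult_left_mono mult.commute)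
        qed (use elim y in auto)
        show "norm (?q z t) \<le> g t"
        \<comment> \<open>\<open>ev\<close> does not exclude z = y; there the quotient is 0, because
          \<open>inverse 0 = 0\<close>.\<close>
        proof (cases "z = y")
          case True
          then show ?thesis using le[OF y t] norm_ge_zero[of "f' y t"] by (simp del: norm_ge_zero)
        next
          case False
          have "norm (?q z t) = norm (f z t - f y t) / norm (z - y)"
            by (simp add: divide_inverse mult.commute)
          with False b show ?thesis by (simp add: pos_divide_le_eq)
        qed
      qed
    qed
  qed
  then have "((\<lambda>z. (int_pos (f z) - int_pos (f y)) /\<^sub>R (z - y)) \<longlongrightarrow> int_pos (f' y)) (at y)"
    by (rule Lim_transform_eventually) (use ev ci(2) in \<open>auto elim!: eventually_mono\<close>)
  then show ?thesis
    by (simp add: has_vector_derivative_iff_quotient)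
qed

text \<open>The swap is immediate on compact rectangles. The limit in y is then taken over a compact
  x-interval by dominated convergence with majorant \<open>2 * a x\<close>, and afterwards the limit
  in x with majorant \<open>c\<close>. Continuity of the two marginal integrals is a hypothesis so
  that they stay in the class \<open>cont_integrable\<close>.\<close>

lemma int_pos_swap:
  fixes F :: "real \<Rightarrow> real \<Rightarrow> 'a::banach"
  assumes F: "continuous_on ({0<..} \<times> {0<..}) (\<lambda>(x, y). F x y)"
    and Fx: "\<And>x. 0 < x \<Longrightarrow> cont_integrable (F x)" and Fy: "\<And>y. 0 < y \<Longrightarrow> cont_integrable (\<lambda>x. F x y)"
    and a: "integrable pos_measure a" "\<And>x. 0 < x \<Longrightarrow> (\<integral>y. norm (F x y) \<partial>pos_measure) \<le> a x"
    and c: "integrable pos_measure c" "\<And>y. 0 < y \<Longrightarrow> (\<integral>x. norm (F x y) \<partial>pos_measure) \<le> c y"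
    and cx: "continuous_on {0<..} (\<lambda>x. int_pos (F x))"
    and cy: "continuous_on {0<..} (\<lambda>y. int_pos (\<lambda>x. F x y))"
  shows "int_pos (\<lambda>x. int_pos (F x)) = int_pos (\<lambda>y. int_pos (\<lambda>x. F x y))"
proof -
  have Fa: "norm (int_pos (F x)) \<le> a x" if "0 < x" for x
    using norm_int_pos_le[OF Fx[OF that], of "\<lambda>y. norm (F x y)"] Fx[OF that] a(2)[OF that]
    by (auto simp: cont_integrable_def)
  have Fc: "norm (int_pos (\<lambda>x. F x y)) \<le> c y" if "0 < y" for y
    using norm_int_pos_le[OF Fy[OF that], of "\<lambda>x. norm (F x y)"] Fy[OF that] c(2)[OF that]
    by (auto simp: cont_integrable_def)
  have ix: "cont_integrable (\<lambda>x. int_pos (F x))"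
    by (rule cont_integrable_dominated[OF cx a(1) Fa])
  have iy: "cont_integrable (\<lambda>y. int_pos (\<lambda>x. F x y))"
    by (rule cont_integrable_dominated[OF cy c(1) Fc])
  have F': "continuous_on ({0<..} \<times> {0<..}) (\<lambda>(y, x). F x y)"
  proof -
    have "prod.swap ` ({0::real<..} \<times> {0::real<..}) \<subseteq> {0<..} \<times> {0<..}" by auto
    from continuous_on_compose2[OF F continuous_on_swap this] show ?thesis by (simp add: case_prod_beta)
  qed
  \<comment> \<open>Truncated in x only. The fact \<open>step\<close> below identifies its full
    integral over y with the integral of the other marginal over
    \<open>inv_interval n\<close>.\<close>
  define G where "G n y = integral (inv_interval n) (\<lambda>x. F x y)" for n y
  have Gc: "norm (G n y) \<le> c y" if "0 < y" for n y
    using integral_Icc_le_pos[OF Fy[OF that], of "\<lambda>x. norm (F x y)" "1 / real (Suc n)" "real (Suc n)"] Fy[OF that] c(2)[OF that]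
    by (auto simp: cont_integrable_def G_def)
  have contG: "continuous_on {0<..} (G n)" for n
    unfolding G_def[abs_def] using inv_interval_subset[of n]
    by (intro integral_continuous_on_param[where 'b=real, simplified] continuous_on_subset[OF F']) auto
  have iG: "cont_integrable (G n)" for n
    by (rule cont_integrable_dominated[OF contG c(1) Gc])
  have contH: "continuous_on {0<..} (\<lambda>x. integral (inv_interval m) (F x))" for m
    using inv_interval_subset[of m]
    by (intro integral_continuous_on_param[where 'b=real, simplified] continuous_on_subset[OF F]) auto
  have step: "integral (inv_interval n) (\<lambda>x. int_pos (F x)) = int_pos (G n)" for n
  proof -
    let ?d = "\<lambda>m x. integral (inv_interval m) (F x) - int_pos (F x)"
    have pos: "0 < x" if "x \<in> inv_interval n" for x
      using subsetD[OF inv_interval_subset that] by (rule greaterThan_iff[THEN iffD1])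
    have ii: "(\<lambda>x. int_pos (F x)) integrable_on inv_interval n" "(\<lambda>x. integral (inv_interval m) (F x)) integrable_on inv_interval n" for m
      by (intro integrable_continuous_interval continuous_on_subset[OF cx] continuous_on_subset[OF contH] inv_interval_subset)+
    have di: "(\<lambda>x. norm (?d m x)) integrable_on inv_interval n" for m
      by (intro integrable_continuous_interval continuous_intros continuous_on_subset[OF cx] continuous_on_subset[OF contH] inv_interval_subset)
    have "(\<lambda>m. integral (inv_interval n) (\<lambda>x. norm (?d m x))) \<longlonglongrightarrow> integral (inv_interval n) (\<lambda>x. 0::real)"
    proof (rule dominated_convergence(2)[OF di])
      show "(\<lambda>x. 2 * a x) integrable_on inv_interval n"
        using integrable_on_subinterval[OF integrable_pos_integrable_on(1)[OF a(1)] inv_interval_subset]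
        by (rule integrable_on_cmult_left[where 'b=real, simplified])
      show "norm (norm (?d m x)) \<le> 2 * a x" if "x \<in> inv_interval n" for m x
      proof -
        have "norm (integral (inv_interval m) (F x)) \<le> a x"
          using integral_Icc_le_pos[OF Fx[OF pos[OF that]], of "\<lambda>y. norm (F x y)" "1 / real (Suc m)" "real (Suc m)"]
            Fx[OF pos[OF that]] a(2)[OF pos[OF that]] by (auto simp: cont_integrable_def)
        with Fa[OF pos[OF that]] norm_triangle_ineq4[of "integral (inv_interval m) (F x)" "int_pos (F x)"]
        show ?thesis by simp
      qed
      show "(\<lambda>m. norm (?d m x)) \<longlonglongrightarrow> 0" if "x \<in> inv_interval n" for x
        by (intro tendsto_norm_zero LIM_zero int_pos_LIMSEQ Fx pos[OF that])
    qed
    then have "(\<lambda>m. integral (inv_interval n) (\<lambda>x. norm (?d m x))) \<longlonglongrightarrow> 0"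
      by (simp only: Henstock_Kurzweil_Integration.integral_0)
    moreover have "\<forall>m. norm (integral (inv_interval n) (\<lambda>x. integral (inv_interval m) (F x)) - integral (inv_interval n) (\<lambda>x. int_pos (F x)))
      \<le> integral (inv_interval n) (\<lambda>x. norm (?d m x))"
      unfolding Henstock_Kurzweil_Integration.integral_diff[OF ii(2,1), symmetric]
      by (intro allI integral_norm_bound_integral Henstock_Kurzweil_Integration.integrable_diff ii di order_refl)
    ultimately have "(\<lambda>m. integral (inv_interval n) (\<lambda>x. integral (inv_interval m) (F x)) - integral (inv_interval n) (\<lambda>x. int_pos (F x))) \<longlonglongrightarrow> 0"
      by (rule Lim_null_comparison[OF always_eventually, rotated])
    then have "(\<lambda>m. integral (inv_interval n) (\<lambda>x. integral (inv_interval m) (F x))) \<longlonglongrightarrow> integral (inv_interval n) (\<lambda>x. int_pos (F x))"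
      by (simp only: LIM_zero_iff)
    moreover have "integral (inv_interval n) (\<lambda>x. integral (inv_interval m) (F x)) = integral (inv_interval m) (G n)" for m
    proof -
      have "inv_interval n \<times> inv_interval m \<subseteq> {0<..} \<times> {0<..}"
        by (intro Sigma_mono inv_interval_subset)
      then have "continuous_on (cbox (1 / real (Suc n), 1 / real (Suc m)) (real (Suc n), real (Suc m))) (\<lambda>(x, y). F x y)"
        unfolding cbox_Pair_eq box_real by (rule continuous_on_subset[OF F])
      from integral_swap_continuous[OF this] show ?thesis
        by (simp add: G_def[abs_def] del: of_nat_Suc)
    qed
    ultimately show ?thesis
      using int_pos_LIMSEQ[OF iG] by (simp only:) (rule LIMSEQ_unique)
  qed
  have "(\<lambda>n. int_pos (G n)) \<longlonglongrightarrow> int_pos (\<lambda>y. int_pos (\<lambda>x. F x y))"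
    using int_pos_LIMSEQ[OF Fy] Gc
    by (intro int_pos_LIMSEQ_dominated[OF iG iy c(1)]) (auto simp: G_def simp del: of_nat_Suc)
  from LIMSEQ_unique[OF int_pos_LIMSEQ[OF ix, unfolded step] this] show ?thesis .
qed

section \<open>Bounded semigroups with invertible generator\<close>

locale bounded_semigroup =
  fixes T :: "real \<Rightarrow> ('a::banach \<Rightarrow>\<^sub>L 'a)" and D :: "'a set" and L :: "'a \<Rightarrow> 'a" and M :: real
  assumes semigroup: "C0_semigroup T" and generator: "is_generator D L T"
    and norm_T_le: "\<And>t. 0 \<le> t \<Longrightarrow> norm (T t) \<le> M" and M_ge_1: "1 \<le> M"
    and zero_resolvent: "0 \<in> resolvent_set D L"
begin

lemma T_0 [simp]: "T 0 x = x"
  using semigroup by (simp add: C0_semigroup_def)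

lemma T_add: "0 \<le> t \<Longrightarrow> 0 \<le> r \<Longrightarrow> T (t + r) x = T t (T r x)"
  using semigroup by (simp add: C0_semigroup_def)

lemma T_commute: "0 \<le> t \<Longrightarrow> 0 \<le> r \<Longrightarrow> T t (T r x) = T r (T t x)"
  using T_add[of t r x] T_add[of r t x] by (simp add: add.commute)

lemma T_at_right: "((\<lambda>t. T t x) \<longlongrightarrow> x) (at_right 0)"
  using semigroup by (simp add: C0_semigroup_def)

lemma norm_T_apply_le: "0 \<le> t \<Longrightarrow> norm (T t x) \<le> M * norm x"
  using norm_blinfun[of "T t" x] mult_right_mono[OF norm_T_le, of t "norm x"] by simp

text \<open>One formula for increments to either side of \<open>t\<close>: the smaller time is
  factored out and the sign moves to the front, so that right-hand information at 0 controls both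
  sides.\<close>

lemma T_eq_min: 
  assumes "0 \<le> t" "0 \<le> z"
  shows "T z x - T t x = sgn (z - t) *\<^sub>R T (min z t) (T \<bar>z - t\<bar> x - x)"
  using assms T_add[of t "z - t" x] T_add[of z "t - z" x]
  by (cases z t rule: linorder_cases) (auto simp: blinfun.diff_right)

lemma norm_T_diff_le:
  assumes "0 \<le> t" "0 \<le> z"
  shows "norm (T z x - T t x) \<le> M * norm (T \<bar>z - t\<bar> x - x)"
proof (cases "z = t")
  case False
  then have "norm (T z x - T t x) = norm (T (min z t) (T \<bar>z - t\<bar> x - x))"
    by (simp add: T_eq_min[OF assms] abs_sgn_eq)
  then show ?thesis using norm_T_apply_le[of "min z t"] assms by simp
qed simp

lemma continuous_on_T: "continuous_on {0..} (\<lambda>t. T t x)"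
  unfolding continuous_on_iff
proof (intro ballI allI impI)
  fix t e :: real assume t: "t \<in> {0..}" and e: "0 < e"
  have "\<forall>\<^sub>F h in at_right 0. dist (T h x) x < e / M"
    using T_at_right by (rule tendstoD) (use e M_ge_1 in simp)
  then obtain d where d: "d > 0" "\<And>h. 0 < h \<Longrightarrow> h < d \<Longrightarrow> dist (T h x) x < e / M"
    by (auto simp: eventually_at_right_field)
  have "dist (T z x) (T t x) < e" if z: "z \<in> {0..}" "dist z t < d" for z
  proof (cases "z = t")
    case False
    then have "M * norm (T \<bar>z - t\<bar> x - x) < e"
      using d(2)[of "\<bar>z - t\<bar>"] z M_ge_1 by (simp add: dist_norm field_simps)
    then show ?thesis
      using norm_T_diff_le[of t z x] z t by (simp add: dist_norm)
  qed (use e in simp)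
  with d(1) show "\<exists>d>0. \<forall>z\<in>{0..}. dist z t < d \<longrightarrow> dist (T z x) (T t x) < e" by blast
qed

section \<open>The generator on its domain\<close>

lemma mem_D: "x \<in> D \<longleftrightarrow> (\<exists>l. ((\<lambda>h. (T h x - x) /\<^sub>R h) \<longlongrightarrow> l) (at_right 0))"
  using generator by (auto simp: is_generator_def)

lemma L_tendsto: "x \<in> D \<Longrightarrow> ((\<lambda>h. (T h x - x) /\<^sub>R h) \<longlongrightarrow> L x) (at_right 0)"
  using generator by (auto simp: is_generator_def)

lemma L_eqI: "((\<lambda>h. (T h x - x) /\<^sub>R h) \<longlongrightarrow> l) (at_right 0) \<Longrightarrow> x \<in> D \<and> L x = l"
  using L_tendsto[of x] mem_D[of x] tendsto_unique[OF trivial_limit_at_right_real] by blast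

lemma L_add: "x \<in> D \<Longrightarrow> y \<in> D \<Longrightarrow> x + y \<in> D \<and> L (x + y) = L x + L y"
proof (rule L_eqI)
  assume "x \<in> D" "y \<in> D"
  from tendsto_add[OF L_tendsto[OF this(1)] L_tendsto[OF this(2)]]
  show "((\<lambda>h. (T h (x + y) - (x + y)) /\<^sub>R h) \<longlongrightarrow> L x + L y) (at_right 0)"
    by (simp add: blinfun.add_right algebra_simps)
qed

lemma L_scaleR: "x \<in> D \<Longrightarrow> c *\<^sub>R x \<in> D \<and> L (c *\<^sub>R x) = c *\<^sub>R L x"
proof (rule L_eqI)
  assume "x \<in> D"
  from tendsto_scaleR[OF tendsto_const[of c] L_tendsto[OF this]]
  show "((\<lambda>h. (T h (c *\<^sub>R x) - c *\<^sub>R x) /\<^sub>R h) \<longlongrightarrow> c *\<^sub>R L x) (at_right 0)"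
    by (simp add: blinfun.scaleR_right algebra_simps)
qed

lemma L_diff: "x \<in> D \<Longrightarrow> y \<in> D \<Longrightarrow> x - y \<in> D \<and> L (x - y) = L x - L y"
  using L_add[of x "-1 *\<^sub>R y"] L_scaleR[of y "-1"] by simp

lemma L_T: "x \<in> D \<Longrightarrow> 0 \<le> t \<Longrightarrow> T t x \<in> D \<and> L (T t x) = T t (L x)"
proof (rule L_eqI)
  assume "x \<in> D" "0 \<le> t"
  have "((\<lambda>h. T t ((T h x - x) /\<^sub>R h)) \<longlongrightarrow> T t (L x)) (at_right 0)"
    by (intro tendsto_intros L_tendsto \<open>x \<in> D\<close>)
  then show "((\<lambda>h. (T h (T t x) - T t x) /\<^sub>R h) \<longlongrightarrow> T t (L x)) (at_right 0)"
    by (rule Lim_transform_eventually)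
       (use \<open>0 \<le> t\<close> in \<open>auto simp: eventually_at_right_field T_commute[of t] blinfun.scaleR_right blinfun.diff_right intro: exI[of _ 1]\<close>)
qed

text \<open>The generator gives only a right derivative at 0. By \<open>T_eq_min\<close> the
  quotient at z is \<open>T (min z t)\<close> applied to the quotient at 0 with increment |z - t|.
  The uniform bound absorbs the error of that quotient, and strong continuity takes care of
  \<open>min z t\<close>.\<close>

lemma T_has_vector_derivative:
  assumes x: "x \<in> D" and t: "0 < t"
  shows "((\<lambda>t. T t x) has_vector_derivative T t (L x)) (at t)"
  unfolding has_vector_derivative_iff_quotient
proof (rule LIM_zero_cancel, rule Lim_null_comparison)
  let ?\<phi> = "\<lambda>h. (T h x - x) /\<^sub>R h"
  have abs: "filterlim (\<lambda>z. \<bar>z - t\<bar>) (at_right 0) (at t)"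
    unfolding filterlim_at
  proof
    show "\<forall>\<^sub>F z in at t. \<bar>z - t\<bar> \<in> {0<..} \<and> \<bar>z - t\<bar> \<noteq> 0"
      by (auto simp: eventually_at_filter)
    show "((\<lambda>z. \<bar>z - t\<bar>) \<longlongrightarrow> 0) (at t)"
      by (intro tendsto_rabs_zero LIM_zero tendsto_ident_at)
  qed
  have "((\<lambda>z. norm (?\<phi> \<bar>z - t\<bar> - L x)) \<longlongrightarrow> 0) (at t)"
    using filterlim_compose[OF L_tendsto[OF x] abs] by (intro tendsto_norm_zero LIM_zero)
  moreover have "((\<lambda>z. norm (T (min z t) (L x) - T t (L x))) \<longlongrightarrow> 0) (at t)"
  proof (intro tendsto_norm_zero LIM_zero)
    have "isCont (\<lambda>r. T r (L x)) t"
      using continuous_on_interior[OF continuous_on_T, of t "L x"] t by (simp add: interior_real_atLeast)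
    moreover have "((\<lambda>z. min z t) \<longlongrightarrow> min t t) (at t)"
      by (intro tendsto_intros)
    ultimately show "((\<lambda>z. T (min z t) (L x)) \<longlongrightarrow> T t (L x)) (at t)"
      using isCont_tendsto_compose[of t "\<lambda>r. T r (L x)"] by simp
  qed
  ultimately show "((\<lambda>z. M * norm (?\<phi> \<bar>z - t\<bar> - L x) + norm (T (min z t) (L x) - T t (L x))) \<longlongrightarrow> 0) (at t)"
    using tendsto_add[OF tendsto_mult[OF tendsto_const[of M]]] by force
  have "\<forall>\<^sub>F z in at t. 0 < z \<and> z \<noteq> t"
    using t eventually_at_topological[of "\<lambda>z. 0 < z \<and> z \<noteq> t" t UNIV] by (auto intro!: exI[of _ "{0<..}"])
  then show "\<forall>\<^sub>F z in at t. norm ((T z x - T t x) /\<^sub>R (z - t) - T t (L x))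
      \<le> M * norm (?\<phi> \<bar>z - t\<bar> - L x) + norm (T (min z t) (L x) - T t (L x))"
  proof eventually_elim
    case (elim z)
    then have "(T z x - T t x) /\<^sub>R (z - t) = T (min z t) (?\<phi> \<bar>z - t\<bar>)"
      using t inverse_minus_eq[of "t - z"] by (subst T_eq_min) (auto simp: blinfun.scaleR_right sgn_if abs_if)
    then have "(T z x - T t x) /\<^sub>R (z - t) - T t (L x) = T (min z t) (?\<phi> \<bar>z - t\<bar> - L x) + (T (min z t) (L x) - T t (L x))"
      by (simp add: blinfun.diff_right)
    then show ?case
      using norm_T_apply_le[of "min z t" "?\<phi> \<bar>z - t\<bar> - L x"] t elim
      by (simp only:) (rule norm_triangle_le, simp)
  qed
qed

definition B :: "'a \<Rightarrow>\<^sub>L 'a" where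
  "B = bounded_inverse D (\<lambda>x. - L x)"

lemma B_inverse: "is_bounded_inverse D (\<lambda>x. - L x) B"
proof -
  obtain R where R: "is_bounded_inverse D (\<lambda>x. - L x) R"
    using zero_resolvent by (auto simp: resolvent_set_def)
  have "R' = R" if "is_bounded_inverse D (\<lambda>x. - L x) R'" for R'
  proof (rule blinfun_eqI)
    show "R' x = R x" for x
      using R that unfolding is_bounded_inverse_def by metis
  qed
  with R show ?thesis
    unfolding B_def bounded_inverse_def by (rule theI)
qed

lemma B_mem: "B x \<in> D" and L_B: "L (B x) = - x" and B_L: "x \<in> D \<Longrightarrow> B (L x) = - x"
  using B_inverse unfolding is_bounded_inverse_def
  by (metis minus_minus, metis minus_minus, metis blinfun.minus_right minus_minus)

lemma B_T: "0 \<le> t \<Longrightarrow> B (T t x) = T t (B x)"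
proof -
  assume t: "0 \<le> t"
  have "L (T t (B x)) = - T t x"
    using L_T[OF B_mem t] by (simp add: L_B blinfun.minus_right)
  then show ?thesis
    using B_L[of "T t (B x)"] L_T[OF B_mem t] by (simp add: blinfun.minus_right)
qed

lemma B_eq_0: "B x = 0 \<Longrightarrow> x = 0"
  using L_B[of x] L_scaleR[OF B_mem, of 0 x] by simp

end

section \<open>Laplace transforms, resolvents and fractional powers\<close>

lemma int_pos_scaleR_left:
  fixes w :: "real \<Rightarrow> real" and v :: "'a::banach"
  assumes "cont_integrable w"
  shows "cont_integrable (\<lambda>t. w t *\<^sub>R v)" "int_pos (\<lambda>t. w t *\<^sub>R v) = int_pos w *\<^sub>R v"
  using cont_integrable_bounded_linear[OF assms bounded_linear_scaleR_left]
    int_pos_bounded_linear[OF assms bounded_linear_scaleR_left] by blast+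

lemma cont_integrable_exp:
  assumes c: "0 < c"
  shows "cont_integrable (\<lambda>t. exp (- c * t) :: real)" and int_pos_exp: "int_pos (\<lambda>t. exp (- c * t) :: real) = 1 / c"
proof -
  show *: "cont_integrable (\<lambda>t. exp (- c * t) :: real)"
  proof (rule cont_integrable_powr_bound[where p=0 and q="-2" and C=1 and C'="2 / c\<^sup>2"])
    show "norm (exp (- c * t)) \<le> 2 / c\<^sup>2 * t powr - 2" if "1 \<le> t" for t
    proof -
      have "(c * t)\<^sup>2 / 2 \<le> exp (c * t)"
        using exp_lower_Taylor_quadratic[of "c * t"] mult_pos_pos[of c t] that c by linarith
      then have "c\<^sup>2 * t\<^sup>2 \<le> 2 * exp (c * t)" by (simp add: power_mult_distrib)
      then show ?thesis
        using that c by (simp add: powr_minus powr_numeral exp_minus divide_simps mult.commute)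
    qed
  qed (use c in \<open>auto intro!: continuous_intros\<close>)
  have "int_pos (\<lambda>t. exp (- c * t)) = 0 - (- 1 / c)"
  proof (rule int_pos_FTC[OF *])
    show "((\<lambda>t. - exp (- c * t) / c) has_vector_derivative exp (- c * t)) (at t)" for t
      using c by (auto intro!: derivative_eq_intros simp: has_real_derivative_iff_has_vector_derivative[symmetric])
    have "((\<lambda>t. - exp (- c * t) / c) \<longlongrightarrow> - exp (- c * 0) / c) (at_right 0)"
      using c by (intro tendsto_intros) auto
    then show "((\<lambda>t. - exp (- c * t) / c) \<longlongrightarrow> - 1 / c) (at_right 0)" by simp
    show "((\<lambda>t. - exp (- c * t) / c) \<longlongrightarrow> 0) at_top"
      using c by real_asymp
  qed
  then show "int_pos (\<lambda>t. exp (- c * t) :: real) = 1 / c" by simp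
qed

context bounded_semigroup
begin

text \<open>The Hille-Phillips calculus: \<open>\<Phi> a\<close> is the Laplace transform of
  \<open>a\<close> evaluated at -L. Resolvents, regularised fractional powers and the extension are
  all instances, so commutation and integration by parts are proved once for general
  weights.\<close>

definition \<Phi> :: "(real \<Rightarrow> real) \<Rightarrow> 'a \<Rightarrow> 'a" where
  "\<Phi> a x = int_pos (\<lambda>t. a t *\<^sub>R T t x)"

lemma continuous_on_T_pos: "continuous_on {0<..} (\<lambda>t. T t x)"
  by (rule continuous_on_subset[OF continuous_on_T]) auto

lemma cont_integrable_T:
  assumes "cont_integrable a"
  shows "cont_integrable (\<lambda>t. a t *\<^sub>R T t x)"
proof (rule cont_integrable_dominated[where g="\<lambda>t. norm (a t) * (M * norm x)"])
  show "continuous_on {0<..} (\<lambda>t. a t *\<^sub>R T t x)"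
    using assms by (intro continuous_intros continuous_on_T_pos) (auto simp: cont_integrable_def)
qed (use assms norm_T_apply_le[of _ x] in \<open>auto simp: cont_integrable_def intro!: mult_left_mono\<close>)

lemma norm_\<Phi>_le:
  assumes "cont_integrable a" "integrable pos_measure g" "\<And>t. 0 < t \<Longrightarrow> \<bar>a t\<bar> \<le> g t"
  shows "norm (\<Phi> a x) \<le> integral\<^sup>L pos_measure g * (M * norm x)"
proof -
  have "norm (\<Phi> a x) \<le> (\<integral>t. g t * (M * norm x) \<partial>pos_measure)"
    unfolding \<Phi>_def
    using assms norm_T_apply_le[of _ x] M_ge_1
    by (intro norm_int_pos_le cont_integrable_T)
       (auto intro!: mult_mono order_trans[OF abs_ge_zero assms(3)])
  then show ?thesis by simp
qed

lemma bounded_linear_\<Phi>: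
  assumes a: "cont_integrable a" shows "bounded_linear (\<Phi> a)"
proof
  show "\<Phi> a (x + y) = \<Phi> a x + \<Phi> a y" for x y
    unfolding \<Phi>_def int_pos_add[OF cont_integrable_T[OF a] cont_integrable_T[OF a], symmetric]
    by (simp add: blinfun.add_right scaleR_add_right)
  show "\<Phi> a (r *\<^sub>R x) = r *\<^sub>R \<Phi> a x" for r x
    unfolding \<Phi>_def int_pos_scaleR[OF cont_integrable_T[OF a], symmetric]
    by (simp add: blinfun.scaleR_right mult.commute)
  have "norm (\<Phi> a x) \<le> norm x * (integral\<^sup>L pos_measure (\<lambda>t. \<bar>a t\<bar>) * M)" for x
    using norm_\<Phi>_le[OF a, of "\<lambda>t. \<bar>a t\<bar>" x] a by (auto simp: cont_integrable_def mult_ac)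
  then show "\<exists>K. \<forall>x. norm (\<Phi> a x) \<le> norm x * K" by blast
qed

text \<open>A bounded operator that commutes with the semigroup commutes with the whole calculus.
  The choices \<open>T r\<close>, \<open>B\<close> and another \<open>\<Phi>\<close> for
  \<open>h\<close> give the next three lemmas.\<close>

lemma \<Phi>_commute_linear:
  assumes a: "cont_integrable a" and h: "bounded_linear h" and hT: "\<And>t. 0 < t \<Longrightarrow> h (T t x) = T t (h x)"
  shows "h (\<Phi> a x) = \<Phi> a (h x)"
  unfolding \<Phi>_def int_pos_bounded_linear[OF cont_integrable_T[OF a] h, symmetric]
  by (rule int_pos_cong) (simp add: linear_scale[OF bounded_linear.linear[OF h]] hT)

lemma T_\<Phi>: "cont_integrable a \<Longrightarrow> 0 \<le> r \<Longrightarrow> T r (\<Phi> a x) = \<Phi> a (T r x)"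
  by (rule \<Phi>_commute_linear[OF _ blinfun.bounded_linear_right]) (auto simp: T_commute)

lemma B_\<Phi>: "cont_integrable a \<Longrightarrow> B (\<Phi> a x) = \<Phi> a (B x)"
  by (rule \<Phi>_commute_linear[OF _ blinfun.bounded_linear_right]) (auto simp: B_T)

lemma \<Phi>_\<Phi>: "cont_integrable a \<Longrightarrow> cont_integrable b \<Longrightarrow> \<Phi> a (\<Phi> b x) = \<Phi> b (\<Phi> a x)"
  by (rule \<Phi>_commute_linear[OF _ bounded_linear_\<Phi>]) (auto simp: T_\<Phi>)

lemma \<Phi>_scale: "cont_integrable a \<Longrightarrow> \<Phi> (\<lambda>t. c * a t) x = c *\<^sub>R \<Phi> a x"
  unfolding \<Phi>_def int_pos_scaleR[OF cont_integrable_T, symmetric] by simp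

lemma \<Phi>_add: "cont_integrable a \<Longrightarrow> cont_integrable b \<Longrightarrow> \<Phi> (\<lambda>t. a t + b t) x = \<Phi> a x + \<Phi> b x"
  unfolding \<Phi>_def by (subst int_pos_add[symmetric]) (auto intro: cont_integrable_T simp: scaleR_add_left)

text \<open>Integration by parts applied to \<open>a t *\<^sub>R T t (B x)\<close>, whose factor \<open>T t (B x)\<close> has derivative \<open>- T t x\<close>.\<close>

lemma \<Phi>_eq_B:
  assumes a: "cont_integrable a" and a': "cont_integrable a'"
    and d: "\<And>t. 0 < t \<Longrightarrow> (a has_real_derivative a' t) (at t)"
    and a0: "(a \<longlongrightarrow> a0) (at_right 0)" and a1: "(a \<longlongrightarrow> 0) at_top"
  shows "\<Phi> a x = B (\<Phi> a' x + a0 *\<^sub>R x)"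
proof -
  have "int_pos (\<lambda>t. a' t *\<^sub>R T t (B x) - a t *\<^sub>R T t x) = 0 - a0 *\<^sub>R B x"
  proof (rule int_pos_FTC)
    show "cont_integrable (\<lambda>t. a' t *\<^sub>R T t (B x) - a t *\<^sub>R T t x)"
      by (intro cont_integrable_diff cont_integrable_T a a')
    show "((\<lambda>t. a t *\<^sub>R T t (B x)) has_vector_derivative a' t *\<^sub>R T t (B x) - a t *\<^sub>R T t x) (at t)" if "0 < t" for t
      using has_vector_derivative_scaleR[OF d[OF that] T_has_vector_derivative[OF B_mem that, of x]]
      by (simp add: L_B blinfun.minus_right add.commute)
    show "((\<lambda>t. a t *\<^sub>R T t (B x)) \<longlongrightarrow> a0 *\<^sub>R B x) (at_right 0)"
      by (intro tendsto_intros a0 T_at_right)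
    have "((\<lambda>t. norm (a t) * (M * norm (B x))) \<longlongrightarrow> 0) at_top"
      using tendsto_mult_left_zero[OF tendsto_norm_zero[OF a1]] by simp
    then show "((\<lambda>t. a t *\<^sub>R T t (B x)) \<longlongrightarrow> 0) at_top"
    proof (rule Lim_null_comparison[rotated])
      show "\<forall>\<^sub>F t in at_top. norm (a t *\<^sub>R T t (B x)) \<le> norm (a t) * (M * norm (B x))"
        using eventually_ge_at_top[of 0] by eventually_elim (auto intro: mult_left_mono norm_T_apply_le)
    qed
  qed
  then have "\<Phi> a' (B x) - \<Phi> a x = - (a0 *\<^sub>R B x)"
    unfolding \<Phi>_def by (simp add: int_pos_diff cont_integrable_T a a')
  then show ?thesis
    by (simp add: blinfun.add_right blinfun.scaleR_right B_\<Phi>[OF a'] algebra_simps)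
qed

text \<open>The resolvent of L as a Laplace transform. \<open>R_eq_B\<close> is the equation (z - L)
  R(z) x = x after applying B, a form that keeps the domain of L out of later computations.\<close>

definition R :: "real \<Rightarrow> 'a \<Rightarrow> 'a" where
  "R z = \<Phi> (\<lambda>t. exp (- z * t))"

lemma bounded_linear_R: "0 < z \<Longrightarrow> bounded_linear (R z)"
  unfolding R_def by (intro bounded_linear_\<Phi> cont_integrable_exp)

lemma R_eq_B: assumes "0 < z" shows "R z x = B (x - z *\<^sub>R R z x)"
proof -
  have "R z x = B (\<Phi> (\<lambda>t. - z * exp (- z * t)) x + 1 *\<^sub>R x)"
    unfolding R_def
  proof (rule \<Phi>_eq_B)
    have "cont_integrable (\<lambda>t. (- z) *\<^sub>R exp (- z * t))"
      by (rule cont_integrable_scaleR[OF cont_integrable_exp(1)[OF assms]])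
    then show "cont_integrable (\<lambda>t. - z * exp (- z * t))" by simp
    show "((\<lambda>t. exp (- z * t)) has_real_derivative - z * exp (- z * t)) (at t)" for t
      by (auto intro!: derivative_eq_intros)
    have "((\<lambda>t. exp (- z * t)) \<longlongrightarrow> exp (- z * 0)) (at_right 0)"
      by (intro tendsto_intros)
    then show "((\<lambda>t. exp (- z * t)) \<longlongrightarrow> 1) (at_right 0)" by simp
    show "((\<lambda>t. exp (- z * t)) \<longlongrightarrow> 0) at_top"
      using assms by real_asymp
  qed (rule cont_integrable_exp(1)[OF assms])
  moreover have "\<Phi> (\<lambda>t. - z * exp (- z * t)) x = - z *\<^sub>R R z x"
    using \<Phi>_scale[OF cont_integrable_exp(1)[OF assms], of "- z" x] by (simp only: R_def)
  ultimately have "R z x = B (- z *\<^sub>R R z x + 1 *\<^sub>R x)" by (simp only:)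
  then show ?thesis by simp
qed

lemma B_R: "0 < z \<Longrightarrow> B (R z x) = R z (B x)"
  unfolding R_def by (intro B_\<Phi> cont_integrable_exp)

lemma norm_R_le: "0 < z \<Longrightarrow> norm (z *\<^sub>R R z x) \<le> M * norm x"
proof -
  assume l: "0 < z"
  note e = cont_integrable_exp(1)[OF l]
  have "norm (R z x) \<le> integral\<^sup>L pos_measure (\<lambda>t. exp (- z * t)) * (M * norm x)"
    unfolding R_def using e by (intro norm_\<Phi>_le) (auto simp: cont_integrable_def)
  also have "\<dots> = (1 / z) * (M * norm x)"
    using int_pos_real[OF e] int_pos_exp[OF l] by simp
  finally show ?thesis using l by (simp add: field_simps)
qed

text \<open>By \<open>R_eq_B\<close> the norm of \<open>R z x\<close> is at most
  \<open>norm B * (1 + M) * norm x\<close>, and z times that norm is at most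
  \<open>M * norm x\<close>. The constant is the sum of the two. The first bound rests on the
  invertibility of L and keeps the estimate finite as z tends to 0.\<close>

definition resolvent_bound :: real where
  "resolvent_bound = norm B * (1 + M) + M"

lemma resolvent_bound_nonneg: "0 \<le> resolvent_bound"
  using M_ge_1 by (simp add: resolvent_bound_def)

lemma norm_R_le_div: assumes "0 < z" shows "norm (R z x) \<le> resolvent_bound / (1 + z) * norm x"
proof -
  have "norm (R z x) \<le> norm B * norm (x - z *\<^sub>R R z x)"
    by (subst R_eq_B[OF assms]) (rule norm_blinfun)
  also have "\<dots> \<le> norm B * (norm x + M * norm x)"
    using norm_triangle_ineq4[of x "z *\<^sub>R R z x"] norm_R_le[OF assms, of x] by (intro mult_left_mono) auto
  finally have "norm (R z x) + z * norm (R z x) \<le> resolvent_bound * norm x"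
    using norm_R_le[OF assms, of x] assms by (simp add: resolvent_bound_def algebra_simps)
  then show ?thesis using assms by (simp add: field_simps)
qed

lemma norm_R_le_const: assumes "0 < z" shows "norm (R z x) \<le> resolvent_bound * norm x"
  using norm_R_le_div[OF assms, of x] assms resolvent_bound_nonneg
    mult_right_mono[of "resolvent_bound / (1 + z)" resolvent_bound "norm x"]
  by (simp add: divide_le_eq mult_le_cancel_left1 order_trans)

text \<open>The argument of \<open>R z\<close> is (z - L) B x, so this is the left-inverse half of
  the resolvent property.\<close>

lemma R_add_scaleR_B: assumes "0 < z" shows "R z (x + z *\<^sub>R B x) = B x"
proof -
  interpret R: bounded_linear "R z" by (rule bounded_linear_R[OF assms])
  have "R z (x + z *\<^sub>R B x) = R z x + z *\<^sub>R B (R z x)"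
    by (simp add: R.add R.scaleR B_R[OF assms])
  also have "\<dots> = B (x - z *\<^sub>R R z x) + z *\<^sub>R B (R z x)"
    by (subst R_eq_B[OF assms]) simp
  finally show ?thesis by (simp add: blinfun.diff_right blinfun.scaleR_right)
qed

text \<open>The resolvent identity, obtained by comparing both sides after applying the injective
  \<open>B\<close>. It yields the Lipschitz bound behind the continuity of z \<mapsto> R(z)
  x.\<close>

lemma R_diff: assumes "0 < z" "0 < \<mu>" shows "R z x - R \<mu> x = (\<mu> - z) *\<^sub>R R z (R \<mu> x)"
proof -
  interpret R: bounded_linear "R z" by (rule bounded_linear_R[OF assms(1)])
  let ?d = "R z x - R \<mu> x"
  have "R z (?d + z *\<^sub>R B ?d) = B ?d"
    by (rule R_add_scaleR_B[OF assms(1)])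
  have "?d = B (x - z *\<^sub>R R z x) - B (x - \<mu> *\<^sub>R R \<mu> x)"
    using R_eq_B[OF assms(1), of x] R_eq_B[OF assms(2), of x] by simp
  then have d: "?d + z *\<^sub>R B ?d = (\<mu> - z) *\<^sub>R B (R \<mu> x)"
    by (simp add: blinfun.diff_right blinfun.scaleR_right algebra_simps)
  have "B ?d = (\<mu> - z) *\<^sub>R B (R z (R \<mu> x))"
    using R_add_scaleR_B[OF assms(1), of ?d] unfolding d by (simp add: R.scaleR B_R[OF assms(1)])
  then have "B (?d - (\<mu> - z) *\<^sub>R R z (R \<mu> x)) = 0"
    by (simp add: blinfun.diff_right blinfun.scaleR_right)
  from B_eq_0[OF this] show ?thesis by simp
qed

lemma norm_R_diff_le: assumes "0 < z" "0 < \<mu>"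
  shows "norm (R z x - R \<mu> x) \<le> \<bar>\<mu> - z\<bar> * (resolvent_bound * (resolvent_bound * norm x))"
proof -
  have "norm (R z (R \<mu> x)) \<le> resolvent_bound * (resolvent_bound * norm x)"
    using norm_R_le_const[OF assms(1), of "R \<mu> x"] norm_R_le_const[OF assms(2), of x] resolvent_bound_nonneg
    by (meson mult_left_mono order_trans)
  then show ?thesis
    by (simp add: R_diff[OF assms] mult_left_mono)
qed

lemma continuous_on_R: "continuous_on {0<..} (\<lambda>z. R z x)"
  unfolding continuous_on_def
proof
  fix \<mu> :: real assume m: "\<mu> \<in> {0<..}"
  show "((\<lambda>z. R z x) \<longlongrightarrow> R \<mu> x) (at \<mu> within {0<..})"
  proof (rule LIM_zero_cancel, rule Lim_null_comparison)
    show "\<forall>\<^sub>F z in at \<mu> within {0<..}. norm (R z x - R \<mu> x) \<le> \<bar>\<mu> - z\<bar> * (resolvent_bound * (resolvent_bound * norm x))"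
      unfolding eventually_at_filter using norm_R_diff_le[of _ \<mu> x] m by (intro always_eventually) auto
    have "((\<lambda>z. \<bar>\<mu> - z\<bar> * (resolvent_bound * (resolvent_bound * norm x))) \<longlongrightarrow> \<bar>\<mu> - \<mu>\<bar> * (resolvent_bound * (resolvent_bound * norm x))) (at \<mu> within {0<..})"
      by (intro tendsto_intros)
    then show "((\<lambda>z. \<bar>\<mu> - z\<bar> * (resolvent_bound * (resolvent_bound * norm x))) \<longlongrightarrow> 0) (at \<mu> within {0<..})" by simp
  qed
qed

end

section \<open>Gamma integrals and scalar majorants\<close>

lemma Gamma_reflection_real:
  fixes s :: real
  assumes "0 < s" "s < 1"
  shows "sin (s * pi) / pi * Gamma (1 - s) = 1 / Gamma s"
proof -
  have "complex_of_real (Gamma s * Gamma (1 - s)) = complex_of_real (pi / sin (pi * s))"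
    using Gamma_reflection_complex[of "complex_of_real s"]
    by (simp add: Gamma_complex_of_real[symmetric] sin_of_real[symmetric])
  then have "Gamma s * Gamma (1 - s) = pi / sin (pi * s)"
    using of_real_eq_iff by blast
  moreover have "0 < sin (pi * s)" using assms by (intro sin_gt_zero) auto
  moreover have "0 < Gamma s" using assms by simp
  ultimately show ?thesis by (simp add: field_simps)
qed

lemma cont_integrable_Gamma:
  fixes a c :: real
  assumes a: "0 < a" and c: "0 < c"
  shows "cont_integrable (\<lambda>t. t powr (a - 1) * exp (- c * t))"
    and int_pos_Gamma: "int_pos (\<lambda>t. t powr (a - 1) * exp (- c * t)) = Gamma a * c powr (- a)"
proof -
  let ?f = "\<lambda>t. t powr (a - 1) / exp t"
  have "(?f has_integral Gamma a) {0..}" using a by (rule Gamma_integral_real)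
  then have f: "(?f has_integral Gamma a) {0<..}"
    by (rule has_integral_spike_set_eq[THEN iffD1, rotated 2])
       (auto intro: negligible_subset[of "{0}"])
  then have "?f absolutely_integrable_on {0<..}"
    by (intro nonnegative_absolutely_integrable_1) auto
  then have "integrable pos_measure ?f"
    by (simp add: set_integrable_def integrable_restrict_space)
  then have ci: "cont_integrable ?f"
    by (intro cont_integrable_dominated[where g="?f"] continuous_intros) auto
  have ip: "int_pos ?f = Gamma a"
    using int_pos_real[OF ci] integrable_pos_integrable_on(2)[OF \<open>integrable pos_measure ?f\<close>] integral_unique[OF f] by simp
  have eq: "t powr (a - 1) * exp (- c * t) = c powr (- a) *\<^sub>R (c *\<^sub>R ?f (c * t))" if "0 < t" for t
    using that c by (simp add: powr_mult powr_diff powr_minus exp_minus field_simps)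
  show "cont_integrable (\<lambda>t. t powr (a - 1) * exp (- c * t))"
  proof -
    have "cont_integrable (\<lambda>t. t powr (a - 1) * exp (- c * t)) \<longleftrightarrow> cont_integrable (\<lambda>t. c powr (- a) *\<^sub>R (c *\<^sub>R ?f (c * t)))"
      by (rule cont_integrable_cong) (rule eq)
    then show ?thesis
      using cont_integrable_scaleR[OF cont_integrable_scale(1)[OF ci c]] by (simp only:)
  qed
  have "int_pos (\<lambda>t. t powr (a - 1) * exp (- c * t)) = int_pos (\<lambda>t. c powr (- a) *\<^sub>R (c *\<^sub>R ?f (c * t)))"
    by (rule int_pos_cong(1)[OF eq])
  also have "\<dots> = c powr (- a) *\<^sub>R Gamma a"
    by (subst int_pos_scaleR[OF cont_integrable_scale(1)[OF ci c]]) (simp only: int_pos_scale[OF ci c] ip)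
  finally show "int_pos (\<lambda>t. t powr (a - 1) * exp (- c * t)) = Gamma a * c powr (- a)"
    by (simp add: mult.commute)
qed

lemma integrable_if_cont_integrable:
  fixes g :: "real \<Rightarrow> real"
  assumes "cont_integrable g" "\<And>t. 0 < t \<Longrightarrow> 0 \<le> g t"
  shows "integrable pos_measure g"
proof -
  have "integrable pos_measure (\<lambda>t. norm (g t))" using assms(1) by (simp add: cont_integrable_def)
  then show ?thesis
    by (rule Bochner_Integration.integrable_cong[THEN iffD1, rotated 2]) (use assms(2) in auto)
qed

lemma cont_integrable_powr_div:
  fixes p :: real assumes p: "- 1 < p" "p < 0" and e: "0 < e"
  shows "cont_integrable (\<lambda>z. z powr p / (e + z))"
proof (rule cont_integrable_powr_bound[where p=p and q="p - 1" and C="1 / e" and C'=1])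
  show "norm (z powr p / (e + z)) \<le> 1 / e * z powr p" if "0 < z" for z
    using that e by (simp add: divide_simps mult_left_mono)
  show "norm (z powr p / (e + z)) \<le> 1 * z powr (p - 1)" if "1 \<le> z" for z
    using that e by (simp add: powr_diff divide_left_mono)
qed (use p e in \<open>auto intro!: continuous_intros\<close>)

context bounded_semigroup
begin

section \<open>Fractional powers of B through the resolvent of L\<close>

abbreviation "Bpow \<equiv> bounded_frac_power B"

text \<open>The inverse of 1/z + B is z (1 - z R(z)), as \<open>R_eq_B\<close> shows on multiplying
  out. On B x it takes the value z R(z) x, again by \<open>R_eq_B\<close>, so the operator inverse
  in the definition of the fractional power becomes a resolvent of L.\<close>

lemma bounded_inverse_shift:
  assumes z: "0 < z"
  shows "bounded_inverse UNIV (\<lambda>x. (1 / z) *\<^sub>R x + B x) (B x) = z *\<^sub>R R z x"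
proof -
  interpret R: bounded_linear "R z" by (rule bounded_linear_R[OF z])
  let ?Q = "\<lambda>v. z *\<^sub>R (v - z *\<^sub>R R z v)"
  have Q: "bounded_linear ?Q"
    by (intro bounded_linear_const_scaleR bounded_linear_sub bounded_linear_ident R.bounded_linear_axioms)
  define Qb where "Qb = Blinfun ?Q"
  have Qb: "blinfun_apply Qb = ?Q"
    unfolding Qb_def by (rule bounded_linear_Blinfun_apply[OF Q])
  have 1: "(1 / z) *\<^sub>R Qb v + B (Qb v) = v" for v
  proof -
    have "B (Qb v) = z *\<^sub>R R z v"
      by (subst R_eq_B[OF z]) (simp add: Qb blinfun.scaleR_right)
    then show ?thesis using z by (simp add: Qb)
  qed
  have 2: "Qb ((1 / z) *\<^sub>R x + B x) = x" for x
  proof -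
    have "z *\<^sub>R ((1 / z) *\<^sub>R x + B x) = x + z *\<^sub>R B x"
      using z by (simp add: scaleR_add_right)
    then have "R z (z *\<^sub>R ((1 / z) *\<^sub>R x + B x)) = B x"
      using R_add_scaleR_B[OF z, of x] by simp
    then have "z *\<^sub>R R z ((1 / z) *\<^sub>R x + B x) = B x" by (simp only: R.scaleR)
    then show ?thesis using z by (simp add: Qb)
  qed
  have inv: "is_bounded_inverse UNIV (\<lambda>x. (1 / z) *\<^sub>R x + B x) Qb"
    using 1 2 by (simp add: is_bounded_inverse_def)
  moreover have "Q' = Qb" if Q': "is_bounded_inverse UNIV (\<lambda>x. (1 / z) *\<^sub>R x + B x) Q'" for Q'
  proof (rule blinfun_eqI)
    show "Q' x = Qb x" for x
      using inv Q' unfolding is_bounded_inverse_def by (metis UNIV_I)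
  qed
  ultimately have "bounded_inverse UNIV (\<lambda>x. (1 / z) *\<^sub>R x + B x) = Qb"
    unfolding bounded_inverse_def by (intro the_equality)
  moreover have "Qb (B x) = z *\<^sub>R R z x"
  proof -
    have "Qb (B x) = z *\<^sub>R B (x - z *\<^sub>R R z x)"
      by (simp add: Qb B_R[OF z] blinfun.diff_right blinfun.scaleR_right)
    then show ?thesis by (simp only: R_eq_B[OF z, symmetric])
  qed
  ultimately show ?thesis by simp
qed

lemma cont_integrable_powr_R:
  assumes s: "0 < s" "s < 1"
  shows "cont_integrable (\<lambda>z. z powr (- s) *\<^sub>R R z x)"
proof (rule cont_integrable_dominated[where g="\<lambda>z. (z powr (- s) / (1 + z)) * (resolvent_bound * norm x)"])
  show "continuous_on {0<..} (\<lambda>z. z powr (- s) *\<^sub>R R z x)"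
    by (intro continuous_intros continuous_on_R) auto
  show "integrable pos_measure (\<lambda>z. (z powr (- s) / (1 + z)) * (resolvent_bound * norm x))"
    using s by (intro integrable_mult_left integrable_if_cont_integrable cont_integrable_powr_div) auto
  show "norm (z powr (- s) *\<^sub>R R z x) \<le> (z powr (- s) / (1 + z)) * (resolvent_bound * norm x)" if "0 < z" for z
    using mult_left_mono[OF norm_R_le_div[OF that, of x], of "z powr (- s)"] by simp
qed

text \<open>With \<mu> = 1/z, the factor z from \<open>bounded_inverse_shift\<close>, \<mu>^(s-1) =
  z^(1-s) and d\<mu> = dz/z^2 combine to the weight z^(-s).\<close>

lemma bounded_frac_power_eq:
  assumes s: "0 < s" "s < 1"
  shows "Bpow s x = (sin (s * pi) / pi) *\<^sub>R int_pos (\<lambda>z. z powr (- s) *\<^sub>R R z x)"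
proof -
  have "int_pos (\<lambda>m. m powr (s - 1) *\<^sub>R bounded_inverse UNIV (\<lambda>x. m *\<^sub>R x + B x) (B x))
    = int_pos (\<lambda>m. (1 / m\<^sup>2) *\<^sub>R ((1 / m) powr (- s) *\<^sub>R R (1 / m) x))"
  proof (rule int_pos_cong(1))
    fix m :: real assume m: "0 < m"
    then have "m powr (s - 1) * (1 / m) = (1 / m\<^sup>2) * (1 / m) powr (- s)"
      by (simp add: powr_diff powr_divide powr_minus power2_eq_square)
    then show "m powr (s - 1) *\<^sub>R bounded_inverse UNIV (\<lambda>x. m *\<^sub>R x + B x) (B x)
        = (1 / m\<^sup>2) *\<^sub>R ((1 / m) powr (- s) *\<^sub>R R (1 / m) x)"
      using bounded_inverse_shift[of "1 / m" x] m by simp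
  qed
  also have "\<dots> = int_pos (\<lambda>z. z powr (- s) *\<^sub>R R z x)"
    by (rule int_pos_inverse[OF cont_integrable_powr_R[OF s] zero_less_one])
  finally show ?thesis by (simp add: bounded_frac_power_def)
qed

text \<open>Lets B^s pass through every integral of the semigroup against a scalar weight, in
  particular through the extension and its weighted derivative; the converse half of (b) relies on
  this.\<close>

lemma bounded_frac_power_\<Phi>:
  assumes s: "0 < s" "s < 1" and a: "cont_integrable a"
  shows "\<Phi> a (Bpow s x) = Bpow s (\<Phi> a x)"
proof -
  interpret a: bounded_linear "\<Phi> a" by (rule bounded_linear_\<Phi>[OF a])
  have "int_pos (\<lambda>z. z powr (- s) *\<^sub>R R z (\<Phi> a x)) = int_pos (\<lambda>z. \<Phi> a (z powr (- s) *\<^sub>R R z x))"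
  proof (rule int_pos_cong(1))
    fix z :: real assume "0 < z"
    then have "R z (\<Phi> a x) = \<Phi> a (R z x)"
      unfolding R_def using a by (intro \<Phi>_\<Phi> cont_integrable_exp(1))
    then show "z powr (- s) *\<^sub>R R z (\<Phi> a x) = \<Phi> a (z powr (- s) *\<^sub>R R z x)"
      by (simp only: a.scaleR)
  qed
  also have "\<dots> = \<Phi> a (int_pos (\<lambda>z. z powr (- s) *\<^sub>R R z x))"
    by (rule int_pos_bounded_linear[OF cont_integrable_powr_R[OF s] a.bounded_linear_axioms])
  finally show ?thesis by (simp add: bounded_frac_power_eq[OF s] a.scaleR)
qed

lemma bounded_linear_bounded_frac_power:
  assumes s: "0 < s" "s < 1"
  shows "bounded_linear (Bpow s)"
proof -
  note ci = cont_integrable_powr_R[OF s]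
  let ?g = "\<lambda>z. z powr (- s) / (1 + z) :: real"
  have g: "integrable pos_measure ?g"
    using s by (intro integrable_if_cont_integrable cont_integrable_powr_div) auto
  have "bounded_linear (\<lambda>x. int_pos (\<lambda>z. z powr (- s) *\<^sub>R R z x))"
  proof
    fix x y :: 'a and r :: real
    show "int_pos (\<lambda>z. z powr (- s) *\<^sub>R R z (x + y)) = int_pos (\<lambda>z. z powr (- s) *\<^sub>R R z x) + int_pos (\<lambda>z. z powr (- s) *\<^sub>R R z y)"
      unfolding int_pos_add[OF ci ci, symmetric]
      by (rule int_pos_cong(1)) (simp add: linear_add[OF bounded_linear.linear[OF bounded_linear_R]] scaleR_add_right)
    show "int_pos (\<lambda>z. z powr (- s) *\<^sub>R R z (r *\<^sub>R x)) = r *\<^sub>R int_pos (\<lambda>z. z powr (- s) *\<^sub>R R z x)"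
      unfolding int_pos_scaleR[OF ci, symmetric]
      by (rule int_pos_cong(1)) (simp add: linear_scale[OF bounded_linear.linear[OF bounded_linear_R]])
    have "norm (int_pos (\<lambda>z. z powr (- s) *\<^sub>R R z x)) \<le> (\<integral>z. ?g z * (resolvent_bound * norm x) \<partial>pos_measure)" for x
    proof (rule norm_int_pos_le[OF ci])
      show "norm (z powr (- s) *\<^sub>R R z x) \<le> ?g z * (resolvent_bound * norm x)" if "0 < z" for z
        using mult_left_mono[OF norm_R_le_div[OF that, of x], of "z powr (- s)"] by simp
    qed (intro integrable_mult_left g)
    then have "norm (int_pos (\<lambda>z. z powr (- s) *\<^sub>R R z x)) \<le> integral\<^sup>L pos_measure ?g * (resolvent_bound * norm x)" for x
      by (simp only: integral_mult_left_zero)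
    then have "norm (int_pos (\<lambda>z. z powr (- s) *\<^sub>R R z x)) \<le> norm x * (integral\<^sup>L pos_measure ?g * resolvent_bound)" for x
      by (simp only: mult_ac)
    then show "\<exists>K. \<forall>x. norm (int_pos (\<lambda>z. z powr (- s) *\<^sub>R R z x)) \<le> norm x * K" by blast
  qed
  moreover have "Bpow s = (\<lambda>x. (sin (s * pi) / pi) *\<^sub>R int_pos (\<lambda>z. z powr (- s) *\<^sub>R R z x))"
    by (rule ext) (rule bounded_frac_power_eq[OF s])
  ultimately show ?thesis
    using bounded_linear_const_scaleR by (simp only:)
qed

end

section \<open>The extension of a vector in the range of a fractional power\<close>

context bounded_semigroup
begin

text \<open>Fubini for nonnegative scalar kernels. By nonnegativity the scalar integrals of
  \<open>k\<close> control the norms themselves, and the orbit contributes only the factor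
  \<open>M * norm v\<close>.\<close>

lemma \<Phi>_swap:
  fixes k :: "real \<Rightarrow> real \<Rightarrow> real"
  assumes k: "continuous_on ({0<..} \<times> {0<..}) (\<lambda>(x, y). k x y)"
    and nn: "\<And>x y. 0 < x \<Longrightarrow> 0 < y \<Longrightarrow> 0 \<le> k x y"
    and kx: "\<And>x. 0 < x \<Longrightarrow> cont_integrable (k x)" and ky: "\<And>y. 0 < y \<Longrightarrow> cont_integrable (\<lambda>x. k x y)"
    and a: "integrable pos_measure a" "\<And>x. 0 < x \<Longrightarrow> int_pos (k x) \<le> a x"
    and c: "integrable pos_measure c" "\<And>y. 0 < y \<Longrightarrow> int_pos (\<lambda>x. k x y) \<le> c y"
    and cx: "continuous_on {0<..} (\<lambda>x. \<Phi> (k x) v)"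
    and cy: "continuous_on {0<..} (\<lambda>y. int_pos (\<lambda>x. k x y))"
  shows "int_pos (\<lambda>x. \<Phi> (k x) v) = \<Phi> (\<lambda>y. int_pos (\<lambda>x. k x y)) v"
proof -
  have inner: "int_pos (\<lambda>x. k x y *\<^sub>R T y v) = int_pos (\<lambda>x. k x y) *\<^sub>R T y v" if "0 < y" for y
    by (rule int_pos_scaleR_left(2)[OF ky[OF that]])
  have M0: "0 \<le> M * norm v" using M_ge_1 by simp
  have nx: "(\<integral>y. norm (k x y *\<^sub>R T y v) \<partial>pos_measure) \<le> a x * (M * norm v)" if x: "0 < x" for x
  proof -
    have "(\<integral>y. norm (k x y *\<^sub>R T y v) \<partial>pos_measure) \<le> (\<integral>y. k x y * (M * norm v) \<partial>pos_measure)"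
    proof (rule integral_mono)
      show "integrable pos_measure (\<lambda>y. norm (k x y *\<^sub>R T y v))"
        using cont_integrable_T[OF kx[OF x]] by (simp add: cont_integrable_def)
      show "integrable pos_measure (\<lambda>y. k x y * (M * norm v))"
        by (intro integrable_mult_left integrable_if_cont_integrable kx nn x)
      show "norm (k x y *\<^sub>R T y v) \<le> k x y * (M * norm v)" if "y \<in> space pos_measure" for y
        using that nn[OF x, of y] norm_T_apply_le[of y v] by (auto intro!: mult_left_mono)
    qed
    also have "\<dots> = int_pos (k x) * (M * norm v)"
      by (simp only: integral_mult_left_zero int_pos_real[OF kx[OF x]])
    also have "\<dots> \<le> a x * (M * norm v)"
      by (rule mult_right_mono[OF a(2)[OF x] M0])
    finally show ?thesis .
  qed
  have ny: "(\<integral>x. norm (k x y *\<^sub>R T y v) \<partial>pos_measure) \<le> c y * (M * norm v)" if y: "0 < y" for y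
  proof -
    have "(\<integral>x. norm (k x y *\<^sub>R T y v) \<partial>pos_measure) \<le> (\<integral>x. k x y * (M * norm v) \<partial>pos_measure)"
    proof (rule integral_mono)
      show "integrable pos_measure (\<lambda>x. norm (k x y *\<^sub>R T y v))"
        using int_pos_scaleR_left(1)[OF ky[OF y], of "T y v"] by (simp add: cont_integrable_def)
      show "integrable pos_measure (\<lambda>x. k x y * (M * norm v))"
        by (intro integrable_mult_left integrable_if_cont_integrable ky nn y)
      show "norm (k x y *\<^sub>R T y v) \<le> k x y * (M * norm v)" if "x \<in> space pos_measure" for x
        using that nn[OF _ y, of x] norm_T_apply_le[of y v] y by (auto intro!: mult_left_mono)
    qed
    also have "\<dots> = int_pos (\<lambda>x. k x y) * (M * norm v)"
      by (simp only: integral_mult_left_zero int_pos_real[OF ky[OF y]])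
    also have "\<dots> \<le> c y * (M * norm v)"
      by (rule mult_right_mono[OF c(2)[OF y] M0])
    finally show ?thesis .
  qed
  have "int_pos (\<lambda>x. int_pos (\<lambda>y. k x y *\<^sub>R T y v)) = int_pos (\<lambda>y. int_pos (\<lambda>x. k x y *\<^sub>R T y v))"
  proof (rule int_pos_swap[OF _ _ _ _ nx _ ny])
    have "continuous_on ({0<..} \<times> {0<..}) (\<lambda>p. (case p of (x, y) \<Rightarrow> k x y) *\<^sub>R T (snd p) v)"
      by (intro continuous_intros k continuous_on_compose2[OF continuous_on_T_pos]) auto
    then show "continuous_on ({0<..} \<times> {0<..}) (\<lambda>(x, y). k x y *\<^sub>R T y v)"
      by (simp add: case_prod_beta')
    show "integrable pos_measure (\<lambda>x. a x * (M * norm v))" "integrable pos_measure (\<lambda>y. c y * (M * norm v))"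
      by (intro integrable_mult_left a c)+
    show "continuous_on {0<..} (\<lambda>x. int_pos (\<lambda>y. k x y *\<^sub>R T y v))"
      using cx by (simp add: \<Phi>_def)
    have "continuous_on {0<..} (\<lambda>y. int_pos (\<lambda>x. k x y) *\<^sub>R T y v)"
      by (intro continuous_intros cy continuous_on_T_pos)
    then show "continuous_on {0<..} (\<lambda>y. int_pos (\<lambda>x. k x y *\<^sub>R T y v))"
      by (rule continuous_on_eq) (simp add: inner)
  qed (auto intro: cont_integrable_T kx int_pos_scaleR_left(1) ky)
  also have "\<dots> = int_pos (\<lambda>y. int_pos (\<lambda>x. k x y) *\<^sub>R T y v)"
    by (rule int_pos_cong(1)) (rule inner)
  finally show ?thesis by (simp only: \<Phi>_def)
qed

text \<open>The kernel z^(-s) exp(-(z + e) t) integrates against \<open>T t f\<close> over t to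
  z^(-s) R(z + e) f, and over z to Gamma(1 - s) t^(s-1) exp(-e t); the reflection formula then
  clears the constants. For e = 0 the scalar marginal z^(-s) / (z + e) would not be integrable at
  0.\<close>

lemma regularised_frac_power:
  assumes s: "0 < s" "s < 1" and e: "0 < e"
  shows "(sin (s * pi) / pi) *\<^sub>R int_pos (\<lambda>z. z powr (- s) *\<^sub>R R (z + e) f)
    = (1 / Gamma s) *\<^sub>R \<Phi> (\<lambda>t. t powr (s - 1) * exp (- e * t)) f"
proof -
  define k where "k z t = z powr (- s) * exp (- (z + e) * t)" for z t :: real
  have kz: "cont_integrable (k z)" "int_pos (k z) = z powr (- s) / (z + e)" "\<Phi> (k z) f = z powr (- s) *\<^sub>R R (z + e) f"
    if "0 < z" for z
  proof -
    have ze: "0 < z + e" using that e by simp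
    show "cont_integrable (k z)" "int_pos (k z) = z powr (- s) / (z + e)"
      using cont_integrable_scaleR[OF cont_integrable_exp(1)[OF ze], of "z powr (- s)"]
        int_pos_scaleR[OF cont_integrable_exp(1)[OF ze], of "z powr (- s)"] int_pos_exp[OF ze]
      by (simp_all add: k_def[abs_def])
    show "\<Phi> (k z) f = z powr (- s) *\<^sub>R R (z + e) f"
      unfolding k_def[abs_def] R_def by (rule \<Phi>_scale[OF cont_integrable_exp(1)[OF ze]])
  qed
  have knn: "0 \<le> k z t" for z t
    by (simp add: k_def)
  have k_eq: "k z t = exp (- e * t) *\<^sub>R (z powr ((1 - s) - 1) * exp (- t * z))" for z t
    by (simp add: k_def algebra_simps exp_add[symmetric])
  have kt: "cont_integrable (\<lambda>z. k z t)" "int_pos (\<lambda>z. k z t) = Gamma (1 - s) * (t powr (s - 1) * exp (- e * t))"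
    if "0 < t" for t
  proof -
    have s1: "0 < 1 - s" using s by simp
    note g = cont_integrable_Gamma[OF s1 that]
    show "cont_integrable (\<lambda>z. k z t)"
      unfolding k_eq by (rule cont_integrable_scaleR[OF g(1)])
    show "int_pos (\<lambda>z. k z t) = Gamma (1 - s) * (t powr (s - 1) * exp (- e * t))"
      unfolding k_eq int_pos_scaleR[OF g(1)] int_pos_Gamma[OF s1 that] by simp
  qed
  note G = cont_integrable_Gamma(1)[OF s(1) e]
  have "int_pos (\<lambda>z. z powr (- s) *\<^sub>R R (z + e) f) = int_pos (\<lambda>z. \<Phi> (k z) f)"
    by (rule int_pos_cong(1)) (simp add: kz)
  also have "\<dots> = \<Phi> (\<lambda>t. int_pos (\<lambda>z. k z t)) f"
  proof (rule \<Phi>_swap)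
    show "continuous_on ({0<..} \<times> {0<..}) (\<lambda>(z, t). k z t)"
      unfolding k_def case_prod_beta' by (intro continuous_intros) auto
    show "integrable pos_measure (\<lambda>z. z powr (- s) / (z + e))"
      using cont_integrable_powr_div[of "- s" e] s e
      by (intro integrable_if_cont_integrable) (auto simp: add.commute)
    show "integrable pos_measure (\<lambda>t. Gamma (1 - s) * (t powr (s - 1) * exp (- e * t)))"
      by (intro integrable_mult_right integrable_if_cont_integrable G) auto
    have "continuous_on {0<..} (\<lambda>z. z powr (- s) *\<^sub>R R (z + e) f)"
      using e by (intro continuous_intros continuous_on_compose2[OF continuous_on_R]) auto
    then show "continuous_on {0<..} (\<lambda>z. \<Phi> (k z) f)"
      by (rule continuous_on_eq) (simp add: kz)
    have "continuous_on {0<..} (\<lambda>t. Gamma (1 - s) * (t powr (s - 1) * exp (- e * t)))"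
      by (intro continuous_intros) auto
    then show "continuous_on {0<..} (\<lambda>t. int_pos (\<lambda>z. k z t))"
      by (rule continuous_on_eq) (simp add: kt)
  qed (auto simp: kz kt knn)
  also have "\<dots> = \<Phi> (\<lambda>t. Gamma (1 - s) * (t powr (s - 1) * exp (- e * t))) f"
    unfolding \<Phi>_def by (rule int_pos_cong(1)) (simp add: kt)
  also have "\<dots> = Gamma (1 - s) *\<^sub>R \<Phi> (\<lambda>t. t powr (s - 1) * exp (- e * t)) f"
    by (rule \<Phi>_scale[OF G])
  finally show ?thesis
    using Gamma_reflection_real[OF s] by simp
qed

end

section \<open>Composition of the regularised kernels\<close>

lemma exp_minus_div_le:
  fixes b t :: real assumes "0 < b" "0 < t"
  shows "exp (- b / t) / t \<le> 1 / b"
proof -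
  have "b / t \<le> exp (b / t)"
    using exp_ge_add_one_self[of "b / t"] by linarith
  then have "b \<le> t * exp (b / t)"
    using assms by (simp add: pos_divide_le_eq mult.commute)
  then have "1 / (t * exp (b / t)) \<le> 1 / b"
    using assms by (intro frac_le) auto
  moreover have "exp (- b / t) / t = 1 / (t * exp (b / t))"
    by (simp add: exp_minus divide_inverse mult.commute)
  ultimately show ?thesis by simp
qed

text \<open>The Gamma integrand with parameter p - 1 under t \<mapsto> 1 / t.\<close>

lemma cont_integrable_exp_inverse:
  fixes b p :: real assumes b: "0 < b" and p: "1 < p"
  shows "cont_integrable (\<lambda>t. exp (- b / t) * t powr (- p))"
proof -
  have "cont_integrable (\<lambda>t. t powr ((p - 1) - 1) * exp (- b * t))"
    using p b by (intro cont_integrable_Gamma) auto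
  from cont_integrable_inverse(1)[OF this zero_less_one]
  have "cont_integrable (\<lambda>t. (1 / t\<^sup>2) *\<^sub>R ((1 / t) powr ((p - 1) - 1) * exp (- b * (1 / t))))" .
  moreover have "(1 / t\<^sup>2) *\<^sub>R ((1 / t) powr ((p - 1) - 1) * exp (- b * (1 / t))) = exp (- b / t) * t powr (- p)"
    if "0 < t" for t
    using that by (simp add: powr_divide powr_diff powr_minus_divide power2_eq_square)
  ultimately show ?thesis
    by (rule cont_integrable_cong[THEN iffD1, rotated])
qed

lemma integral_norm_le:
  fixes f :: "real \<Rightarrow> 'a::banach"
  assumes f: "cont_integrable f" and g: "integrable pos_measure g"
    and le: "\<And>t. 0 < t \<Longrightarrow> norm (f t) \<le> g t"
  shows "(\<integral>t. norm (f t) \<partial>pos_measure) \<le> integral\<^sup>L pos_measure g"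
  using f g by (intro integral_mono) (auto simp: cont_integrable_def le)

context bounded_semigroup
begin

text \<open>
  The substitutions \<open>r = t w\<close> and \<open>\<rho> = t (1 + w)\<close> replace the convolution by kernels that are
  continuous on the whole quadrant, so that \<open>int_pos_swap\<close> applies twice.
\<close>

lemma regularised_extension:
  assumes s: "0 < s" "s < 1" and e: "0 < e" and b: "0 < b"
  shows "\<Phi> (\<lambda>t. exp (- b / t) * t powr (- 1 - s) * exp (- e * t)) (\<Phi> (\<lambda>t. t powr (s - 1) * exp (- e * t)) f)
    = (Gamma s * b powr (- s)) *\<^sub>R \<Phi> (\<lambda>t. exp (- b / t) * (t powr (s - 1) * exp (- e * t))) f"
proof -
  let ?gam = "\<lambda>t. t powr (s - 1) * exp (- e * t)"
  let ?ker = "\<lambda>t. exp (- b / t) * t powr (- 1 - s) * exp (- e * t)"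
  define h where "h = \<Phi> ?gam f"
  \<comment> \<open>The double integrand after r = t w. The factor t of dr and t^(s-1) from the
    inner weight reduce t^(-1-s) to 1/t.\<close>
  define F where "F t w = (exp (- b / t) / t * (w powr (s - 1) * exp (- (e * t) * (1 + w)))) *\<^sub>R T (t * (1 + w)) f" for t w
  \<comment> \<open>The weight left after the second substitution. As a function of w it is a Gamma
    integrand with rate b / r, which is where \<open>Gamma s * b powr (- s)\<close> comes
    from.\<close>
  define k where "k w r = w powr (s - 1) * (exp (- (b * (1 + w)) / r) / r * exp (- e * r))" for w r
  define K where "K = M * norm f"
  have K0: "0 \<le> K" using M_ge_1 by (simp add: K_def)
  note ce = cont_integrable_exp(1) and cG = cont_integrable_Gamma(1)
  have kF: "F t w = (1 + w) *\<^sub>R (k w ((1 + w) * t) *\<^sub>R T ((1 + w) * t) f)" if "0 < t" "0 < w" for t w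
  proof -
    have w1: "1 + w \<noteq> 0" using that by simp
    then have "- (b * (1 + w)) / ((1 + w) * t) = - b / t"
      using nonzero_mult_divide_mult_cancel_left[of "1 + w" "- b" t] by (simp add: mult.commute)
    moreover have "(1 + w) * (x / ((1 + w) * t) * y) = x / t * y" for x y :: real
      using w1 by simp
    ultimately show ?thesis
      using that by (simp add: F_def k_def mult_ac)
  qed
  \<comment> \<open>The bound exp(-c/r)/r <= 1/c with c = b (1 + w) supplies the decay in w that
    makes w^(s-1) integrable at infinity.\<close>
  have k_le: "k w r \<le> w powr (s - 1) / (b * (1 + w)) * exp (- e * r)" and k_nonneg: "0 \<le> k w r" if "0 < w" "0 < r" for w r
  proof -
    have "exp (- (b * (1 + w)) / r) / r * exp (- e * r) \<le> 1 / (b * (1 + w)) * exp (- e * r)"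
      using that b by (intro mult_right_mono exp_minus_div_le) auto
    from mult_left_mono[OF this, of "w powr (s - 1)"]
    show "k w r \<le> w powr (s - 1) / (b * (1 + w)) * exp (- e * r)" by (simp add: k_def)
    show "0 \<le> k w r" using that by (simp add: k_def)
  qed
  have k_cont: "continuous_on ({0<..} \<times> {0<..}) (\<lambda>(w, r). k w r)"
    unfolding k_def case_prod_beta' by (intro continuous_intros) auto
  have kw_cont: "continuous_on {0<..} (k w)" for w
    unfolding k_def[abs_def] by (intro continuous_intros) auto
  have kw: "cont_integrable (k w)" "int_pos (k w) \<le> (1 / (b * e)) * (w powr (s - 1) / (1 + w))" if w: "0 < w" for w
  proof -
    have i: "integrable pos_measure (\<lambda>r. w powr (s - 1) / (b * (1 + w)) * exp (- e * r))"
      by (intro integrable_mult_right integrable_if_cont_integrable ce e) auto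
    show kc: "cont_integrable (k w)"
      by (rule cont_integrable_dominated[OF kw_cont i]) (use k_le k_nonneg w in auto)
    have "int_pos (k w) \<le> norm (int_pos (k w))" by simp
    also have "\<dots> \<le> integral\<^sup>L pos_measure (\<lambda>r. w powr (s - 1) / (b * (1 + w)) * exp (- e * r))"
      by (rule norm_int_pos_le[OF kc i]) (use k_le k_nonneg w in auto)
    also have "\<dots> = w powr (s - 1) / (b * (1 + w)) * (1 / e)"
      by (simp only: integral_mult_right_zero int_pos_real[OF ce[OF e], symmetric] int_pos_exp[OF e])
    finally show "int_pos (k w) \<le> (1 / (b * e)) * (w powr (s - 1) / (1 + w))"
      by (simp add: mult_ac)
  qed
  have kr_eq: "k w r = (exp (- b / r) / r * exp (- e * r)) *\<^sub>R (w powr (s - 1) * exp (- (b / r) * w))" for w r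
    by (simp add: k_def algebra_simps exp_add[symmetric] add_divide_distrib exp_diff divide_simps)
  have kr: "cont_integrable (\<lambda>w. k w r)"
    "int_pos (\<lambda>w. k w r) = Gamma s * b powr (- s) * (exp (- b / r) * ?gam r)" if r: "0 < r" for r
  proof -
    have br: "0 < b / r" using b r by simp
    show "cont_integrable (\<lambda>w. k w r)"
      unfolding kr_eq by (rule cont_integrable_scaleR[OF cG[OF s(1) br]])
    have "int_pos (\<lambda>w. k w r) = (exp (- b / r) / r * exp (- e * r)) *\<^sub>R (Gamma s * (b / r) powr (- s))"
      unfolding kr_eq by (simp only: int_pos_scaleR[OF cG[OF s(1) br]] int_pos_Gamma[OF s(1) br])
    moreover have "(b / r) powr (- s) = b powr (- s) * (r powr (s - 1) * r)"
      using b r by (simp add: powr_divide powr_minus powr_diff divide_simps)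
    ultimately show "int_pos (\<lambda>w. k w r) = Gamma s * b powr (- s) * (exp (- b / r) * ?gam r)"
      using r by (simp add: field_simps)
  qed
  have ci_b: "cont_integrable (\<lambda>t. exp (- b / t) * ?gam t)"
  proof (rule cont_integrable_dominated[where g="?gam"])
    show "norm (exp (- b / t) * ?gam t) \<le> ?gam t" if "0 < t" for t
      using that b by (simp add: mult_left_le_one_le)
  qed (use integrable_if_cont_integrable[OF cG[OF s(1) e]] in \<open>auto intro!: continuous_intros\<close>)
  have ci_div: "integrable pos_measure (\<lambda>w. w powr (s - 1) / (1 + w))"
    using s by (intro integrable_if_cont_integrable cont_integrable_powr_div) auto
  have cont_\<Phi>k: "continuous_on {0<..} (\<lambda>w. \<Phi> (k w) f)"
    unfolding continuous_on_def
  proof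
    fix w :: real assume "w \<in> {0<..}"
    then have w: "0 < w" by simp
    \<comment> \<open>\<open>q\<close> is \<open>k\<close> without the factor w^(s-1), which is
      unbounded near 0. What remains has a majorant in r that does not depend on w.\<close>
    define q where "q w r = exp (- (b * (1 + w)) / r) / r * exp (- e * r)" for w r
    have cq: "cont_integrable (q w)" if "0 < w" for w
    proof -
      have "cont_integrable (\<lambda>r. (1 / w powr (s - 1)) *\<^sub>R k w r)"
        by (rule cont_integrable_scaleR[OF kw(1)[OF that]])
      then show "cont_integrable (q w)"
        using that by (simp add: k_def q_def[abs_def])
    qed
    have qk: "\<Phi> (k w) f = w powr (s - 1) *\<^sub>R \<Phi> (q w) f" if "0 < w" for w
      using \<Phi>_scale[OF cq[OF that], of "w powr (s - 1)" f] by (simp add: k_def[abs_def] q_def[abs_def])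
    have "((\<lambda>w. \<Phi> (q w) f) \<longlongrightarrow> \<Phi> (q w) f) (at w within {0<..})"
      unfolding \<Phi>_def
    proof (rule int_pos_tendsto_dominated)
      show "integrable pos_measure (\<lambda>r. 1 / b * exp (- e * r) * K)"
        by (intro integrable_mult_left integrable_mult_right integrable_if_cont_integrable ce e) auto
      show "\<forall>\<^sub>F v in at w within {0<..}. cont_integrable (\<lambda>r. q v r *\<^sub>R T r f)"
        by (auto simp: eventually_at_filter intro!: always_eventually cont_integrable_T cq)
      show "cont_integrable (\<lambda>r. q w r *\<^sub>R T r f)"
        by (intro cont_integrable_T cq w)
      show "((\<lambda>v. q v r *\<^sub>R T r f) \<longlongrightarrow> q w r *\<^sub>R T r f) (at w within {0<..})" if "0 < r" for r
        unfolding q_def using that by (intro tendsto_intros) auto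
      have "norm (q v r *\<^sub>R T r f) \<le> 1 / b * exp (- e * r) * K" if "0 < v" "0 < r" for v r
      proof -
        have "exp (- (b * (1 + v)) / r) / r \<le> 1 / (b * (1 + v))"
          using that b by (intro exp_minus_div_le) auto
        also have "\<dots> \<le> 1 / b"
          using that b by (simp add: divide_simps)
        finally have "q v r \<le> 1 / b * exp (- e * r)"
          unfolding q_def by (intro mult_right_mono) auto
        then have "q v r * norm (T r f) \<le> 1 / b * exp (- e * r) * K"
          using that norm_T_apply_le[of r f] b by (intro mult_mono) (auto simp: K_def)
        moreover have "0 \<le> q v r" using that by (simp add: q_def)
        ultimately show ?thesis by simp
      qed
      then show "\<forall>\<^sub>F v in at w within {0<..}. \<forall>r>0. norm (q v r *\<^sub>R T r f) \<le> 1 / b * exp (- e * r) * K"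
        by (auto simp: eventually_at_filter intro!: always_eventually)
    qed
    then have "((\<lambda>w. w powr (s - 1) *\<^sub>R \<Phi> (q w) f) \<longlongrightarrow> w powr (s - 1) *\<^sub>R \<Phi> (q w) f) (at w within {0<..})"
      using w by (intro tendsto_intros) auto
    then show "((\<lambda>w. \<Phi> (k w) f) \<longlongrightarrow> \<Phi> (k w) f) (at w within {0<..})"
      unfolding qk[OF w]
      by (rule Lim_transform_eventually) (auto simp: eventually_at_filter qk intro!: always_eventually)
  qed
  have Fw: "int_pos (\<lambda>t. F t w) = \<Phi> (k w) f" "cont_integrable (\<lambda>t. F t w)" if w: "0 < w" for w
  proof -
    have w1: "0 < 1 + w" using w by simp
    note sc = cont_integrable_scale(1)[OF cont_integrable_T[OF kw(1)[OF w]] w1, of f]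
    show "int_pos (\<lambda>t. F t w) = \<Phi> (k w) f"
      unfolding \<Phi>_def int_pos_scale[OF cont_integrable_T[OF kw(1)[OF w]] w1, of f, symmetric]
      by (rule int_pos_cong(1)) (rule kF[OF _ w])
    have "cont_integrable (\<lambda>t. F t w) \<longleftrightarrow> cont_integrable (\<lambda>t. (1 + w) *\<^sub>R (k w ((1 + w) * t) *\<^sub>R T ((1 + w) * t) f))"
      by (rule cont_integrable_cong) (rule kF[OF _ w])
    then show "cont_integrable (\<lambda>t. F t w)" using sc by simp
  qed
  have Ft: "cont_integrable (F t)" "int_pos (F t) = ?ker t *\<^sub>R T t h" if t: "0 < t" for t
  proof -
    let ?g = "\<lambda>r. ?gam r *\<^sub>R T (t + r) f"
    have eq: "F t w = ?ker t *\<^sub>R (t *\<^sub>R ?g (t * w))" if w: "0 < w" for w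
    proof -
      have "t * (1 + w) = t + t * w" by (simp add: algebra_simps)
      moreover have "exp (- b / t) / t * (w powr (s - 1) * exp (- (e * t) * (1 + w)))
        = ?ker t * (t * (?gam (t * w)))"
      proof -
        have "t powr (- 1 - s) * (t * (t * w) powr (s - 1)) = w powr (s - 1) / t"
          using t w by (simp add: powr_mult powr_diff powr_minus field_simps)
        moreover have "exp (- (e * t) * (1 + w)) = exp (- e * t) * exp (- e * (t * w))"
          by (simp add: exp_add[symmetric] algebra_simps)
        moreover have "?ker t * (t * (?gam (t * w)))
          = exp (- b / t) * (t powr (- 1 - s) * (t * (t * w) powr (s - 1))) * (exp (- e * t) * exp (- e * (t * w)))"
          by (simp only: mult_ac)
        ultimately show ?thesis by (simp only:) simp
      qed
      ultimately show ?thesis by (simp add: F_def)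
    qed
    have g: "cont_integrable ?g" "int_pos ?g = T t h"
    proof -
      have *: "?g r = T t (?gam r *\<^sub>R T r f)" if "0 < r" for r
        using t that by (simp add: T_add blinfun.scaleR_right)
      note bl = blinfun.bounded_linear_right[of "T t"]
      have "cont_integrable ?g \<longleftrightarrow> cont_integrable (\<lambda>r. T t (?gam r *\<^sub>R T r f))"
        by (rule cont_integrable_cong) (rule *)
      then show "cont_integrable ?g"
        using cont_integrable_bounded_linear(1)[OF cont_integrable_T[OF cG[OF s(1) e]] bl] by blast
      have "int_pos ?g = int_pos (\<lambda>r. T t (?gam r *\<^sub>R T r f))"
        by (rule int_pos_cong(1)) (rule *)
      then show "int_pos ?g = T t h"
        unfolding h_def \<Phi>_def using int_pos_bounded_linear[OF cont_integrable_T[OF cG[OF s(1) e]] bl] by simp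
    qed
    note sc = cont_integrable_scale(1)[OF g(1) t]
    have "cont_integrable (F t) \<longleftrightarrow> cont_integrable (\<lambda>w. ?ker t *\<^sub>R (t *\<^sub>R ?g (t * w)))"
      by (rule cont_integrable_cong) (rule eq)
    then show "cont_integrable (F t)" using cont_integrable_scaleR[OF sc] by blast
    have "int_pos (F t) = int_pos (\<lambda>w. ?ker t *\<^sub>R (t *\<^sub>R ?g (t * w)))"
      by (rule int_pos_cong(1)) (rule eq)
    also have "\<dots> = ?ker t *\<^sub>R T t h"
      by (simp only: int_pos_scaleR[OF sc] int_pos_scale[OF g(1) t] g(2))
    finally show "int_pos (F t) = ?ker t *\<^sub>R T t h" .
  qed
  have normF: "norm (F t w) \<le> exp (- b / t) / t * (w powr (s - 1) * exp (- (e * t) * (1 + w))) * K" if "0 < t" "0 < w" for t w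
  proof -
    have c: "0 \<le> exp (- b / t) / t * (w powr (s - 1) * exp (- (e * t) * (1 + w)))"
      using that by simp
    show ?thesis
      using that by (simp only: F_def norm_scaleR real_norm_def abs_of_nonneg[OF c] K_def)
        (intro mult_left_mono[OF norm_T_apply_le c], simp)
  qed
  have ci_k: "cont_integrable ?ker"
  proof (rule cont_integrable_dominated)
    have "cont_integrable (\<lambda>t. exp (- b / t) * t powr (- 1 - s))"
      using cont_integrable_exp_inverse[OF b, of "1 + s"] s by simp
    then show "integrable pos_measure (\<lambda>t. exp (- b / t) * t powr (- 1 - s))"
      by (rule integrable_if_cont_integrable) simp
    show "norm (?ker t) \<le> exp (- b / t) * t powr (- 1 - s)" if "0 < t" for t
      using that e by (simp add: mult_right_le_one_le)
  qed (auto intro!: continuous_intros)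
  have "\<Phi> ?ker h = int_pos (\<lambda>t. int_pos (F t))"
    unfolding \<Phi>_def by (rule int_pos_cong(1)) (simp only: Ft)
  also have "\<dots> = int_pos (\<lambda>w. int_pos (\<lambda>t. F t w))"
  proof (rule int_pos_swap)
    show "continuous_on ({0<..} \<times> {0<..}) (\<lambda>(t, w). F t w)"
      unfolding F_def case_prod_beta'
      by (intro continuous_intros continuous_on_compose2[OF continuous_on_T_pos]) (auto intro: mult_pos_pos add_pos_pos)
    \<comment> \<open>Integrating the norm over w leaves (e t)^(-s) / t, which restores the power
      t^(-1-s) of the outer kernel.\<close>
    show "integrable pos_measure (\<lambda>t. Gamma s * e powr (- s) * K * ?ker t)"
      by (intro integrable_mult_right integrable_if_cont_integrable ci_k) auto
    show "integrable pos_measure (\<lambda>w. K / (b * e) * (w powr (s - 1) / (1 + w)))"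
      by (intro integrable_mult_right ci_div)
    show "(\<integral>w. norm (F t w) \<partial>pos_measure) \<le> Gamma s * e powr (- s) * K * ?ker t"
      if t: "0 < t" for t
    proof -
      have et: "0 < e * t" using e t by simp
      let ?c = "exp (- b / t) / t * exp (- e * t) * K"
      have "(\<integral>w. norm (F t w) \<partial>pos_measure) \<le> (\<integral>w. ?c * (w powr (s - 1) * exp (- (e * t) * w)) \<partial>pos_measure)"
      proof (rule integral_norm_le[OF Ft(1)[OF t]])
        show "integrable pos_measure (\<lambda>w. ?c * (w powr (s - 1) * exp (- (e * t) * w)))"
          by (intro integrable_mult_right integrable_if_cont_integrable cG[OF s(1) et]) auto
        show "norm (F t w) \<le> ?c * (w powr (s - 1) * exp (- (e * t) * w))" if "0 < w" for w
        proof -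
          have "exp (- (e * t) * (1 + w)) = exp (- e * t) * exp (- (e * t) * w)"
            by (simp add: exp_add[symmetric] algebra_simps)
          then show ?thesis using normF[OF t that] by (simp add: mult_ac)
        qed
      qed
      also have "\<dots> = ?c * (Gamma s * (e * t) powr (- s))"
        by (simp only: integral_mult_right_zero int_pos_real[OF cG[OF s(1) et], symmetric] int_pos_Gamma[OF s(1) et])
      also have "\<dots> = Gamma s * e powr (- s) * K * ?ker t"
        using e t by (simp add: powr_mult powr_diff powr_minus field_simps)
      finally show ?thesis .
    qed
    show "(\<integral>t. norm (F t w) \<partial>pos_measure) \<le> K / (b * e) * (w powr (s - 1) / (1 + w))" if w: "0 < w" for w
    proof -
      have ew: "0 < e * (1 + w)" using e w by simp
      let ?c = "1 / b * w powr (s - 1) * K"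
      have "(\<integral>t. norm (F t w) \<partial>pos_measure) \<le> (\<integral>t. ?c * exp (- (e * (1 + w)) * t) \<partial>pos_measure)"
      proof (rule integral_norm_le[OF Fw(2)[OF w]])
        show "integrable pos_measure (\<lambda>t. ?c * exp (- (e * (1 + w)) * t))"
          by (intro integrable_mult_right integrable_if_cont_integrable ce[OF ew]) auto
        show "norm (F t w) \<le> ?c * exp (- (e * (1 + w)) * t)" if t: "0 < t" for t
        proof -
          have "exp (- b / t) / t * (w powr (s - 1) * exp (- (e * t) * (1 + w))) * K
            \<le> 1 / b * (w powr (s - 1) * exp (- (e * t) * (1 + w))) * K"
            using exp_minus_div_le[OF b t] K0 by (intro mult_right_mono) auto
          then show ?thesis using normF[OF t w] by (simp add: mult_ac)
        qed
      qed
      also have "\<dots> = ?c * (1 / (e * (1 + w)))"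
        by (simp only: integral_mult_right_zero int_pos_real[OF ce[OF ew], symmetric] int_pos_exp[OF ew])
      also have "\<dots> = K / (b * e) * (w powr (s - 1) / (1 + w))"
        by (simp add: mult_ac)
      finally show ?thesis .
    qed
    have "continuous_on {0<..} (\<lambda>t. ?ker t *\<^sub>R T t h)"
      by (intro continuous_intros continuous_on_T_pos) auto
    then show "continuous_on {0<..} (\<lambda>t. int_pos (F t))"
      by (rule continuous_on_eq) (simp add: Ft)
    show "continuous_on {0<..} (\<lambda>w. int_pos (\<lambda>t. F t w))"
      by (rule continuous_on_eq[OF cont_\<Phi>k]) (simp add: Fw)
  qed (simp_all add: Ft Fw)
  also have "\<dots> = int_pos (\<lambda>w. \<Phi> (k w) f)"
    by (rule int_pos_cong(1)) (rule Fw)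
  also have "\<dots> = \<Phi> (\<lambda>r. int_pos (\<lambda>w. k w r)) f"
  proof (rule \<Phi>_swap[OF k_cont])
    show "integrable pos_measure (\<lambda>w. (1 / (b * e)) * (w powr (s - 1) / (1 + w)))"
      by (intro integrable_mult_right ci_div)
    show "integrable pos_measure (\<lambda>r. Gamma s * b powr (- s) * (exp (- b / r) * ?gam r))"
      by (intro integrable_mult_right integrable_if_cont_integrable ci_b) auto
    have "continuous_on {0<..} (\<lambda>r. Gamma s * b powr (- s) * (exp (- b / r) * ?gam r))"
      by (intro continuous_intros) auto
    then show "continuous_on {0<..} (\<lambda>r. int_pos (\<lambda>w. k w r))"
      by (rule continuous_on_eq) (simp add: kr)
    show "int_pos (k w) \<le> (1 / (b * e)) * (w powr (s - 1) / (1 + w))" if "0 < w" for w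
      by (rule kw(2)[OF that])
  qed (auto simp: kr k_nonneg intro: kw(1) cont_\<Phi>k)
  also have "\<dots> = \<Phi> (\<lambda>r. Gamma s * b powr (- s) * (exp (- b / r) * ?gam r)) f"
    unfolding \<Phi>_def by (rule int_pos_cong(1)) (simp add: kr)
  also have "\<dots> = (Gamma s * b powr (- s)) *\<^sub>R \<Phi> (\<lambda>t. exp (- b / t) * ?gam t) f"
    by (rule \<Phi>_scale[OF ci_b])
  finally show ?thesis by (simp only: h_def)
qed

end

section \<open>Removal of the regularisation\<close>

lemma eventually_at_right_0I:
  "(\<And>e::real. 0 < e \<Longrightarrow> P e) \<Longrightarrow> \<forall>\<^sub>F e in at_right 0. P e"
  by (auto simp: eventually_at_filter)

text \<open>Near 0 the weight is at most t^(s-1) in size. For large t the factor exp(-b/t) - 1 is at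
  most b/t in size and improves t^(s-1) to the integrable t^(s-2).\<close>

lemma cont_integrable_exp_inverse_diff:
  fixes b s :: real
  assumes b: "0 < b" and s: "0 < s" "s < 1"
  shows "cont_integrable (\<lambda>t. (exp (- b / t) - 1) * t powr (s - 1))"
proof (rule cont_integrable_powr_bound[where p="s - 1" and q="s - 2" and C=1 and C'=b])
  have a: "\<bar>exp (- b / t) - 1\<bar> = 1 - exp (- b / t)" if "0 < t" for t
    using that b by simp
  show "norm ((exp (- b / t) - 1) * t powr (s - 1)) \<le> 1 * t powr (s - 1)" if "0 < t" for t
    using a[OF that] that b by (simp add: abs_mult mult_left_le_one_le)
  show "norm ((exp (- b / t) - 1) * t powr (s - 1)) \<le> b * t powr (s - 2)" if "1 \<le> t" for t
  proof -
    have t: "0 < t" using that by simp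
    have "\<bar>exp (- b / t) - 1\<bar> \<le> b / t"
      using a[OF t] exp_ge_add_one_self[of "- b / t"] by simp
    then have "\<bar>exp (- b / t) - 1\<bar> * t powr (s - 1) \<le> b / t * t powr (s - 1)"
      by (rule mult_right_mono) simp
    also have "\<dots> = b * t powr (s - 2)"
      using t by (simp add: powr_diff power2_eq_square)
    finally show ?thesis by (simp add: abs_mult)
  qed
qed (use s in \<open>auto intro!: continuous_intros\<close>)

text \<open>The value is Gamma(-s), reached by one integration by parts: the function (1 - exp(-r))
  r^(-s) / s vanishes at both ends, and its derivative pairs this integrand with that of Gamma(1 -
  s).\<close>

lemma int_pos_exp_minus_one:
  assumes s: "0 < s" "s < 1"
  shows "cont_integrable (\<lambda>r. (exp (- r) - 1) / r powr (1 + s))"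
    and "int_pos (\<lambda>r. (exp (- r) - 1) / r powr (1 + s)) = - Gamma (1 - s) / s"
proof -
  have a: "\<bar>exp (- r) - 1\<bar> = 1 - exp (- r)" if "0 < r" for r :: real
    using that by simp
  show ci: "cont_integrable (\<lambda>r. (exp (- r) - 1) / r powr (1 + s))"
  proof (rule cont_integrable_powr_bound[where p="- s" and q="- 1 - s" and C=1 and C'=1])
    show "norm ((exp (- r) - 1) / r powr (1 + s)) \<le> 1 * r powr (- s)" if "0 < r" for r
    proof -
      have "\<bar>exp (- r) - 1\<bar> \<le> r" using a[OF that] exp_ge_add_one_self[of "- r"] by simp
      then have "\<bar>exp (- r) - 1\<bar> / r powr (1 + s) \<le> r / r powr (1 + s)"
        by (rule divide_right_mono) simp
      also have "\<dots> = r powr (- s)"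
        using that by (simp add: powr_add powr_minus_divide)
      finally show ?thesis by simp
    qed
    show "norm ((exp (- r) - 1) / r powr (1 + s)) \<le> 1 * r powr (- 1 - s)" if "1 \<le> r" for r
    proof -
      have "\<bar>exp (- r) - 1\<bar> / r powr (1 + s) \<le> 1 / r powr (1 + s)"
        using a[of r] that by (intro divide_right_mono) auto
      also have "\<dots> = r powr (- 1 - s)"
        using that powr_minus_divide[of r "1 + s"] by simp
      finally show ?thesis by simp
    qed
  qed (use s in \<open>auto intro!: continuous_intros\<close>)
  let ?g = "\<lambda>r. r powr ((1 - s) - 1) * exp (- 1 * r)"
  have g: "cont_integrable ?g" "int_pos ?g = Gamma (1 - s)"
    using cont_integrable_Gamma[of "1 - s" 1] s by auto
  have "int_pos (\<lambda>r. (1 / s) *\<^sub>R ?g r + (exp (- r) - 1) / r powr (1 + s)) = 0 - 0"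
  proof (rule int_pos_FTC)
    show "cont_integrable (\<lambda>r. (1 / s) *\<^sub>R ?g r + (exp (- r) - 1) / r powr (1 + s))"
      by (intro cont_integrable_add(1) cont_integrable_scaleR g ci)
    show "((\<lambda>r. (1 - exp (- r)) * r powr (- s) / s) has_vector_derivative (1 / s) *\<^sub>R ?g r + (exp (- r) - 1) / r powr (1 + s)) (at r)"
      if "0 < r" for r
    proof -
      have "((\<lambda>r. (1 - exp (- r)) * r powr (- s) / s) has_real_derivative
          (exp (- r) * r powr (- s) + (1 - exp (- r)) * (- s * r powr (- s - 1))) / s) (at r)"
      proof (rule DERIV_cdivide)
        show "((\<lambda>r. (1 - exp (- r)) * r powr (- s)) has_real_derivative
            exp (- r) * r powr (- s) + (1 - exp (- r)) * (- s * r powr (- s - 1))) (at r)"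
          using that by (auto intro!: derivative_eq_intros simp: algebra_simps)
      qed
      moreover have "(exp (- r) * r powr (- s) + (1 - exp (- r)) * (- s * r powr (- s - 1))) / s
          = (1 / s) *\<^sub>R ?g r + (exp (- r) - 1) / r powr (1 + s)"
      proof -
        have "r powr (- s - 1) = 1 / r powr (1 + s)"
        proof -
          have "- s - 1 = - (1 + s)" by simp
          then show ?thesis by (simp only: powr_minus_divide)
        qed
        then have "(exp (- r) - 1) / r powr (1 + s) = (exp (- r) - 1) * r powr (- s - 1)"
          by simp
        then show ?thesis using s by (simp only:) (simp add: field_simps)
      qed
      ultimately show ?thesis by (simp add: has_real_derivative_iff_has_vector_derivative)
    qed
    show "((\<lambda>r. (1 - exp (- r)) * r powr (- s) / s) \<longlongrightarrow> 0) (at_right 0)"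
      using s by real_asymp
    show "((\<lambda>r. (1 - exp (- r)) * r powr (- s) / s) \<longlongrightarrow> 0) at_top"
      using s by real_asymp
  qed
  moreover have "int_pos (\<lambda>r. (1 / s) *\<^sub>R ?g r + (exp (- r) - 1) / r powr (1 + s))
     = (1 / s) *\<^sub>R Gamma (1 - s) + int_pos (\<lambda>r. (exp (- r) - 1) / r powr (1 + s))"
    by (simp only: int_pos_add[OF cont_integrable_scaleR[OF g(1)] ci] int_pos_scaleR[OF g(1)] g(2))
  ultimately show "int_pos (\<lambda>r. (exp (- r) - 1) / r powr (1 + s)) = - Gamma (1 - s) / s" by simp
qed

context bounded_semigroup
begin

lemma cont_integrable_mult_exp:
  fixes a :: "real \<Rightarrow> real"
  assumes a: "cont_integrable a" and e: "0 < e"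
  shows "cont_integrable (\<lambda>t. a t * exp (- e * t))"
    and "0 < t \<Longrightarrow> \<bar>a t * exp (- e * t)\<bar> \<le> \<bar>a t\<bar>"
proof -
  show *: "\<bar>a t * exp (- e * t)\<bar> \<le> \<bar>a t\<bar>" if "0 < t" for t
    using that e by (simp add: abs_mult mult_right_le_one_le)
  show "cont_integrable (\<lambda>t. a t * exp (- e * t))"
    using a * unfolding cont_integrable_def
    by (intro cont_integrable_dominated[where g="\<lambda>t. \<bar>a t\<bar>", unfolded cont_integrable_def]) (auto intro!: continuous_intros)
qed

lemma \<Phi>_exp_tendsto:
  fixes a :: "real \<Rightarrow> real"
  assumes a: "cont_integrable a"
  shows "((\<lambda>e. \<Phi> (\<lambda>t. a t * exp (- e * t)) x) \<longlongrightarrow> \<Phi> a x) (at_right 0)"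
  unfolding \<Phi>_def
proof (rule int_pos_tendsto_dominated)
  show "integrable pos_measure (\<lambda>t. \<bar>a t\<bar> * (M * norm x))"
    using a by (intro integrable_mult_left) (simp add: cont_integrable_def)
  show "\<forall>\<^sub>F e in at_right 0. cont_integrable (\<lambda>t. (a t * exp (- e * t)) *\<^sub>R T t x)"
    by (intro eventually_at_right_0I cont_integrable_T cont_integrable_mult_exp a)
  have "norm ((a t * exp (- e * t)) *\<^sub>R T t x) \<le> \<bar>a t\<bar> * (M * norm x)" if "0 < e" "0 < t" for e t
    unfolding norm_scaleR
    using that norm_T_apply_le[of t x] by (intro mult_mono cont_integrable_mult_exp[OF a]) auto
  then show "\<forall>\<^sub>F e in at_right 0. \<forall>t>0. norm ((a t * exp (- e * t)) *\<^sub>R T t x) \<le> \<bar>a t\<bar> * (M * norm x)"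
    by (intro eventually_at_right_0I) auto
  show "((\<lambda>e. (a t * exp (- e * t)) *\<^sub>R T t x) \<longlongrightarrow> a t *\<^sub>R T t x) (at_right 0)" for t
  proof -
    have "((\<lambda>e. (a t * exp (- e * t)) *\<^sub>R T t x) \<longlongrightarrow> (a t * exp (- 0 * t)) *\<^sub>R T t x) (at_right 0)"
      by (intro tendsto_intros)
    then show ?thesis by simp
  qed
qed (rule cont_integrable_T[OF a])

text \<open>By \<open>norm_R_le_div\<close> the shifted integrands have a common majorant
  proportional to z^(-s) / (1 + z). This gives the limit of the regularised powers even where the
  integral of t^(s-1) T(t) f does not converge absolutely.\<close>

lemma frac_power_tendsto:
  assumes s: "0 < s" "s < 1"
  shows "((\<lambda>e. (sin (s * pi) / pi) *\<^sub>R int_pos (\<lambda>z. z powr (- s) *\<^sub>R R (z + e) f)) \<longlongrightarrow> Bpow s f) (at_right 0)"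
  unfolding bounded_frac_power_eq[OF s]
proof (intro tendsto_scaleR tendsto_const, rule int_pos_tendsto_dominated)
  have g: "integrable pos_measure (\<lambda>z. (z powr (- s) / (1 + z)) * (resolvent_bound * norm f))"
    using s by (intro integrable_mult_left integrable_if_cont_integrable cont_integrable_powr_div) auto
  then show "integrable pos_measure (\<lambda>z. (z powr (- s) / (1 + z)) * (resolvent_bound * norm f))" .
  have n: "norm (z powr (- s) *\<^sub>R R (z + e) f) \<le> (z powr (- s) / (1 + z)) * (resolvent_bound * norm f)" if "0 < e" "0 < z" for e z
  proof -
    have "norm (R (z + e) f) \<le> resolvent_bound / (1 + (z + e)) * norm f"
      using that by (intro norm_R_le_div) simp
    also have "\<dots> \<le> resolvent_bound / (1 + z) * norm f"
      using that resolvent_bound_nonneg by (intro mult_right_mono divide_left_mono) auto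
    finally have "z powr (- s) * norm (R (z + e) f) \<le> z powr (- s) * (resolvent_bound / (1 + z) * norm f)"
      by (rule mult_left_mono) simp
    then show ?thesis by simp
  qed
  then show "\<forall>\<^sub>F e in at_right 0. \<forall>z>0. norm (z powr (- s) *\<^sub>R R (z + e) f) \<le> (z powr (- s) / (1 + z)) * (resolvent_bound * norm f)"
    by (intro eventually_at_right_0I) auto
  have "cont_integrable (\<lambda>z. z powr (- s) *\<^sub>R R (z + e) f)" if "0 < e" for e
    using that by (intro cont_integrable_dominated[OF _ g n] continuous_intros continuous_on_compose2[OF continuous_on_R]) auto
  then show "\<forall>\<^sub>F e in at_right 0. cont_integrable (\<lambda>z. z powr (- s) *\<^sub>R R (z + e) f)"
    by (intro eventually_at_right_0I) auto
  show "((\<lambda>e. z powr (- s) *\<^sub>R R (z + e) f) \<longlongrightarrow> z powr (- s) *\<^sub>R R z f) (at_right 0)" if z: "0 < z" for z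
  proof (intro tendsto_scaleR tendsto_const)
    have "isCont (\<lambda>z. R z f) z"
      using continuous_on_interior[OF continuous_on_R] z by (simp add: interior_open)
    moreover have "((\<lambda>e. z + e) \<longlongrightarrow> z + 0) (at_right 0)"
      by (intro tendsto_intros)
    ultimately show "((\<lambda>e. R (z + e) f) \<longlongrightarrow> R z f) (at_right 0)"
      using isCont_tendsto_compose[of z "\<lambda>z. R z f"] by simp
  qed
qed (rule cont_integrable_powr_R[OF s])

text \<open>In \<open>regularised_extension\<close> the weight exp(-b/t) t^(s-1) splits into
  (exp(-b/t) - 1) t^(s-1) and t^(s-1). The second part reproduces Gamma(s) times \<open>v e\<close>,
  whose limit is known from the resolvent formula, so only the first needs an integrable weight.
  With b = y^2/4 this is the first identity of (a).\<close>

lemma extension_frac_power: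
  fixes f :: 'a
  assumes s: "0 < s" "s < 1" and b: "0 < b"
  defines "u \<equiv> Bpow s f"
  shows "(b powr s / Gamma s) *\<^sub>R \<Phi> (\<lambda>t. exp (- b / t) * t powr (- 1 - s)) u
    = u + (1 / Gamma s) *\<^sub>R \<Phi> (\<lambda>t. (exp (- b / t) - 1) * t powr (s - 1)) f"
proof -
  define \<kappa> where "\<kappa> t = exp (- b / t) * t powr (- 1 - s)" for t
  define d where "d t = (exp (- b / t) - 1) * t powr (s - 1)" for t
  define v where "v e = (1 / Gamma s) *\<^sub>R \<Phi> (\<lambda>t. t powr (s - 1) * exp (- e * t)) f" for e
  let ?K = "\<lambda>e. \<Phi> (\<lambda>t. \<kappa> t * exp (- e * t))" and ?N = "\<lambda>e. \<Phi> (\<lambda>t. d t * exp (- e * t)) f"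
  have G: "0 < Gamma s" using s by simp
  have ck: "cont_integrable \<kappa>"
    using cont_integrable_exp_inverse[OF b, of "1 + s"] s by (simp add: \<kappa>_def[abs_def])
  have cd: "cont_integrable d"
    unfolding d_def[abs_def] by (rule cont_integrable_exp_inverse_diff[OF b s])
  have v: "(v \<longlongrightarrow> u) (at_right 0)"
  proof (rule Lim_transform_eventually[OF frac_power_tendsto[OF s, of f, folded u_def]])
    show "\<forall>\<^sub>F e in at_right 0. (sin (s * pi) / pi) *\<^sub>R int_pos (\<lambda>z. z powr (- s) *\<^sub>R R (z + e) f) = v e"
      unfolding v_def by (intro eventually_at_right_0I regularised_frac_power s)
  qed
  have eq: "?K e (v e) = b powr (- s) *\<^sub>R (?N e + Gamma s *\<^sub>R v e)" if e: "0 < e" for e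
  proof -
    interpret k: bounded_linear "?K e"
      by (intro bounded_linear_\<Phi> cont_integrable_mult_exp ck e)
    note cG = cont_integrable_Gamma(1)[OF s(1) e]
    have 1: "Gamma s *\<^sub>R ?K e (v e) = (Gamma s * b powr (- s)) *\<^sub>R \<Phi> (\<lambda>t. exp (- b / t) * (t powr (s - 1) * exp (- e * t))) f"
    proof -
      have "Gamma s *\<^sub>R ?K e (v e) = ?K e (Gamma s *\<^sub>R v e)"
        by (rule k.scaleR[symmetric])
      also have "Gamma s *\<^sub>R v e = \<Phi> (\<lambda>t. t powr (s - 1) * exp (- e * t)) f"
        using G by (simp add: v_def)
      also have "?K e \<dots> = (Gamma s * b powr (- s)) *\<^sub>R \<Phi> (\<lambda>t. exp (- b / t) * (t powr (s - 1) * exp (- e * t))) f"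
        unfolding \<kappa>_def by (rule regularised_extension[OF s e b])
      finally show ?thesis .
    qed
    have 2: "\<Phi> (\<lambda>t. exp (- b / t) * (t powr (s - 1) * exp (- e * t))) f
      = \<Phi> (\<lambda>t. d t * exp (- e * t) + t powr (s - 1) * exp (- e * t)) f"
      by (simp add: d_def algebra_simps)
    have 3: "\<dots> = ?N e + Gamma s *\<^sub>R v e"
      using G by (subst \<Phi>_add[OF cont_integrable_mult_exp(1)[OF cd e] cG]) (simp add: v_def)
    show ?thesis
      using 1 G unfolding 2 3 scaleR_scaleR[symmetric] by (simp only: scaleR_cancel_left) simp
  qed
  have "((\<lambda>e. ?K e (v e)) \<longlongrightarrow> b powr (- s) *\<^sub>R (\<Phi> d f + Gamma s *\<^sub>R u)) (at_right 0)"
  proof (rule Lim_transform_eventually)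
    show "((\<lambda>e. b powr (- s) *\<^sub>R (?N e + Gamma s *\<^sub>R v e)) \<longlongrightarrow> b powr (- s) *\<^sub>R (\<Phi> d f + Gamma s *\<^sub>R u)) (at_right 0)"
      by (intro tendsto_intros \<Phi>_exp_tendsto cd v)
    show "\<forall>\<^sub>F e in at_right 0. b powr (- s) *\<^sub>R (?N e + Gamma s *\<^sub>R v e) = ?K e (v e)"
      using eq by (intro eventually_at_right_0I) auto
  qed
  moreover have "((\<lambda>e. ?K e (v e)) \<longlongrightarrow> \<Phi> \<kappa> u) (at_right 0)"
  proof -
    \<comment> \<open>Kernel and vector both depend on \<open>e\<close>. The operators
      \<open>?K e\<close> are bounded uniformly in \<open>e\<close>, which disposes of
      \<open>v e - u\<close>; on the fixed vector \<open>u\<close> dominated convergence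
      applies.\<close>
    have "((\<lambda>e. ?K e (v e - u)) \<longlongrightarrow> 0) (at_right 0)"
    proof (rule Lim_null_comparison)
      have "((\<lambda>e. integral\<^sup>L pos_measure (\<lambda>t. \<bar>\<kappa> t\<bar>) * (M * norm (v e - u))) \<longlongrightarrow> integral\<^sup>L pos_measure (\<lambda>t. \<bar>\<kappa> t\<bar>) * (M * norm (u - u))) (at_right 0)"
        by (intro tendsto_intros v)
      then show "((\<lambda>e. integral\<^sup>L pos_measure (\<lambda>t. \<bar>\<kappa> t\<bar>) * (M * norm (v e - u))) \<longlongrightarrow> 0) (at_right 0)" by simp
      have "norm (?K e (v e - u)) \<le> integral\<^sup>L pos_measure (\<lambda>t. \<bar>\<kappa> t\<bar>) * (M * norm (v e - u))" if "0 < e" for e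
        using ck that by (intro norm_\<Phi>_le cont_integrable_mult_exp) (auto simp: cont_integrable_def)
      then show "\<forall>\<^sub>F e in at_right 0. norm (?K e (v e - u)) \<le> integral\<^sup>L pos_measure (\<lambda>t. \<bar>\<kappa> t\<bar>) * (M * norm (v e - u))"
        by (intro eventually_at_right_0I) auto
    qed
    from tendsto_add[OF this \<Phi>_exp_tendsto[OF ck, of u]]
    have "((\<lambda>e. ?K e (v e - u) + ?K e u) \<longlongrightarrow> \<Phi> \<kappa> u) (at_right 0)"
      by simp
    then show ?thesis
    proof (rule Lim_transform_eventually)
      have "?K e (v e - u) + ?K e u = ?K e (v e)" if e: "0 < e" for e
      proof -
        interpret k: bounded_linear "?K e"
          by (intro bounded_linear_\<Phi> cont_integrable_mult_exp ck e)
        show ?thesis by (simp only: k.diff diff_add_cancel)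
      qed
      then show "\<forall>\<^sub>F e in at_right 0. ?K e (v e - u) + ?K e u = ?K e (v e)"
        by (intro eventually_at_right_0I) auto
    qed
  qed
  ultimately have "\<Phi> \<kappa> u = b powr (- s) *\<^sub>R (\<Phi> d f + Gamma s *\<^sub>R u)"
    using tendsto_unique[OF trivial_limit_at_right_real] by blast
  moreover have "b powr s * b powr (- s) = 1" using b by (simp add: powr_minus)
  ultimately show ?thesis
    using G by (simp add: \<kappa>_def[abs_def] d_def[abs_def] scaleR_add_right)
qed

lemma \<Phi>_inverse:
  assumes a: "cont_integrable a" and b: "0 < b"
  shows "cont_integrable (\<lambda>r. (b / r\<^sup>2 * a (b / r)) *\<^sub>R T (b / r) x)"
    and "int_pos (\<lambda>r. (b / r\<^sup>2 * a (b / r)) *\<^sub>R T (b / r) x) = \<Phi> a x"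
  using cont_integrable_inverse(1)[OF cont_integrable_T[OF a] b] int_pos_inverse[OF cont_integrable_T[OF a] b]
  by (simp_all add: \<Phi>_def)

lemma cont_integrable_T_inverse:
  fixes w :: "real \<Rightarrow> real"
  assumes w: "cont_integrable w" and b: "0 < b"
  shows "cont_integrable (\<lambda>r. w r *\<^sub>R T (b / r) x)"
    and "0 < r \<Longrightarrow> norm (w r *\<^sub>R T (b / r) x) \<le> \<bar>w r\<bar> * (M * norm x)"
proof -
  show n: "norm (w r *\<^sub>R T (b / r) x) \<le> \<bar>w r\<bar> * (M * norm x)" if "0 < r" for r
    using that b norm_T_apply_le[of "b / r" x] by (auto intro!: mult_left_mono)
  have "continuous_on {0<..} w" using w by (simp add: cont_integrable_def)
  moreover have "integrable pos_measure (\<lambda>r. \<bar>w r\<bar> * (M * norm x))"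
    using w by (intro integrable_mult_left) (simp add: cont_integrable_def)
  ultimately show "cont_integrable (\<lambda>r. w r *\<^sub>R T (b / r) x)"
    using b by (intro cont_integrable_dominated[OF _ _ n] continuous_intros continuous_on_compose2[OF continuous_on_T_pos]) auto
qed

text \<open>After the substitution the parameter sits only in T(b/r), which tends strongly to the
  identity. The quotient and the weighted derivative in (b) differ only in the weight
  \<open>w\<close>.\<close>

lemma int_pos_T_inverse_tendsto:
  fixes w :: "real \<Rightarrow> real"
  assumes w: "cont_integrable w"
  shows "((\<lambda>b. int_pos (\<lambda>r. w r *\<^sub>R T (b / r) x)) \<longlongrightarrow> int_pos w *\<^sub>R x) (at_right 0)"
  unfolding int_pos_scaleR_left(2)[OF w, symmetric]
proof (rule int_pos_tendsto_dominated)
  show "integrable pos_measure (\<lambda>r. \<bar>w r\<bar> * (M * norm x))"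
    using w by (intro integrable_mult_left) (simp add: cont_integrable_def)
  show "\<forall>\<^sub>F b in at_right 0. \<forall>r>0. norm (w r *\<^sub>R T (b / r) x) \<le> \<bar>w r\<bar> * (M * norm x)"
    by (intro eventually_at_right_0I allI impI cont_integrable_T_inverse(2)[OF w])
  show "\<forall>\<^sub>F b in at_right 0. cont_integrable (\<lambda>r. w r *\<^sub>R T (b / r) x)"
    by (intro eventually_at_right_0I cont_integrable_T_inverse(1)[OF w])
  show "((\<lambda>b. w r *\<^sub>R T (b / r) x) \<longlongrightarrow> w r *\<^sub>R x) (at_right 0)" if r: "0 < r" for r
  proof (intro tendsto_scaleR tendsto_const, rule filterlim_compose[OF T_at_right])
    show "filterlim (\<lambda>b. b / r) (at_right 0) (at_right 0)"
      using r by real_asymp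
  qed
qed (rule int_pos_scaleR_left(1)[OF w])

end

section \<open>The differential equation and the limits at zero\<close>

context bounded_semigroup
begin

text \<open>Up to the factor y^(2s) / (4^s Gamma(s)), the extension is the case p = 1 + s. The
  derivative in y and the operator L raise p by one or two (\<open>J_has_vector_derivative\<close>,
  \<open>L_J\<close>), so the differential equation reduces to algebra within this family.\<close>

definition J :: "real \<Rightarrow> real \<Rightarrow> 'a \<Rightarrow> 'a" where
  "J p y x = \<Phi> (\<lambda>t. exp (- (y\<^sup>2 / 4) / t) * t powr (- p)) x"

lemma cont_integrable_J:
  fixes p y :: real
  shows "1 < p \<Longrightarrow> 0 < y \<Longrightarrow> cont_integrable (\<lambda>t. exp (- (y\<^sup>2 / 4) / t) * t powr (- p))"
  by (intro cont_integrable_exp_inverse) auto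

lemma exp_square_mono:
  fixes y z t :: real
  assumes "0 < y" "y / 2 < z" "0 < t"
  shows "exp (- (z\<^sup>2 / 4) / t) \<le> exp (- ((y / 2)\<^sup>2 / 4) / t)"
proof -
  have "(y / 2)\<^sup>2 \<le> z\<^sup>2" using assms by (intro power_mono) auto
  then show ?thesis using assms by (simp add: divide_right_mono)
qed

text \<open>Stated for general weights because it serves both the kernels of \<open>J\<close> and,
  in \<open>ext_flux_tendsto\<close>, the difference kernel of (a). Near y the derivatives are
  dominated through the kernel at y / 2, since exp(-z^2/(4t)) decreases in z > 0.\<close>

lemma \<Phi>_has_vector_derivative:
  fixes a :: "real \<Rightarrow> real \<Rightarrow> real"
  assumes y: "0 < y" and p: "1 < p"
    and a: "\<And>z. 0 < z \<Longrightarrow> cont_integrable (a z)"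
    and d: "\<And>z t. 0 < z \<Longrightarrow> 0 < t \<Longrightarrow> ((\<lambda>z. a z t) has_real_derivative - (z / 2) * (exp (- (z\<^sup>2 / 4) / t) * t powr (- p))) (at z)"
  shows "((\<lambda>y. \<Phi> (a y) x) has_vector_derivative - (y / 2) *\<^sub>R J p y x) (at y)"
proof -
  let ?k = "\<lambda>z t. exp (- (z\<^sup>2 / 4) / t) * t powr (- p)"
  have "((\<lambda>z. int_pos (\<lambda>t. a z t *\<^sub>R T t x)) has_vector_derivative int_pos (\<lambda>t. (- (y / 2)) *\<^sub>R (?k y t *\<^sub>R T t x))) (at y)"
  proof (rule int_pos_has_vector_derivative[where p="y / 2" and q="2 * y"])
    show "y \<in> {y / 2<..<2 * y}" using y by simp
    show "cont_integrable (\<lambda>t. (- (y / 2)) *\<^sub>R (?k y t *\<^sub>R T t x))"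
      by (intro cont_integrable_scaleR cont_integrable_T cont_integrable_J p y)
    show "integrable pos_measure (\<lambda>t. ?k (y / 2) t * (y * (M * norm x)))"
      using y by (intro integrable_mult_left integrable_if_cont_integrable cont_integrable_J p) auto
    fix z assume z: "z \<in> {y / 2<..<2 * y}"
    then have z0: "0 < z" using y by simp
    show "cont_integrable (\<lambda>t. a z t *\<^sub>R T t x)"
      by (intro cont_integrable_T a z0)
    fix t :: real assume t: "0 < t"
    show "((\<lambda>z. a z t *\<^sub>R T t x) has_vector_derivative - (z / 2) *\<^sub>R ?k z t *\<^sub>R T t x) (at z)"
      using has_vector_derivative_scaleR[OF d[OF z0 t] has_vector_derivative_const[of "T t x"]] by simp
    have "norm (- (z / 2) *\<^sub>R ?k z t *\<^sub>R T t x) = z / 2 * (?k z t * norm (T t x))"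
      using z0 by simp
    also have "\<dots> \<le> y * (?k (y / 2) t * (M * norm x))"
      using z y t norm_T_apply_le[of t x] exp_square_mono[of y z t] by (intro mult_mono mult_right_mono) auto
    finally show "norm (- (z / 2) *\<^sub>R ?k z t *\<^sub>R T t x) \<le> ?k (y / 2) t * (y * (M * norm x))"
      by (simp add: mult_ac)
  qed
  then show ?thesis
    by (simp only: int_pos_scaleR[OF cont_integrable_T[OF cont_integrable_J[OF p y]]] J_def \<Phi>_def)
qed

lemma J_has_vector_derivative:
  assumes y: "0 < y" and p: "1 < p"
  shows "((\<lambda>y. J p y x) has_vector_derivative - (y / 2) *\<^sub>R J (p + 1) y x) (at y)"
  unfolding J_def[of p]
proof (rule \<Phi>_has_vector_derivative[OF y])
  show "((\<lambda>z. exp (- (z\<^sup>2 / 4) / t) * t powr (- p)) has_real_derivative - (z / 2) * (exp (- (z\<^sup>2 / 4) / t) * t powr (- (p + 1)))) (at z)"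
    if "0 < z" "0 < t" for z t
    using that by (auto intro!: derivative_eq_intros simp: powr_diff)
  show "cont_integrable (\<lambda>t. exp (- (z\<^sup>2 / 4) / t) * t powr (- p))" if "0 < z" for z
    by (rule cont_integrable_J[OF p that])
qed (use p in simp)

lemma continuous_on_J: "1 < p \<Longrightarrow> continuous_on {0<..} (\<lambda>y. J p y x)"
  by (intro continuous_at_imp_continuous_on ballI has_vector_derivative_continuous[OF J_has_vector_derivative]) auto

text \<open>Integration by parts (\<open>\<Phi>_eq_B\<close>) turns L into -d/dt on the kernel. The
  factor exp(-b/t) beats every negative power of t at 0, so there is no boundary term.\<close>

lemma L_J:
  assumes y: "0 < y" and p: "1 < p"
  shows "J p y x \<in> D" and "L (J p y x) = p *\<^sub>R J (p + 1) y x - (y\<^sup>2 / 4) *\<^sub>R J (p + 2) y x"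
proof -
  define b where "b = y\<^sup>2 / 4"
  have b: "0 < b" using y by (simp add: b_def)
  let ?k = "\<lambda>p t. exp (- b / t) * t powr (- p)"
  have ci: "cont_integrable (?k q)" if "1 < q" for q
    using cont_integrable_exp_inverse[OF b that] .
  have J: "J q y x = \<Phi> (?k q) x" for q by (simp add: J_def b_def)
  have c1: "cont_integrable (\<lambda>t. b * ?k (p + 2) t)"
    using cont_integrable_scaleR[OF ci[of "p + 2"], of b] p by simp
  have c2: "cont_integrable (\<lambda>t. - p * ?k (p + 1) t)"
    using cont_integrable_scaleR[OF ci[of "p + 1"], of "- p"] p by simp
  have "\<Phi> (?k p) x = B (\<Phi> (\<lambda>t. b * ?k (p + 2) t + - p * ?k (p + 1) t) x + 0 *\<^sub>R x)"
  proof (rule \<Phi>_eq_B)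
    show "cont_integrable (\<lambda>t. b * ?k (p + 2) t + - p * ?k (p + 1) t)"
      by (rule cont_integrable_add(1)[OF c1 c2])
    show "(?k p has_real_derivative b * ?k (p + 2) t + - p * ?k (p + 1) t) (at t)" if "0 < t" for t
    proof -
      have "t powr (- (p + 2)) = t powr (- p) / t\<^sup>2" "t powr (- (p + 1)) = t powr (- p - 1)"
        using that by (simp_all add: powr_diff power2_eq_square)
      then show ?thesis
        using that by (auto intro!: derivative_eq_intros simp: power2_eq_square)
    qed
    show "(?k p \<longlongrightarrow> 0) (at_right 0)" using b p by real_asymp
    show "(?k p \<longlongrightarrow> 0) at_top" using b p by real_asymp
  qed (rule ci[OF p])
  also have "\<Phi> (\<lambda>t. b * ?k (p + 2) t + - p * ?k (p + 1) t) x = b *\<^sub>R J (p + 2) y x + (- p) *\<^sub>R J (p + 1) y x"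
  proof -
    have "\<Phi> (\<lambda>t. b * ?k (p + 2) t) x = b *\<^sub>R J (p + 2) y x"
      unfolding J by (rule \<Phi>_scale[OF ci]) (use p in simp)
    moreover have "\<Phi> (\<lambda>t. - p * ?k (p + 1) t) x = - p *\<^sub>R J (p + 1) y x"
      unfolding J by (rule \<Phi>_scale[OF ci]) (use p in simp)
    ultimately show ?thesis
      by (simp only: \<Phi>_add[OF c1 c2])
  qed
  finally have *: "J p y x = B (b *\<^sub>R J (p + 2) y x - p *\<^sub>R J (p + 1) y x)"
    by (simp add: J)
  show "J p y x \<in> D" by (subst *) (rule B_mem)
  show "L (J p y x) = p *\<^sub>R J (p + 1) y x - (y\<^sup>2 / 4) *\<^sub>R J (p + 2) y x"
    by (subst *) (simp add: L_B b_def)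
qed

section \<open>The extension, its flux and the differential equation\<close>

lemma ext_integrand_eq:
  assumes "0 < t"
  shows "ext_integrand T s x y t = (exp (- (y\<^sup>2 / 4) / t) * t powr (- (1 + s))) *\<^sub>R T t x"
  unfolding ext_integrand_def powr_minus_divide by simp

lemma ext_eq_J:
  assumes "0 < y"
  shows "ext T s x y = (y powr (2 * s) / (4 powr s * Gamma s)) *\<^sub>R J (1 + s) y x"
  unfolding ext_def J_def \<Phi>_def by (subst int_pos_cong(1)[OF ext_integrand_eq]) simp_all

lemma integrable_ext_integrand:
  assumes "0 < y" "0 < s"
  shows "integrable_pos (ext_integrand T s x y)"
proof -
  have "integrable_pos (\<lambda>t. (exp (- (y\<^sup>2 / 4) / t) * t powr (- (1 + s))) *\<^sub>R T t x)"
    using assms by (intro cont_integrable_integrable_pos cont_integrable_T cont_integrable_J) auto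
  then show ?thesis by (subst int_pos_cong(2)[OF ext_integrand_eq])
qed

text \<open>This is y^(1-2s) U'(y) written out; the powers of y that depend on s have cancelled
  outside \<open>J\<close>.\<close>

definition ext_flux :: "real \<Rightarrow> 'a \<Rightarrow> real \<Rightarrow> 'a" where
  "ext_flux s x y = (1 / (4 powr s * Gamma s)) *\<^sub>R ((2 * s) *\<^sub>R J (1 + s) y x - (y\<^sup>2 / 2) *\<^sub>R J (2 + s) y x)"

lemma ext_has_vector_derivative:
  assumes y: "0 < y" and s: "0 < s"
  shows "(ext T s x has_vector_derivative y powr (2 * s - 1) *\<^sub>R ext_flux s x y) (at y)"
proof -
  define c where "c = 1 / (4 powr s * Gamma s)"
  have "((\<lambda>y. c *\<^sub>R (y powr (2 * s) *\<^sub>R J (1 + s) y x)) has_vector_derivative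
     c *\<^sub>R (y powr (2 * s) *\<^sub>R (- (y / 2) *\<^sub>R J (1 + s + 1) y x) + (2 * s * y powr (2 * s - 1)) *\<^sub>R J (1 + s) y x)) (at y)"
  proof (rule bounded_linear.has_vector_derivative[OF bounded_linear_scaleR_right], rule has_vector_derivative_scaleR)
    show "((\<lambda>y. y powr (2 * s)) has_real_derivative 2 * s * y powr (2 * s - 1)) (at y)"
      using y by (auto intro!: derivative_eq_intros)
  qed (intro J_has_vector_derivative; use y s in simp)
  moreover have "c *\<^sub>R (y powr (2 * s) *\<^sub>R (- (y / 2) *\<^sub>R J (1 + s + 1) y x) + (2 * s * y powr (2 * s - 1)) *\<^sub>R J (1 + s) y x)
      = y powr (2 * s - 1) *\<^sub>R ext_flux s x y"
  proof -
    have "y powr (2 * s) * (y / 2) = y powr (2 * s - 1) * (y\<^sup>2 / 2)"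
      using y by (simp add: powr_diff power2_eq_square)
    then show ?thesis
      by (simp add: ext_flux_def c_def scaleR_diff_right mult_ac add.commute)
  qed
  ultimately have "((\<lambda>y. c *\<^sub>R (y powr (2 * s) *\<^sub>R J (1 + s) y x)) has_vector_derivative y powr (2 * s - 1) *\<^sub>R ext_flux s x y) (at y)"
    by simp
  then show ?thesis
    by (rule has_vector_derivative_transform_within_open[where S="{0<..}"]) (use y in \<open>auto simp: ext_eq_J c_def\<close>)
qed

text \<open>The differential equation in divergence form, (y^(1-2s) U')' = - y^(1-2s) L U. The
  prefactor y^(2s) of U leaves the single y on the right.\<close>

lemma ext_flux_has_vector_derivative:
  assumes y: "0 < y" and s: "0 < s"
  shows "(ext_flux s x has_vector_derivative - (y / (4 powr s * Gamma s)) *\<^sub>R L (J (1 + s) y x)) (at y)"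
proof -
  define c where "c = 1 / (4 powr s * Gamma s)"
  have "((\<lambda>y. c *\<^sub>R ((2 * s) *\<^sub>R J (1 + s) y x - (y\<^sup>2 / 2) *\<^sub>R J (2 + s) y x)) has_vector_derivative
     c *\<^sub>R ((2 * s) *\<^sub>R (- (y / 2) *\<^sub>R J (1 + s + 1) y x) - ((y\<^sup>2 / 2) *\<^sub>R (- (y / 2) *\<^sub>R J (2 + s + 1) y x) + y *\<^sub>R J (2 + s) y x))) (at y)"
  proof (rule bounded_linear.has_vector_derivative[OF bounded_linear_scaleR_right], rule has_vector_derivative_diff)
    show "((\<lambda>y. (2 * s) *\<^sub>R J (1 + s) y x) has_vector_derivative (2 * s) *\<^sub>R (- (y / 2) *\<^sub>R J (1 + s + 1) y x)) (at y)"
      using y s by (intro bounded_linear.has_vector_derivative[OF bounded_linear_scaleR_right] J_has_vector_derivative) auto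
    show "((\<lambda>y. (y\<^sup>2 / 2) *\<^sub>R J (2 + s) y x) has_vector_derivative
        (y\<^sup>2 / 2) *\<^sub>R (- (y / 2) *\<^sub>R J (2 + s + 1) y x) + y *\<^sub>R J (2 + s) y x) (at y)"
      using y s by (intro has_vector_derivative_scaleR J_has_vector_derivative) (auto intro!: derivative_eq_intros)
  qed
  moreover have "c *\<^sub>R ((2 * s) *\<^sub>R (- (y / 2) *\<^sub>R J (1 + s + 1) y x) - ((y\<^sup>2 / 2) *\<^sub>R (- (y / 2) *\<^sub>R J (2 + s + 1) y x) + y *\<^sub>R J (2 + s) y x))
    = - (y / (4 powr s * Gamma s)) *\<^sub>R L (J (1 + s) y x)"
  proof -
    have "1 + s + 1 = 2 + s" "1 + s + 2 = 3 + s" "2 + s + 1 = 3 + s" by simp_all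
    moreover from this have "L (J (1 + s) y x) = (1 + s) *\<^sub>R J (2 + s) y x - (y\<^sup>2 / 4) *\<^sub>R J (3 + s) y x"
      using L_J(2)[OF y, of "1 + s" x] s by simp
    ultimately show ?thesis
      by (simp only:) (simp add: c_def algebra_simps power2_eq_square)
  qed
  ultimately show ?thesis by (simp add: ext_flux_def[abs_def] c_def)
qed


section \<open>Representation formulas and limits at y = 0\<close>

lemma ext_frac_power:
  fixes f :: 'a
  assumes s: "0 < s" "s < 1" and y: "0 < y"
  defines "u \<equiv> Bpow s f"
  shows "ext T s u y = u + (1 / Gamma s) *\<^sub>R \<Phi> (\<lambda>t. (exp (- (y\<^sup>2 / 4) / t) - 1) * t powr (s - 1)) f"
proof -
  have b: "0 < y\<^sup>2 / 4" using y by simp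
  have "(y\<^sup>2 / 4) powr s = y powr (2 * s) / 4 powr s"
    using y powr_powr[of y 2 s] by (simp add: powr_divide powr_numeral)
  then show ?thesis
    using extension_frac_power[OF s b, of f] ext_eq_J[OF y, of s u] by (simp add: u_def J_def)
qed

text \<open>Substituting t = b / r moves the parameter from the weight into the semigroup and splits
  off b^s. With b = y^2/4 this leads from the first to the second formula of (a).\<close>

lemma \<Phi>_exp_minus_one:
  assumes s: "0 < s" "s < 1" and b: "0 < b"
  shows "cont_integrable (\<lambda>r. ((exp (- r) - 1) / r powr (1 + s)) *\<^sub>R T (b / r) f)"
    and "\<Phi> (\<lambda>t. (exp (- b / t) - 1) * t powr (s - 1)) f = b powr s *\<^sub>R int_pos (\<lambda>r. ((exp (- r) - 1) / r powr (1 + s)) *\<^sub>R T (b / r) f)"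
proof -
  let ?a = "\<lambda>t. (exp (- b / t) - 1) * t powr (s - 1)"
  let ?g = "\<lambda>r. ((exp (- r) - 1) / r powr (1 + s)) *\<^sub>R T (b / r) f"
  note ci = cont_integrable_exp_inverse_diff[OF b s]
  have eq: "(b / r\<^sup>2 * ?a (b / r)) *\<^sub>R T (b / r) f = b powr s *\<^sub>R ?g r" if r: "0 < r" for r
  proof -
    have "b / r\<^sup>2 * (b / r) powr (s - 1) = b powr s / r powr (1 + s)"
      using b r by (simp add: powr_divide powr_diff powr_add power2_eq_square)
    moreover have "- b / (b / r) = - r" using b r by simp
    ultimately have "b / r\<^sup>2 * ?a (b / r) = b powr s * ((exp (- r) - 1) / r powr (1 + s))"
      by (simp only: mult.left_commute[of "b / r\<^sup>2"]) simp
    then show ?thesis by simp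
  qed
  have ci': "cont_integrable (\<lambda>r. b powr s *\<^sub>R ?g r)"
    using \<Phi>_inverse(1)[OF ci b, of f] cont_integrable_cong[OF eq] by simp
  have g: "?g = (\<lambda>r. (1 / b powr s) *\<^sub>R (b powr s *\<^sub>R ?g r))" using b by simp
  show cg: "cont_integrable ?g"
    by (subst g) (rule cont_integrable_scaleR[OF ci'])
  have "\<Phi> ?a f = int_pos (\<lambda>r. b powr s *\<^sub>R ?g r)"
    unfolding \<Phi>_inverse(2)[OF ci b, of f, symmetric] by (rule int_pos_cong(1)) (rule eq)
  then show "\<Phi> ?a f = b powr s *\<^sub>R int_pos ?g"
    by (simp only: int_pos_scaleR[OF cg])
qed

lemma filterlim_square_quarter: "filterlim (\<lambda>y::real. y\<^sup>2 / 4) (at_right 0) (at_right 0)"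
  by real_asymp

lemma ext_quotient_tendsto:
  fixes f :: 'a
  assumes s: "0 < s" "s < 1"
  defines "u \<equiv> Bpow s f"
  shows "((\<lambda>y. (ext T s u y - u) /\<^sub>R y powr (2 * s)) \<longlongrightarrow> (c_const s / (2 * s)) *\<^sub>R f) (at_right 0)"
proof -
  let ?w = "\<lambda>r::real. (exp (- r) - 1) / r powr (1 + s)"
  let ?c = "1 / (4 powr s * Gamma s)"
  note w = int_pos_exp_minus_one[OF s]
  have "((\<lambda>y. ?c *\<^sub>R int_pos (\<lambda>r. ?w r *\<^sub>R T ((y\<^sup>2 / 4) / r) f)) \<longlongrightarrow> ?c *\<^sub>R (int_pos ?w *\<^sub>R f)) (at_right 0)"
    by (intro tendsto_scaleR tendsto_const filterlim_compose[OF int_pos_T_inverse_tendsto[OF w(1)] filterlim_square_quarter])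
  moreover have "?c *\<^sub>R (int_pos ?w *\<^sub>R f) = (c_const s / (2 * s)) *\<^sub>R f"
    unfolding w(2) c_const_def by (simp add: powr_diff powr_half_sqrt mult.commute)
  moreover have "\<forall>\<^sub>F y in at_right 0. ?c *\<^sub>R int_pos (\<lambda>r. ?w r *\<^sub>R T ((y\<^sup>2 / 4) / r) f) = (ext T s u y - u) /\<^sub>R y powr (2 * s)"
  proof (rule eventually_at_right_0I)
    fix y :: real assume y: "0 < y"
    have b: "0 < y\<^sup>2 / 4" using y by simp
    have p: "(y\<^sup>2 / 4) powr s = y powr (2 * s) / 4 powr s"
      using y powr_powr[of y 2 s] by (simp add: powr_divide powr_numeral)
    show "?c *\<^sub>R int_pos (\<lambda>r. ?w r *\<^sub>R T ((y\<^sup>2 / 4) / r) f) = (ext T s u y - u) /\<^sub>R y powr (2 * s)"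
      unfolding ext_frac_power[OF s y, of f, folded u_def] \<Phi>_exp_minus_one(2)[OF s b] p using y by simp
  qed
  ultimately show ?thesis
    using Lim_transform_eventually by fastforce
qed

text \<open>The definition of \<open>ext_flux\<close> contains terms of order y^(-2s) that cancel,
  so it does not show the limit. Differentiating the representation (a) instead expresses U' through
  \<open>J (2 - s) y f\<close>, and uniqueness of derivatives equates the two. The substitution t =
  y^2/(4r) then gives an integral with the fixed weight r^(-s) exp(-r).\<close>

lemma ext_flux_tendsto:
  fixes f :: 'a
  assumes s: "0 < s" "s < 1"
  defines "u \<equiv> Bpow s f"
  shows "(ext_flux s u \<longlongrightarrow> c_const s *\<^sub>R f) (at_right 0)"
proof -
  let ?w = "\<lambda>r. r powr ((1 - s) - 1) * exp (- 1 * r)"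
  \<comment> \<open>Differentiation contributes -y/2 and 1/Gamma(s), the weight of the flux
    y^(1-2s), and the substitution b^(s-1) with b = y^2/4. The powers of y cancel and 4^(1-s)
    remains.\<close>
  let ?c = "- (4 powr (1 - s) / (2 * Gamma s))"
  have w: "cont_integrable ?w" "int_pos ?w = Gamma (1 - s)"
    using cont_integrable_Gamma[of "1 - s" 1] s by auto
  have "((\<lambda>y. ?c *\<^sub>R int_pos (\<lambda>r. ?w r *\<^sub>R T ((y\<^sup>2 / 4) / r) f)) \<longlongrightarrow> ?c *\<^sub>R (int_pos ?w *\<^sub>R f)) (at_right 0)"
    by (intro tendsto_scaleR tendsto_const filterlim_compose[OF int_pos_T_inverse_tendsto[OF w(1)] filterlim_square_quarter])
  moreover have "?c *\<^sub>R (int_pos ?w *\<^sub>R f) = c_const s *\<^sub>R f"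
    unfolding w(2) c_const_def by (simp add: powr_diff powr_half_sqrt mult.commute)
  moreover have "\<forall>\<^sub>F y in at_right 0. ?c *\<^sub>R int_pos (\<lambda>r. ?w r *\<^sub>R T ((y\<^sup>2 / 4) / r) f) = ext_flux s u y"
  proof (rule eventually_at_right_0I)
    fix y :: real assume y: "0 < y"
    define b where "b = y\<^sup>2 / 4"
    have b: "0 < b" using y by (simp add: b_def)
    define I where "I = int_pos (\<lambda>r. ?w r *\<^sub>R T (b / r) f)"
    have p: "1 < 2 - s" using s by simp
    let ?a = "\<lambda>t. exp (- b / t) * t powr (- (2 - s))"
    have ca: "cont_integrable ?a" by (rule cont_integrable_exp_inverse[OF b p])
    have cwT: "cont_integrable (\<lambda>r. ?w r *\<^sub>R T (b / r) f)"
      by (rule cont_integrable_T_inverse(1)[OF w(1) b])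
    have "J (2 - s) y f = \<Phi> ?a f" by (simp add: J_def b_def)
    also have "\<dots> = int_pos (\<lambda>r. (b / r\<^sup>2 * ?a (b / r)) *\<^sub>R T (b / r) f)"
      by (rule \<Phi>_inverse(2)[OF ca b, symmetric])
    also have "\<dots> = int_pos (\<lambda>r. b powr (s - 1) *\<^sub>R (?w r *\<^sub>R T (b / r) f))"
    proof (rule int_pos_cong(1))
      fix r :: real assume r: "0 < r"
      have "b / r\<^sup>2 * (b / r) powr (- (2 - s)) = b powr (s - 1) * r powr ((1 - s) - 1)"
        using b r by (simp add: powr_divide powr_diff powr_minus power2_eq_square field_simps)
      moreover have "- b / (b / r) = - 1 * r" using b r by simp
      ultimately have "b / r\<^sup>2 * ?a (b / r) = b powr (s - 1) * ?w r"
        by (simp only: mult.left_commute[of "b / r\<^sup>2"]) simp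
      then show "(b / r\<^sup>2 * ?a (b / r)) *\<^sub>R T (b / r) f = b powr (s - 1) *\<^sub>R (?w r *\<^sub>R T (b / r) f)"
        by simp
    qed
    also have "\<dots> = b powr (s - 1) *\<^sub>R I"
      unfolding I_def by (rule int_pos_scaleR[OF cwT])
    finally have J: "J (2 - s) y f = b powr (s - 1) *\<^sub>R I" .
    have "((\<lambda>y. u + (1 / Gamma s) *\<^sub>R \<Phi> (\<lambda>t. (exp (- (y\<^sup>2 / 4) / t) - 1) * t powr (s - 1)) f) has_vector_derivative
        0 + (1 / Gamma s) *\<^sub>R (- (y / 2) *\<^sub>R J (2 - s) y f)) (at y)"
    proof (intro has_vector_derivative_add has_vector_derivative_const
        bounded_linear.has_vector_derivative[OF bounded_linear_scaleR_right] \<Phi>_has_vector_derivative y p)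
      show "cont_integrable (\<lambda>t. (exp (- (z\<^sup>2 / 4) / t) - 1) * t powr (s - 1))" if "0 < z" for z :: real
        using that by (intro cont_integrable_exp_inverse_diff s) simp
      show "((\<lambda>z. (exp (- (z\<^sup>2 / 4) / t) - 1) * t powr (s - 1)) has_real_derivative
          - (z / 2) * (exp (- (z\<^sup>2 / 4) / t) * t powr (- (2 - s)))) (at z)" if "0 < z" "0 < t" for z t
        using that by (auto intro!: derivative_eq_intros simp: powr_diff power2_eq_square)
    qed
    then have "(ext T s u has_vector_derivative 0 + (1 / Gamma s) *\<^sub>R (- (y / 2) *\<^sub>R J (2 - s) y f)) (at y)"
      by (rule has_vector_derivative_transform_within_open[where S="{0<..}"])
         (use y in \<open>auto simp: ext_frac_power[OF s, of _ f, folded u_def]\<close>)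
    from vector_derivative_unique_at[OF ext_has_vector_derivative[OF y s(1)] this]
    have "y powr (2 * s - 1) *\<^sub>R ext_flux s u y = (1 / Gamma s) *\<^sub>R (- (y / 2) *\<^sub>R (b powr (s - 1) *\<^sub>R I))"
      by (simp only: J add_0)
    then have "y powr (1 - 2 * s) *\<^sub>R (y powr (2 * s - 1) *\<^sub>R ext_flux s u y)
        = (- (y powr (1 - 2 * s) * y * b powr (s - 1)) / (2 * Gamma s)) *\<^sub>R I"
      by (simp only:) (simp add: mult_ac)
    moreover have "y powr (1 - 2 * s) * y powr (2 * s - 1) = 1"
      using y by (simp add: powr_add[symmetric])
    moreover have "y powr (1 - 2 * s) * y * b powr (s - 1) = 4 powr (1 - s)"
    proof -
      have "b powr (s - 1) = y powr (2 * (s - 1)) / 4 powr (s - 1)"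
        using y powr_powr[of y 2 "s - 1"] by (simp add: b_def powr_divide powr_numeral)
      moreover have "y powr (1 - 2 * s) * y * y powr (2 * (s - 1)) = 1"
      proof -
        have "y powr (1 - 2 * s) * y powr 1 * y powr (2 * (s - 1)) = y powr ((1 - 2 * s) + 1 + 2 * (s - 1))"
          by (simp only: powr_add)
        then show ?thesis using y by simp
      qed
      moreover have "1 / 4 powr (s - 1) = (4::real) powr (1 - s)"
        using powr_minus_divide[of 4 "s - 1"] by simp
      ultimately show ?thesis by (metis mult.assoc times_divide_eq_right)
    qed
    ultimately show "?c *\<^sub>R int_pos (\<lambda>r. ?w r *\<^sub>R T ((y\<^sup>2 / 4) / r) f) = ext_flux s u y"
      by (simp add: I_def b_def)
  qed
  ultimately show ?thesis
    using Lim_transform_eventually by fastforce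
qed

end

section \<open>Uniqueness\<close>

text \<open>For p < 1 the bound x^(p-1) is singular at 0, so the mean value inequality is used on
  [d, y] and d tends to 0 afterwards, with the limit of \<open>G\<close> as initial value.\<close>

lemma norm_le_powr_of_derivative:
  fixes G :: "real \<Rightarrow> 'a::banach"
  assumes G: "\<And>x. 0 < x \<Longrightarrow> x \<le> Y \<Longrightarrow> (G has_vector_derivative g x) (at x)"
    and g: "\<And>x. 0 < x \<Longrightarrow> x \<le> Y \<Longrightarrow> norm (g x) \<le> K * x powr (p - 1)"
    and p: "0 < p" and K: "0 \<le> K" and lim: "(G \<longlongrightarrow> 0) (at_right 0)" and y: "0 < y" "y \<le> Y"
  shows "norm (G y) \<le> K / p * y powr p"
proof -
  have "norm (G y - G d) \<le> K / p * y powr p" if d: "0 < d" "d < y" for d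
  proof -
    have "norm (G y - G d) \<le> K / p * y powr p - K / p * d powr p"
    proof (rule differentiable_bound_general[OF d(2)])
      show "continuous_on {d..y} G"
        using d y by (intro continuous_at_imp_continuous_on ballI has_vector_derivative_continuous[OF G]) auto
      show "continuous_on {d..y} (\<lambda>x. K / p * x powr p)"
        using d by (intro continuous_intros) auto
      fix x assume x: "d < x" "x < y"
      then have x0: "0 < x" "x \<le> Y" using d y by auto
      show "(G has_vector_derivative g x) (at x)" by (rule G[OF x0])
      show "((\<lambda>x. K / p * x powr p) has_vector_derivative K * x powr (p - 1)) (at x)"
        unfolding has_real_derivative_iff_has_vector_derivative[symmetric]
        using x0 p by (auto intro!: derivative_eq_intros)
      show "norm (g x) \<le> K * x powr (p - 1)" by (rule g[OF x0])
    qed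
    also have "\<dots> \<le> K / p * y powr p" using K p by simp
    finally show ?thesis .
  qed
  then have ev: "\<forall>\<^sub>F d in at_right 0. norm (G y - G d) \<le> K / p * y powr p"
    using y eventually_at_right_real[OF y(1)] by (auto elim!: eventually_mono)
  have "((\<lambda>d. norm (G y - G d)) \<longlongrightarrow> norm (G y - 0)) (at_right 0)"
    by (intro tendsto_intros lim)
  from tendsto_upperbound[OF this ev trivial_limit_at_right_real] show ?thesis by simp
qed

text \<open>n^n / n! is a single term of the exponential series at n.\<close>

lemma power_le_exp_fact: "real n ^ n \<le> exp (real n) * fact n"
proof -
  have "real n ^ n / fact n \<le> (\<Sum>k<Suc n. inverse (fact k) *\<^sub>R real n ^ k)"
    by (simp add: divide_inverse mult.commute sum_nonneg)
  also have "\<dots> \<le> (\<Sum>k. inverse (fact k) *\<^sub>R real n ^ k)"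
    by (rule sum_le_suminf[OF summable_exp_generic]) auto
  also have "\<dots> = exp (real n)" by (simp add: exp_def)
  finally show ?thesis by (simp add: field_simps)
qed

text \<open>Starts the induction on powers of B. A solution may grow for large y, so the bound is
  only for (0, Y]: the limit covers a neighbourhood of 0 and compactness the rest.\<close>

lemma bounded_near_right_0:
  fixes Z :: "real \<Rightarrow> 'a::banach"
  assumes Z: "continuous_on {0<..} Z" and lim: "(Z \<longlongrightarrow> 0) (at_right 0)"
  obtains N where "0 \<le> N" "\<And>x. 0 < x \<Longrightarrow> x \<le> Y \<Longrightarrow> norm (Z x) \<le> N"
proof -
  have "\<forall>\<^sub>F x in at_right 0. dist (Z x) 0 < 1"
    using lim by (rule tendstoD) simp
  then obtain d where d: "d > 0" "\<And>x. 0 < x \<Longrightarrow> x < d \<Longrightarrow> dist (Z x) 0 < 1"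
    by (auto simp: eventually_at_right_field)
  have "compact (Z ` {d..Y})"
    using d by (intro compact_continuous_image continuous_on_subset[OF Z]) auto
  from compact_imp_bounded[OF this] obtain C where C: "\<And>z. z \<in> Z ` {d..Y} \<Longrightarrow> norm z \<le> C"
    unfolding bounded_iff by blast
  show ?thesis
  proof (rule that[of "max 1 C"])
    show "norm (Z x) \<le> max 1 C" if "0 < x" "x \<le> Y" for x
    proof (cases "x < d")
      case True
      then show ?thesis using d(2)[of x] that by simp
    next
      case False
      then show ?thesis using C[of "Z x"] that by simp
    qed
  qed simp
qed

context bounded_semigroup
begin

text \<open>z R(z) averages the orbit with weights z exp(-z r) of total mass 1, so it preserves any
  bound that holds along the whole orbit. Carrying an orbit bound through the induction avoids the
  factor M^n that iterating \<open>norm_R_le\<close> would produce.\<close>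

lemma norm_resolvent_power_le:
  assumes z: "0 < z"
  shows "(\<And>t. 0 \<le> t \<Longrightarrow> norm (T t x) \<le> c) \<Longrightarrow> 0 \<le> t \<Longrightarrow> norm (T t (((\<lambda>x. z *\<^sub>R R z x) ^^ n) x)) \<le> c"
proof (induction n arbitrary: x t)
  case (Suc n)
  let ?W = "\<lambda>x. z *\<^sub>R R z x"
  have "norm (T t (?W x)) \<le> c" if t: "0 \<le> t" for t
  proof -
    note ce = cont_integrable_exp(1)[OF z]
    have "T t (R z x) = R z (T t x)"
      unfolding R_def by (rule T_\<Phi>[OF ce t])
    moreover have "norm (R z (T t x)) \<le> c / z"
    proof -
      have "norm (R z (T t x)) \<le> (\<integral>r. exp (- z * r) * c \<partial>pos_measure)"
        unfolding R_def \<Phi>_def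
      proof (rule norm_int_pos_le[OF cont_integrable_T[OF ce]])
        show "integrable pos_measure (\<lambda>r. exp (- z * r) * c)"
          by (intro integrable_mult_left integrable_if_cont_integrable ce) auto
        show "norm (exp (- z * r) *\<^sub>R T r (T t x)) \<le> exp (- z * r) * c" if "0 < r" for r
          using Suc.prems(1)[of "r + t"] T_add[of r t x] t that by (simp add: mult_left_mono)
      qed
      also have "\<dots> = c / z"
        by (simp only: integral_mult_left_zero int_pos_real[OF ce, symmetric] int_pos_exp[OF z]) simp
      finally show ?thesis .
    qed
    ultimately show ?thesis using z by (simp add: blinfun.scaleR_right field_simps)
  qed
  from Suc.IH[OF this Suc.prems(2)] show ?case by (simp only: funpow_Suc_right o_def)
qed simp

text \<open>
  With \<open>W = z R(z) = z B E\<close> and \<open>E = 1 - z R(z)\<close> the hypothesis gives \<open>W\<^sup>n x \<rightarrow> 0\<close> along \<open>z = n/t\<close>, while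
  telescoping gives \<open>\<parallel>W\<^sup>n B x - B x\<parallel> \<le> M\<^sup>2 t \<parallel>x\<parallel>\<close>.
\<close>

lemma eq_0_of_power_bounds:
  assumes x: "\<And>n. norm ((blinfun_apply B ^^ n) x) \<le> N * q ^ n / (fact n)\<^sup>2" and q: "0 \<le> q"
  shows "x = 0"
proof -
  have N: "0 \<le> N" using x[of 0] norm_ge_zero[of x] by (simp del: norm_ge_zero)
  have BB: "norm (B x) \<le> M\<^sup>2 * t * norm x" if t: "0 < t" for t
  proof -
    \<comment> \<open>\<open>C\<close> gathers the n-th powers: (1 + M)^n from E^n, q^n from the
      hypothesis, t^(-n) from z^n with z = n/t, and exp(n) from n^n <= exp(n) n!.\<close>
    define C where "C = exp 1 * ((1 + M) * q / t)"
    have main: "norm (B x) \<le> norm B * (N * (C ^ n / fact n)) + M\<^sup>2 * t * norm x" if n: "0 < n" for n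
    proof -
      define z where "z = real n / t"
      have z: "0 < z" using n t by (simp add: z_def)
      define W where "W = (\<lambda>x. z *\<^sub>R R z x)"
      define E where "E = (\<lambda>x. x - z *\<^sub>R R z x)"
      interpret R: bounded_linear "R z" by (rule bounded_linear_R[OF z])
      have WB: "W (B v) = B (W v)" for v by (simp add: W_def B_R[OF z] blinfun.scaleR_right)
      have EB: "E (B v) = B (E v)" for v by (simp add: E_def B_R[OF z] blinfun.scaleR_right blinfun.diff_right)
      have WE: "W v = z *\<^sub>R B (E v)" for v
        unfolding W_def E_def by (subst R_eq_B[OF z]) simp
      have Wnorm: "norm ((W ^^ k) v) \<le> M * norm v" for k v
        using norm_resolvent_power_le[OF z, of v "M * norm v" 0 k] norm_T_apply_le by (simp add: W_def)
      have Enorm: "norm ((E ^^ k) v) \<le> (1 + M) ^ k * norm v" for k v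
      proof (induction k)
        case (Suc k)
        have "norm (E w) \<le> (1 + M) * norm w" for w
          unfolding E_def using norm_triangle_ineq4[of w "z *\<^sub>R R z w"] norm_R_le[OF z, of w] by (simp add: algebra_simps)
        from this[of "(E ^^ k) v"] have "norm (E ((E ^^ k) v)) \<le> (1 + M) * norm ((E ^^ k) v)" .
        also have "\<dots> \<le> (1 + M) * ((1 + M) ^ k * norm v)"
          by (rule mult_left_mono[OF Suc]) (use M_ge_1 in simp)
        finally show ?case by (simp add: mult.assoc)
      qed simp
      have EBk: "E ((blinfun_apply B ^^ k) v) = (blinfun_apply B ^^ k) (E v)" for k v
        by (induction k) (simp_all add: EB)
      have lin: "(blinfun_apply B ^^ k) (c *\<^sub>R v) = c *\<^sub>R (blinfun_apply B ^^ k) v" for k c v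
        by (induction k) (simp_all add: blinfun.scaleR_right)
      have Escale: "E (c *\<^sub>R v) = c *\<^sub>R E v" for c v
        by (simp add: E_def R.scaleR scaleR_diff_right)
      \<comment> \<open>By \<open>WE\<close> each \<open>W\<close> is z B E, and B commutes with E,
        so the n factors B can be collected next to the vector.\<close>
      have Wk: "(W ^^ k) v = z ^ k *\<^sub>R (E ^^ k) ((blinfun_apply B ^^ k) v)" for k v
      proof (induction k)
        case (Suc k)
        have EkB: "(E ^^ k) (B v) = B ((E ^^ k) v)" for v
          by (induction k) (simp_all add: EB)
        have "(W ^^ Suc k) v = z *\<^sub>R B (E ((W ^^ k) v))"
          by (simp only: funpow.simps o_apply WE[of "(W ^^ k) v"])
        also have "\<dots> = z ^ Suc k *\<^sub>R B (E ((E ^^ k) ((blinfun_apply B ^^ k) v)))"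
          by (simp only: Suc.IH Escale blinfun.scaleR_right scaleR_scaleR power_Suc)
        also have "\<dots> = z ^ Suc k *\<^sub>R (E ^^ Suc k) ((blinfun_apply B ^^ Suc k) v)"
          by (simp add: EkB EB)
        finally show ?case .
      qed simp
      have "norm ((W ^^ n) x) \<le> z ^ n * ((1 + M) ^ n * (N * q ^ n / (fact n)\<^sup>2))"
      proof -
        have "norm ((W ^^ n) x) = z ^ n * norm ((E ^^ n) ((blinfun_apply B ^^ n) x))"
          using z by (simp add: Wk)
        also have "\<dots> \<le> z ^ n * ((1 + M) ^ n * norm ((blinfun_apply B ^^ n) x))"
          using z by (intro mult_left_mono Enorm) auto
        also have "\<dots> \<le> z ^ n * ((1 + M) ^ n * (N * q ^ n / (fact n)\<^sup>2))"
          using z M_ge_1 x by (intro mult_left_mono) auto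
        finally show ?thesis .
      qed
      also have "\<dots> = N * ((1 + M) * q / t) ^ n * (real n ^ n) / (fact n)\<^sup>2"
        by (simp add: z_def power_divide power_mult_distrib mult_ac)
      also have "\<dots> \<le> N * ((1 + M) * q / t) ^ n * (exp (real n) * fact n) / (fact n)\<^sup>2"
        using N q t M_ge_1 by (intro divide_right_mono mult_left_mono power_le_exp_fact) auto
      also have "\<dots> = N * (C ^ n / fact n)"
      proof -
        have "exp (real n) = exp 1 ^ n" by (simp add: exp_of_nat_mult[of n 1, simplified])
        moreover have "C ^ n = exp 1 ^ n * ((1 + M) * q / t) ^ n"
          unfolding C_def by (rule power_mult_distrib)
        ultimately show ?thesis by (simp add: power2_eq_square)
      qed
      finally have w: "norm ((W ^^ n) x) \<le> N * (C ^ n / fact n)" .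
      \<comment> \<open>Telescoping: each of the k increments is some power of W applied to W v - v,
        and \<open>Wnorm\<close> bounds all powers by the same M.\<close>
      have tele: "norm ((W ^^ k) v - v) \<le> real k * (M * norm (W v - v))" for k v
      proof (induction k)
        case (Suc k)
        have "(W ^^ k) (a - b) = (W ^^ k) a - (W ^^ k) b" for a b
          by (induction k) (simp_all add: W_def R.diff scaleR_diff_right)
        then have "(W ^^ Suc k) v - v = (W ^^ k) (W v - v) + ((W ^^ k) v - v)"
          by (simp add: funpow_swap1)
        also have "norm \<dots> \<le> M * norm (W v - v) + real k * (M * norm (W v - v))"
          by (rule norm_triangle_mono[OF Wnorm Suc])
        finally show ?case by (simp add: algebra_simps)
      qed simp
      \<comment> \<open>On the range of B the operator W - 1 has size of order 1/z, so n steps with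
        z = n / t add up to order t.\<close>
      have WBx: "W (B x) - B x = - R z x"
      proof -
        have "B x - z *\<^sub>R B (R z x) = R z x"
          using R_eq_B[OF z, of x] by (simp add: blinfun.diff_right blinfun.scaleR_right)
        moreover have "W (B x) - B x = - (B x - z *\<^sub>R B (R z x))"
          by (simp add: W_def B_R[OF z, symmetric])
        ultimately show ?thesis by (simp only:)
      qed
      have "norm (W (B x) - B x) \<le> M * norm x / z"
        unfolding WBx norm_minus_cancel using norm_R_le[OF z, of x] z by (simp add: field_simps)
      then have "real n * (M * norm (W (B x) - B x)) \<le> real n * (M * (M * norm x / z))"
        using M_ge_1 by (intro mult_left_mono) auto
      also have "\<dots> = M\<^sup>2 * t * norm x"
        using n t by (simp add: z_def power2_eq_square)
      finally have "norm ((W ^^ n) (B x) - B x) \<le> M\<^sup>2 * t * norm x"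
        using tele[of n "B x"] by linarith
      moreover have "(W ^^ n) (B x) = B ((W ^^ n) x)"
        by (induction n) (simp_all add: WB)
      moreover have "norm (B ((W ^^ n) x)) \<le> norm B * (N * (C ^ n / fact n))"
        using norm_blinfun[of B "(W ^^ n) x"] mult_left_mono[OF w, of "norm B"] by simp
      ultimately show ?thesis
        using norm_triangle_ineq3[of "B x" "B ((W ^^ n) x)"] norm_minus_commute[of "B x" "B ((W ^^ n) x)"] by simp
    qed
    have "(\<lambda>n. C ^ n / fact n) \<longlonglongrightarrow> 0"
      using summable_LIMSEQ_zero[OF summable_exp_generic[of C]] by (simp add: divide_inverse mult.commute)
    then have "(\<lambda>n. norm B * (N * (C ^ n / fact n)) + M\<^sup>2 * t * norm x) \<longlonglongrightarrow> norm B * (N * 0) + M\<^sup>2 * t * norm x"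
      by (intro tendsto_intros)
    then have "norm (B x) \<le> norm B * (N * 0) + M\<^sup>2 * t * norm x"
      by (rule LIMSEQ_le_const) (use main in \<open>auto intro!: exI[of _ 1]\<close>)
    then show ?thesis by simp
  qed
  \<comment> \<open>For each fixed t the index n has already gone to infinity; now t tends to
    0.\<close>
  have "((\<lambda>t. M\<^sup>2 * t * norm x) \<longlongrightarrow> M\<^sup>2 * 0 * norm x) (at_right 0)"
    by (intro tendsto_intros)
  moreover have "\<forall>\<^sub>F t in at_right 0. norm (B x) \<le> M\<^sup>2 * t * norm x"
    using BB by (rule eventually_at_right_0I)
  ultimately have "norm (B x) \<le> M\<^sup>2 * 0 * norm x"
    by (rule tendsto_lowerbound) simp
  then have "B x = 0" by simp
  then show ?thesis by (rule B_eq_0)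
qed

text \<open>The equation reads P' = - y^(1-2s) L Z with P = y^(1-2s) Z', and B^(n+1) L = - B^n on
  the domain. A bound on B^n Z thus integrates to one on B^(n+1) P, and since Z' = y^(2s-1) P, a
  second integration bounds B^(n+1) Z.\<close>

lemma solution_eq_0:
  assumes s: "0 < s" "s < 1"
    and D: "\<And>y. 0 < y \<Longrightarrow> Z y \<in> D"
    and Z: "\<And>y. 0 < y \<Longrightarrow> (Z has_vector_derivative Z1 y) (at y)"
    and Z1: "\<And>y. 0 < y \<Longrightarrow> (Z1 has_vector_derivative Z2 y) (at y)"
    and eq: "\<And>y. 0 < y \<Longrightarrow> L (Z y) + ((1 - 2 * s) / y) *\<^sub>R Z1 y + Z2 y = 0"
    and lim: "(Z \<longlongrightarrow> 0) (at_right 0)" "((\<lambda>y. y powr (1 - 2 * s) *\<^sub>R Z1 y) \<longlongrightarrow> 0) (at_right 0)"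
    and Y: "0 < Y"
  shows "Z Y = 0"
proof -
  define P where "P y = y powr (1 - 2 * s) *\<^sub>R Z1 y" for y
  define Bn where "Bn n = (blinfun_apply B ^^ n)" for n
  have Bn_lin: "bounded_linear (Bn n)" for n
    unfolding Bn_def
  proof (induction n)
    case 0
    then show ?case by (simp add: id_def bounded_linear_ident)
  next
    case (Suc n)
    then show ?case
      using bounded_linear_compose[OF blinfun.bounded_linear_right Suc] by (simp add: o_def)
  qed
  have Bn_Suc: "Bn (Suc n) x = Bn n (B x)" for n x
    by (simp add: Bn_def funpow_swap1)
  have P': "(P has_vector_derivative - (y powr (1 - 2 * s) *\<^sub>R L (Z y))) (at y)" if y: "0 < y" for y
  proof -
    have "(P has_vector_derivative y powr (1 - 2 * s) *\<^sub>R Z2 y + ((1 - 2 * s) * y powr (1 - 2 * s - 1)) *\<^sub>R Z1 y) (at y)"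
      unfolding P_def using y by (intro has_vector_derivative_scaleR Z1) (auto intro!: derivative_eq_intros)
    moreover have "Z2 y = - (L (Z y) + ((1 - 2 * s) / y) *\<^sub>R Z1 y)"
      using eq[OF y] unfolding eq_neg_iff_add_eq_0 by (simp only: ac_simps)
    moreover have "(1 - 2 * s) * y powr (1 - 2 * s - 1) = y powr (1 - 2 * s) * ((1 - 2 * s) / y)"
      using y powr_diff[of y "1 - 2 * s" 1] by simp
    ultimately show ?thesis
      by (simp add: scaleR_diff_right scaleR_add_right)
  qed
  have contZ: "continuous_on {0<..} Z"
    by (intro continuous_at_imp_continuous_on ballI has_vector_derivative_continuous[OF Z]) auto
  obtain N where N: "0 \<le> N" "\<And>y. 0 < y \<Longrightarrow> y \<le> Y \<Longrightarrow> norm (Z y) \<le> N"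
    using bounded_near_right_0[OF contZ lim(1), of Y] by blast
  \<comment> \<open>The two integrations divide by 2n + 2 - 2s and by 2n + 2. Replacing their
    product by its lower bound 4 (1 - s) (n + 1)^2 gives a closed form for \<open>K\<close>.\<close>
  define K where "K n = N / ((4 * (1 - s)) ^ n * (fact n)\<^sup>2)" for n
  have K0: "0 \<le> K n" for n using N(1) s by (simp add: K_def)
  have bound: "\<forall>y. 0 < y \<longrightarrow> y \<le> Y \<longrightarrow> norm (Bn n (Z y)) \<le> K n * y powr (2 * real n)" for n
  proof (induction n)
    case 0
    then show ?case using N(2) by (simp add: Bn_def K_def)
  next
    case (Suc n)
    \<comment> \<open>The exponent of the antiderivative of y^(1-2s) y^(2n); it is positive for n =
      0 because s < 1.\<close>
    define c where "c = 2 * real n + 2 - 2 * s"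
    have c: "0 < c" using s by (simp add: c_def)
    interpret Bn: bounded_linear "Bn n" by (rule Bn_lin)
    interpret BS: bounded_linear "Bn (Suc n)" by (rule Bn_lin)
    have G: "norm (Bn (Suc n) (P y)) \<le> K n / c * y powr c" if y: "0 < y" "y \<le> Y" for y
    proof (rule norm_le_powr_of_derivative[OF _ _ c K0 _ y])
      show "((\<lambda>y. Bn (Suc n) (P y)) has_vector_derivative y powr (1 - 2 * s) *\<^sub>R Bn n (Z y)) (at y)" if "0 < y" for y
      proof -
        have "((\<lambda>y. Bn (Suc n) (P y)) has_vector_derivative Bn (Suc n) (- (y powr (1 - 2 * s) *\<^sub>R L (Z y)))) (at y)"
          by (rule BS.has_vector_derivative[OF P'[OF that]])
        moreover have "Bn (Suc n) (- (y powr (1 - 2 * s) *\<^sub>R L (Z y))) = y powr (1 - 2 * s) *\<^sub>R Bn n (Z y)"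
          by (simp add: Bn_Suc B_L[OF D[OF that]] blinfun.minus_right blinfun.scaleR_right Bn.scaleR)
        ultimately show ?thesis by simp
      qed
      show "norm (y powr (1 - 2 * s) *\<^sub>R Bn n (Z y)) \<le> K n * y powr (c - 1)" if y: "0 < y" "y \<le> Y" for y
      proof -
        have "y powr (1 - 2 * s) * norm (Bn n (Z y)) \<le> y powr (1 - 2 * s) * (K n * y powr (2 * real n))"
          using Suc y by (intro mult_left_mono) auto
        also have "\<dots> = K n * y powr (c - 1)"
          using y by (simp add: c_def powr_add[symmetric] algebra_simps)
        finally show ?thesis by simp
      qed
      show "((\<lambda>y. Bn (Suc n) (P y)) \<longlongrightarrow> 0) (at_right 0)"
        using BS.tendsto[OF lim(2)] by (simp add: P_def BS.zero)
    qed
    have "norm (Bn (Suc n) (Z y)) \<le> (K n / c) / (2 * real n + 2) * y powr (2 * real n + 2)" if y: "0 < y" "y \<le> Y" for y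
    proof (rule norm_le_powr_of_derivative[OF _ _ _ _ _ y])
      show "((\<lambda>y. Bn (Suc n) (Z y)) has_vector_derivative Bn (Suc n) (Z1 y)) (at y)" if "0 < y" for y
        by (rule BS.has_vector_derivative[OF Z[OF that]])
      show "norm (Bn (Suc n) (Z1 y)) \<le> K n / c * y powr ((2 * real n + 2) - 1)" if y: "0 < y" "y \<le> Y" for y
      proof -
        have "Z1 y = y powr (2 * s - 1) *\<^sub>R P y"
          using y by (simp add: P_def powr_add[symmetric])
        then have "norm (Bn (Suc n) (Z1 y)) = y powr (2 * s - 1) * norm (Bn (Suc n) (P y))"
          by (simp add: BS.scaleR)
        also have "\<dots> \<le> y powr (2 * s - 1) * (K n / c * y powr c)"
          using G[OF y] by (intro mult_left_mono) auto
        also have "\<dots> = K n / c * (y powr (2 * s - 1) * y powr c)" by simp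
        also have "y powr (2 * s - 1) * y powr c = y powr ((2 * real n + 2) - 1)"
          by (simp add: c_def powr_add[symmetric])
        finally show ?thesis .
      qed
      show "((\<lambda>y. Bn (Suc n) (Z y)) \<longlongrightarrow> 0) (at_right 0)"
        using BS.tendsto[OF lim(1)] by (simp add: BS.zero)
    qed (use K0[of n] c in auto)
    moreover have "(K n / c) / (2 * real n + 2) \<le> K (Suc n)"
    proof -
      have "(1 - s) * (real n + 1) \<le> real n + 1 - s"
        using s by (simp add: algebra_simps)
      then have "4 * (1 - s) * (real n + 1)\<^sup>2 \<le> c * (2 * real n + 2)"
        using mult_right_mono[of "(1 - s) * (real n + 1)" "real n + 1 - s" "4 * (real n + 1)"]
        by (simp add: c_def power2_eq_square algebra_simps)
      then have "K n / (c * (2 * real n + 2)) \<le> K n / (4 * (1 - s) * (real n + 1)\<^sup>2)"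
        using K0[of n] s c by (intro divide_left_mono mult_pos_pos) auto
      also have "\<dots> = K (Suc n)"
        by (simp add: K_def power_mult_distrib mult_ac add.commute)
      finally show ?thesis by simp
    qed
    ultimately have "norm (Bn (Suc n) (Z y)) \<le> K (Suc n) * y powr (2 * real n + 2)" if "0 < y" "y \<le> Y" for y
      using that by (meson mult_right_mono order_trans powr_ge_zero)
    moreover have "2 * real (Suc n) = 2 * real n + 2" by simp
    ultimately show ?case by (simp only:) blast
  qed
  have "norm (Bn n (Z Y)) \<le> N * (Y\<^sup>2 / (4 * (1 - s))) ^ n / (fact n)\<^sup>2" for n
  proof -
    have "Y powr (2 * real n) = (Y\<^sup>2) ^ n"
      using Y powr_realpow[of Y "2 * n"] by (simp add: power_mult)
    moreover have "norm (Bn n (Z Y)) \<le> K n * Y powr (2 * real n)"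
      using bound[of n] Y by simp
    ultimately show ?thesis
      by (simp add: K_def power_divide mult_ac)
  qed
  then show ?thesis
    using s by (intro eq_0_of_power_bounds[of "Z Y" N "Y\<^sup>2 / (4 * (1 - s))"]) (auto simp: Bn_def)
qed

end

section \<open>The extension problem\<close>

lemma Gamma_real_neq_0: "0 < x \<Longrightarrow> Gamma (x::real) \<noteq> 0"
  using Gamma_real_pos[of x] by (intro notI) simp

lemma c_const_neq_0:
  assumes "0 < s" "s < 1" shows "c_const s \<noteq> 0"
  using assms Gamma_real_neq_0[of s] Gamma_real_neq_0[of "1 - s"] by (simp add: c_const_def)

context bounded_semigroup
begin

section \<open>Converse directions, classical solutions and the final statement\<close>

lemma powr_vector_derivative_ext:
  assumes s: "0 < s" and y: "0 < y"
  shows "y powr (1 - 2 * s) *\<^sub>R vector_derivative (ext T s u) (at y) = ext_flux s u y"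
  using y powr_add[of y "1 - 2 * s" "2 * s - 1"]
  by (simp add: vector_derivative_at[OF ext_has_vector_derivative[OF y s]])

lemma powr_vector_derivative_ext_tendsto_iff:
  assumes "0 < s"
  shows "((\<lambda>y. y powr (1 - 2 * s) *\<^sub>R vector_derivative (ext T s u) (at y)) \<longlongrightarrow> l) (at_right 0)
    \<longleftrightarrow> (ext_flux s u \<longlongrightarrow> l) (at_right 0)"
  by (intro filterlim_cong refl eventually_at_right_0I powr_vector_derivative_ext assms)

lemma frac_power_J:
  assumes s: "0 < s" "s < 1" and p: "1 < p" and y: "0 < y"
  shows "Bpow s (J p y x) = J p y (Bpow s x)"
  unfolding J_def by (rule bounded_frac_power_\<Phi>[OF s cont_integrable_J[OF p y], symmetric])

lemma range_of_flux_limit: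
  assumes s: "0 < s" "s < 1" and l: "(ext_flux s u \<longlongrightarrow> l) (at_right 0)"
  shows "u \<in> range (Bpow s)"
proof -
  interpret F: bounded_linear "Bpow s" by (rule bounded_linear_bounded_frac_power[OF s])
  note c = c_const_neq_0[OF s]
  have "\<forall>\<^sub>F y in at_right 0. Bpow s (ext_flux s u y) = ext_flux s (Bpow s u) y"
    using s by (intro eventually_at_right_0I) (simp add: ext_flux_def F.scaleR F.diff frac_power_J)
  with F.tendsto[OF l] have "(ext_flux s (Bpow s u) \<longlongrightarrow> Bpow s l) (at_right 0)"
    by (rule Lim_transform_eventually)
  then have "Bpow s l = c_const s *\<^sub>R u"
    using ext_flux_tendsto[OF s, of u] tendsto_unique[OF trivial_limit_at_right_real] by blast
  then have "u = Bpow s ((1 / c_const s) *\<^sub>R l)"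
    using c by (simp add: F.scaleR)
  then show ?thesis by blast
qed

lemma range_of_quotient_limit:
  assumes s: "0 < s" "s < 1" and l: "((\<lambda>y. (ext T s u y - u) /\<^sub>R y powr (2 * s)) \<longlongrightarrow> l) (at_right 0)"
  shows "u \<in> range (Bpow s)"
proof -
  interpret F: bounded_linear "Bpow s" by (rule bounded_linear_bounded_frac_power[OF s])
  have c: "c_const s / (2 * s) \<noteq> 0" using s c_const_neq_0[OF s] by simp
  have "\<forall>\<^sub>F y in at_right 0. Bpow s ((ext T s u y - u) /\<^sub>R y powr (2 * s))
      = (ext T s (Bpow s u) y - Bpow s u) /\<^sub>R y powr (2 * s)"
    using s by (intro eventually_at_right_0I) (simp add: ext_eq_J F.scaleR F.diff frac_power_J)
  with F.tendsto[OF l] have "((\<lambda>y. (ext T s (Bpow s u) y - Bpow s u) /\<^sub>R y powr (2 * s))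
      \<longlongrightarrow> Bpow s l) (at_right 0)"
    by (rule Lim_transform_eventually)
  from tendsto_unique[OF trivial_limit_at_right_real this ext_quotient_tendsto[OF s, of u]]
  have "Bpow s l = (c_const s / (2 * s)) *\<^sub>R u" .
  then have "u = Bpow s ((1 / (c_const s / (2 * s))) *\<^sub>R l)"
    using c by (simp only: F.scaleR scaleR_scaleR) simp
  then show ?thesis by blast
qed

lemma ext_classical_solution:
  assumes s: "0 < s" "s < 1"
  shows "classical_solution D L s (Bpow s f) (c_const s *\<^sub>R f) (ext T s (Bpow s f))"
proof -
  define u where "u = Bpow s f"
  define C where "C = 4 powr s * Gamma s"
  have C: "C \<noteq> 0" using Gamma_real_neq_0[OF s(1)] by (simp add: C_def)
  define V1 where "V1 y = y powr (2 * s - 1) *\<^sub>R ext_flux s u y" for y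
  \<comment> \<open>The product rule for y^(2s-1) times the flux. Its first term is already - L U,
    and its second cancels the first-order term of the equation.\<close>
  define V2 where "V2 y = y powr (2 * s - 1) *\<^sub>R (- (y / C) *\<^sub>R L (J (1 + s) y u))
     + ((2 * s - 1) * y powr (2 * s - 1 - 1)) *\<^sub>R ext_flux s u y" for y
  have s1: "1 < 1 + s" "1 < 2 + s" using s by auto
  have LJ: "L (J (1 + s) y u) = (1 + s) *\<^sub>R J (2 + s) y u - (y\<^sup>2 / 4) *\<^sub>R J (3 + s) y u" if "0 < y" for y
    using L_J(2)[OF that s1(1), of u] by (simp add: add.commute)
  \<comment> \<open>L itself is not assumed continuous, so continuity of L U is read off the
    explicit formula \<open>LJ\<close>.\<close>
  have contLJ: "continuous_on {0<..} (\<lambda>y. L (J (1 + s) y u))"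
  proof (rule continuous_on_eq)
    show "continuous_on {0<..} (\<lambda>y. (1 + s) *\<^sub>R J (2 + s) y u - (y\<^sup>2 / 4) *\<^sub>R J (3 + s) y u)"
      using s by (intro continuous_intros continuous_on_J) auto
  qed (simp add: LJ)
  have ext: "ext T s u y = (y powr (2 * s) / C) *\<^sub>R J (1 + s) y u" if "0 < y" for y
    using ext_eq_J[OF that, of s u] by (simp add: C_def)
  have extD: "ext T s u y \<in> D" "L (ext T s u y) = (y powr (2 * s) / C) *\<^sub>R L (J (1 + s) y u)" if "0 < y" for y
    using L_scaleR[OF L_J(1)[OF that s1(1)], of "y powr (2 * s) / C" u] by (simp_all add: ext that)
  have cont_ext: "continuous_on {0<..} (ext T s u)"
    by (intro continuous_at_imp_continuous_on ballI has_vector_derivative_continuous[OF ext_has_vector_derivative]) (use s in auto)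
  have cont_Lext: "continuous_on {0<..} (\<lambda>y. L (ext T s u y))"
  proof (rule continuous_on_eq)
    show "continuous_on {0<..} (\<lambda>y. (y powr (2 * s) / C) *\<^sub>R L (J (1 + s) y u))"
      using C by (intro continuous_intros contLJ) auto
  qed (simp add: extD)
  have cont_flux: "continuous_on {0<..} (ext_flux s u)"
    by (intro continuous_at_imp_continuous_on ballI has_vector_derivative_continuous[OF ext_flux_has_vector_derivative]) (use s in auto)
  have 1: "continuous_into_domain D L (ext T s u)"
    unfolding continuous_into_domain_def
  proof (intro conjI allI impI extD)
    fix y :: real assume y: "0 < y"
    have t: "(g \<longlongrightarrow> g y) (at y)" if "continuous_on {0<..} g" for g :: "real \<Rightarrow> 'a"
      using continuous_on_interior[OF that, of y] y by (simp add: interior_open isCont_def)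
    have "((\<lambda>z. norm (ext T s u z - ext T s u y) + norm (L (ext T s u z) - L (ext T s u y))) \<longlongrightarrow>
        norm (ext T s u y - ext T s u y) + norm (L (ext T s u y) - L (ext T s u y))) (at y)"
      by (intro tendsto_intros t[OF cont_ext] t[OF cont_Lext])
    moreover have "\<forall>\<^sub>F z in at y. norm (ext T s u z - ext T s u y) + norm (L (ext T s u z) - L (ext T s u y)) = graph_norm L (ext T s u z - ext T s u y)"
    proof -
      have "\<forall>\<^sub>F z in at y. 0 < z"
        using y eventually_at_topological[of "\<lambda>z. 0 < z" y UNIV] by (auto intro!: exI[of _ "{0<..}"])
      then show ?thesis
        by eventually_elim (use y in \<open>simp add: graph_norm_def L_diff extD\<close>)
    qed
    ultimately show "((\<lambda>z. graph_norm L (ext T s u z - ext T s u y)) \<longlongrightarrow> 0) (at y)"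
      using Lim_transform_eventually by fastforce
  qed
  have 2: "(V1 has_vector_derivative V2 y) (at y)" if "0 < y" for y
    unfolding V1_def V2_def C_def using that s
    by (intro has_vector_derivative_scaleR ext_flux_has_vector_derivative) (auto intro!: derivative_eq_intros)
  have 3: "L (ext T s u y) + ((1 - 2 * s) / y) *\<^sub>R V1 y + V2 y = 0" if y: "0 < y" for y
  proof -
    have "y powr (2 * s - 1) * (y / C) = y powr (2 * s) / C"
      using y by (simp add: powr_diff)
    moreover have "(1 - 2 * s) / y * y powr (2 * s - 1) = - ((2 * s - 1) * y powr (2 * s - 1 - 1))"
      using y powr_diff[of y "2 * s - 1" 1] by (simp add: field_simps)
    ultimately show ?thesis
      by (auto simp: V1_def V2_def extD[OF y])
  qed
  have 4: "continuous_on {0<..} V2"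
    unfolding V2_def using C by (intro continuous_intros contLJ cont_flux) auto
  \<comment> \<open>U - u is y^(2s) times the quotient of (b), whose limit exists.\<close>
  have 5: "(ext T s u \<longlongrightarrow> u) (at_right 0)"
  proof -
    have "((\<lambda>y::real. y powr (2 * s)) \<longlongrightarrow> 0) (at_right 0)" using s by real_asymp
    from tendsto_add[OF tendsto_const tendsto_scaleR[OF this ext_quotient_tendsto[OF s, of f]], of u]
    have "((\<lambda>y. u + y powr (2 * s) *\<^sub>R ((ext T s u y - u) /\<^sub>R y powr (2 * s))) \<longlongrightarrow> u) (at_right 0)"
      by (simp add: u_def)
    then show ?thesis
      by (rule Lim_transform_eventually) (auto intro!: eventually_at_right_0I)
  qed
  have 6: "((\<lambda>y. y powr (1 - 2 * s) *\<^sub>R V1 y) \<longlongrightarrow> c_const s *\<^sub>R f) (at_right 0)"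
  proof (rule Lim_transform_eventually[OF ext_flux_tendsto[OF s, of f]])
    have "y powr (1 - 2 * s) * y powr (2 * s - 1) = 1" if "0 < y" for y :: real
      using that by (simp add: powr_add[symmetric])
    then show "\<forall>\<^sub>F y in at_right 0. ext_flux s (Bpow s f) y = y powr (1 - 2 * s) *\<^sub>R V1 y"
      by (intro eventually_at_right_0I) (simp add: V1_def u_def)
  qed
  show ?thesis
    unfolding classical_solution_def u_def[symmetric]
    using 1 2 3 4 5 6 ext_has_vector_derivative[of _ s u] s
    by (intro conjI exI[of _ V1] exI[of _ V2] allI impI) (auto simp: V1_def)
qed

lemma classical_solution_unique:
  assumes s: "0 < s" "s < 1" and V: "classical_solution D L s u g V" and W: "classical_solution D L s u g W" and y: "0 < y"
  shows "V y = W y"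
proof -
  obtain V1 V2 where V: "\<And>y. 0 < y \<Longrightarrow> V y \<in> D" "\<And>y. 0 < y \<Longrightarrow> (V has_vector_derivative V1 y) (at y)"
    "\<And>y. 0 < y \<Longrightarrow> (V1 has_vector_derivative V2 y) (at y)"
    "\<And>y. 0 < y \<Longrightarrow> L (V y) + ((1 - 2 * s) / y) *\<^sub>R V1 y + V2 y = 0"
    "(V \<longlongrightarrow> u) (at_right 0)" "((\<lambda>y. y powr (1 - 2 * s) *\<^sub>R V1 y) \<longlongrightarrow> g) (at_right 0)"
    using V unfolding classical_solution_def continuous_into_domain_def by blast
  obtain W1 W2 where W: "\<And>y. 0 < y \<Longrightarrow> W y \<in> D" "\<And>y. 0 < y \<Longrightarrow> (W has_vector_derivative W1 y) (at y)"
    "\<And>y. 0 < y \<Longrightarrow> (W1 has_vector_derivative W2 y) (at y)"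
    "\<And>y. 0 < y \<Longrightarrow> L (W y) + ((1 - 2 * s) / y) *\<^sub>R W1 y + W2 y = 0"
    "(W \<longlongrightarrow> u) (at_right 0)" "((\<lambda>y. y powr (1 - 2 * s) *\<^sub>R W1 y) \<longlongrightarrow> g) (at_right 0)"
    using W unfolding classical_solution_def continuous_into_domain_def by blast
  have "V y - W y = 0"
  proof (rule solution_eq_0[OF s _ _ _ _ _ _ y])
    show "V y - W y \<in> D" if "0 < y" for y
      using L_diff[OF V(1) W(1), OF that that] by simp
    show "((\<lambda>y. V y - W y) has_vector_derivative V1 y - W1 y) (at y)" if "0 < y" for y
      by (intro has_vector_derivative_diff V W that)
    show "((\<lambda>y. V1 y - W1 y) has_vector_derivative V2 y - W2 y) (at y)" if "0 < y" for y
      by (intro has_vector_derivative_diff V W that)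
    show "L (V y - W y) + ((1 - 2 * s) / y) *\<^sub>R (V1 y - W1 y) + (V2 y - W2 y) = 0" if y: "0 < y" for y
    proof -
      have "L (V y - W y) = L (V y) - L (W y)"
        using L_diff[OF V(1) W(1), OF y y] by simp
      then have "L (V y - W y) + ((1 - 2 * s) / y) *\<^sub>R (V1 y - W1 y) + (V2 y - W2 y)
          = (L (V y) + ((1 - 2 * s) / y) *\<^sub>R V1 y + V2 y) - (L (W y) + ((1 - 2 * s) / y) *\<^sub>R W1 y + W2 y)"
        by (simp add: scaleR_diff_right)
      then show ?thesis
        by (simp only: V(4)[OF y] W(4)[OF y] diff_0_right)
    qed
    show "((\<lambda>y. V y - W y) \<longlongrightarrow> 0) (at_right 0)"
      using tendsto_diff[OF V(5) W(5)] by simp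
    show "((\<lambda>y. y powr (1 - 2 * s) *\<^sub>R (V1 y - W1 y)) \<longlongrightarrow> 0) (at_right 0)"
      using tendsto_diff[OF V(6) W(6)] by (simp add: scaleR_diff_right)
  qed
  then show ?thesis by simp
qed

lemma frac_power_domain_eq: "frac_power_domain D (\<lambda>x. - L x) s = range (Bpow s)"
  by (simp add: frac_power_domain_def B_def)

text \<open>On the range, \<open>inv\<close> selects a preimage under B^s, so results stated for
  \<open>Bpow s f\<close> with arbitrary \<open>f\<close> apply to
  \<open>frac_power\<close>.\<close>

lemma bounded_frac_power_frac_power:
  "u \<in> frac_power_domain D (\<lambda>x. - L x) s \<Longrightarrow> Bpow s (frac_power D (\<lambda>x. - L x) s u) = u"
  unfolding frac_power_domain_eq by (simp add: frac_power_def B_def[symmetric] f_inv_into_f)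

lemma ext_representation:
  fixes f :: 'a
  assumes s: "0 < s" "s < 1" and y: "0 < y"
  defines "u \<equiv> Bpow s f"
  shows "integrable_pos (\<lambda>t. ((exp (- (y\<^sup>2 / (4 * t))) - 1) / t powr (1 - s)) *\<^sub>R T t f)"
    and "ext T s u y = u + (1 / Gamma s) *\<^sub>R int_pos (\<lambda>t. ((exp (- (y\<^sup>2 / (4 * t))) - 1) / t powr (1 - s)) *\<^sub>R T t f)"
    and "integrable_pos (\<lambda>r. ((exp (- r) - 1) / r powr (1 + s)) *\<^sub>R T (y\<^sup>2 / (4 * r)) f)"
    and "ext T s u y = u + (y powr (2 * s) / (4 powr s * Gamma s)) *\<^sub>R
      int_pos (\<lambda>r. ((exp (- r) - 1) / r powr (1 + s)) *\<^sub>R T (y\<^sup>2 / (4 * r)) f)"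
proof -
  have b: "0 < y\<^sup>2 / 4" using y by simp
  have p: "(y\<^sup>2 / 4) powr s = y powr (2 * s) / 4 powr s"
    using y powr_powr[of y 2 s] by (simp add: powr_divide powr_numeral)
  let ?d = "\<lambda>t. (exp (- (y\<^sup>2 / 4) / t) - 1) * t powr (s - 1)"
  have eq: "((exp (- (y\<^sup>2 / (4 * t))) - 1) / t powr (1 - s)) *\<^sub>R T t f = ?d t *\<^sub>R T t f" for t
    using powr_minus_divide[of t "1 - s"] by simp
  show "integrable_pos (\<lambda>t. ((exp (- (y\<^sup>2 / (4 * t))) - 1) / t powr (1 - s)) *\<^sub>R T t f)"
    unfolding eq by (intro cont_integrable_integrable_pos cont_integrable_T cont_integrable_exp_inverse_diff b s)
  show "ext T s u y = u + (1 / Gamma s) *\<^sub>R int_pos (\<lambda>t. ((exp (- (y\<^sup>2 / (4 * t))) - 1) / t powr (1 - s)) *\<^sub>R T t f)"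
    unfolding eq using ext_frac_power[OF s y, of f] by (simp add: u_def \<Phi>_def)
  note r = \<Phi>_exp_minus_one[OF s b, of f]
  show "integrable_pos (\<lambda>r. ((exp (- r) - 1) / r powr (1 + s)) *\<^sub>R T (y\<^sup>2 / (4 * r)) f)"
    using cont_integrable_integrable_pos[OF r(1)] by simp
  show "ext T s u y = u + (y powr (2 * s) / (4 powr s * Gamma s)) *\<^sub>R
      int_pos (\<lambda>r. ((exp (- r) - 1) / r powr (1 + s)) *\<^sub>R T (y\<^sup>2 / (4 * r)) f)"
    using ext_frac_power[OF s y, of f] unfolding r(2) p by (simp add: u_def)
qed

end

theorem theorem5p1:
  fixes T :: "real \<Rightarrow> ('a::banach \<Rightarrow>\<^sub>L 'a)"
    and D :: "'a set" and L :: "'a \<Rightarrow> 'a" and s :: real and u :: 'a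
  assumes "C0_semigroup T" and "uniformly_bounded T" and "is_generator D L T"
    and "0 \<in> resolvent_set D L"
    and "0 < s" and "s < 1"
  shows
    "(\<forall>y>0. integrable_pos (ext_integrand T s u y) \<and>
            (ext T s u) differentiable (at y))
   \<and>
     (u \<in> frac_power_domain D (\<lambda>x. - L x) s \<longrightarrow>
       (\<forall>f. f = frac_power D (\<lambda>x. - L x) s u \<longrightarrow>
         (\<forall>y>0.
            integrable_pos
              (\<lambda>t. ((exp (- (y\<^sup>2 / (4 * t))) - 1) / t powr (1 - s)) *\<^sub>R T t f) \<and>
            ext T s u y =
              u + (1 / Gamma s) *\<^sub>R
                int_pos (\<lambda>t. ((exp (- (y\<^sup>2 / (4 * t))) - 1) / t powr (1 - s)) *\<^sub>R T t f) \<and>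
            integrable_pos
              (\<lambda>r. ((exp (- r) - 1) / r powr (1 + s)) *\<^sub>R T (y\<^sup>2 / (4 * r)) f) \<and>
            ext T s u y =
              u + (y powr (2 * s) / (4 powr s * Gamma s)) *\<^sub>R
                int_pos (\<lambda>r. ((exp (- r) - 1) / r powr (1 + s)) *\<^sub>R T (y\<^sup>2 / (4 * r)) f))))
   \<and>
     (u \<in> frac_power_domain D (\<lambda>x. - L x) s \<longleftrightarrow>
       (\<exists>l. ((\<lambda>y. y powr (1 - 2 * s) *\<^sub>R vector_derivative (ext T s u) (at y)) \<longlongrightarrow> l)
              (at_right 0)))
   \<and>
     (u \<in> frac_power_domain D (\<lambda>x. - L x) s \<longleftrightarrow>
       (\<exists>l. ((\<lambda>y. (ext T s u y - u) /\<^sub>R y powr (2 * s)) \<longlongrightarrow> l) (at_right 0)))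
   \<and>
     (u \<in> frac_power_domain D (\<lambda>x. - L x) s \<longrightarrow>
       ((\<lambda>y. y powr (1 - 2 * s) *\<^sub>R vector_derivative (ext T s u) (at y))
          \<longlongrightarrow> c_const s *\<^sub>R frac_power D (\<lambda>x. - L x) s u) (at_right 0) \<and>
       (\<exists>l. ((\<lambda>y. (ext T s u y - u) /\<^sub>R y powr (2 * s)) \<longlongrightarrow> l) (at_right 0) \<and>
            c_const s *\<^sub>R frac_power D (\<lambda>x. - L x) s u = (2 * s) *\<^sub>R l))
   \<and>
     (u \<in> frac_power_domain D (\<lambda>x. - L x) s \<longrightarrow>
       classical_solution D L s u (c_const s *\<^sub>R frac_power D (\<lambda>x. - L x) s u) (ext T s u) \<and>
       (\<forall>V. classical_solution D L s u (c_const s *\<^sub>R frac_power D (\<lambda>x. - L x) s u) V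
              \<longrightarrow> (\<forall>y>0. V y = ext T s u y)))"
proof -
  obtain M where "1 \<le> M" "\<And>t. 0 \<le> t \<Longrightarrow> norm (T t) \<le> M"
    using assms(2) unfolding uniformly_bounded_def by blast
  then interpret bounded_semigroup T D L M
    using assms(1,3,4) by unfold_locales auto
  note s = assms(5,6)
  let ?f = "frac_power D (\<lambda>x. - L x) s u" and ?dom = "u \<in> frac_power_domain D (\<lambda>x. - L x) s"
  have fp: "Bpow s (?f) = u" if "?dom"
    using that by (rule bounded_frac_power_frac_power)
  have flux: "(ext_flux s u \<longlongrightarrow> c_const s *\<^sub>R ?f) (at_right 0)"
    and quotient: "((\<lambda>y. (ext T s u y - u) /\<^sub>R y powr (2 * s)) \<longlongrightarrow>
      (c_const s / (2 * s)) *\<^sub>R ?f) (at_right 0)"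
    and solution: "classical_solution D L s u (c_const s *\<^sub>R ?f) (ext T s u)"
    if "?dom"
    using ext_flux_tendsto[OF s, of "?f"]
      ext_quotient_tendsto[OF s, of "?f"]
      ext_classical_solution[OF s, of "?f"]
    unfolding fp[OF that] by blast+
  show ?thesis
    \<comment> \<open>From here on the limits of y^(1-2s) U' are limits of
      \<open>ext_flux\<close>.\<close>
    unfolding powr_vector_derivative_ext_tendsto_iff[OF s(1)]
  proof (intro conjI allI impI iffI)
    fix y :: real assume y: "0 < y"
    show "integrable_pos (ext_integrand T s u y)"
      by (rule integrable_ext_integrand[OF y s(1)])
    show "ext T s u differentiable at y"
      using ext_has_vector_derivative[OF y s(1)] by (auto simp: has_vector_derivative_def differentiable_def)
  next
    fix f and y :: real
    assume u: "?dom" and f: "f = ?f" and y: "0 < y"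
    note r = ext_representation[OF s y, of f]
    show "integrable_pos (\<lambda>t. ((exp (- (y\<^sup>2 / (4 * t))) - 1) / t powr (1 - s)) *\<^sub>R T t f)"
      by (rule r(1))
    show "integrable_pos (\<lambda>r. ((exp (- r) - 1) / r powr (1 + s)) *\<^sub>R T (y\<^sup>2 / (4 * r)) f)"
      by (rule r(3))
    show "ext T s u y = u + (1 / Gamma s) *\<^sub>R int_pos (\<lambda>t. ((exp (- (y\<^sup>2 / (4 * t))) - 1) / t powr (1 - s)) *\<^sub>R T t f)"
      using r(2) unfolding f fp[OF u] .
    show "ext T s u y = u + (y powr (2 * s) / (4 powr s * Gamma s)) *\<^sub>R
        int_pos (\<lambda>r. ((exp (- r) - 1) / r powr (1 + s)) *\<^sub>R T (y\<^sup>2 / (4 * r)) f)"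
      using r(4) unfolding f fp[OF u] .
  next
    assume u: "?dom"
    show "(ext_flux s u \<longlongrightarrow> c_const s *\<^sub>R ?f) (at_right 0)"
      by (rule flux[OF u])
    then show "\<exists>l. (ext_flux s u \<longlongrightarrow> l) (at_right 0)" by blast
    show "\<exists>l. ((\<lambda>y. (ext T s u y - u) /\<^sub>R y powr (2 * s)) \<longlongrightarrow> l) (at_right 0)"
      using quotient[OF u] by blast
    show "\<exists>l. ((\<lambda>y. (ext T s u y - u) /\<^sub>R y powr (2 * s)) \<longlongrightarrow> l) (at_right 0) \<and>
        c_const s *\<^sub>R ?f = (2 * s) *\<^sub>R l"
      using quotient[OF u] s by (intro exI conjI) auto
    show "classical_solution D L s u (c_const s *\<^sub>R ?f) (ext T s u)"
      by (rule solution[OF u])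
    then show "V y = ext T s u y"
      if "classical_solution D L s u (c_const s *\<^sub>R ?f) V" "0 < y" for V y
      using classical_solution_unique[OF s that(1) _ that(2)] by blast
  next
    assume "\<exists>l. (ext_flux s u \<longlongrightarrow> l) (at_right 0)"
    then show "?dom"
      unfolding frac_power_domain_eq using range_of_flux_limit[OF s] by blast
  next
    assume "\<exists>l. ((\<lambda>y. (ext T s u y - u) /\<^sub>R y powr (2 * s)) \<longlongrightarrow> l) (at_right 0)"
    then show "?dom"
      unfolding frac_power_domain_eq using range_of_quotient_limit[OF s] by blast
  qed
qed

end
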